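(* Let $\alpha>-1/2$, and let $\zeta$ be a positive function on $\mathbb{R}^{d+1}_+$ with $\zeta(\xi)\ge1$ for all $\xi\in\mathbb{R}^{d+1}_+$ and $\zeta^{-1}\in L^1_\alpha(\mathbb{R}^{d+1}_+)$. Let $m$ be a function in $L^\infty_\alpha(\mathbb{R}^{d+1}_+)$ and $\sigma>0$. For any $h\in L^2_\alpha(\mathbb{R}^{d+1}_+)$ and for any $\eta>0$, there exists a unique function $\varphi^*_{\eta,h,\sigma}$ where the infimum $$\inf_{\varphi\in\mathcal{H}_\zeta(\mathbb{R}^{d+1}_+)}\Big\{\eta\|\varphi\|_\zeta^2+\|h-\mathcal{T}_{w,m,\sigma}\varphi\|_{\alpha,2}^2\Big\}$$ is attained. Moreover, the extremal function $\varphi^*_{\eta,h,\sigma}$ is given by $$\varphi^*_{\eta,h,\sigma}(y)=\int_{\mathbb{R}^{d+1}_+}h(x)\,\overline{\Theta_{\zeta,\eta}(x,y)}\,d\mu_\alpha(x),$$ where $$\Theta_{\zeta,\eta}(x,y)=\int_{\mathbb{R}^{d+1}_+}\frac{m_\sigma(\xi)\,\Lambda^d_\alpha(x,\xi)}{\eta\zeta(\xi)+|m_\sigma(\xi)|^2}\,\Lambda^d_\alpha(-y,\xi)\,d\mu_\alpha(\xi).$$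
   Context: Notation: $d$ is a positive integer; $\mathbb{R}^{d+1}_+=\mathbb{R}^d\times(0,\infty)$; $x=(x',x_{d+1})$; $-x$ denotes $(-x',x_{d+1})$ (only the first $d$ coordinates change sign). $L^p_\alpha(\mathbb{R}^{d+1}_+)$ is the $L^p$ space, with norm $\|\cdot\|_{\alpha,p}$, of the measure $$d\mu_\alpha(x)=\frac{x_{d+1}^{2\alpha+1}}{(2\pi)^{d}2^{2\alpha}\Gamma^2(\alpha+1)}\,dx\quad\text{on }\mathbb{R}^{d+1}_+.$$ The Weinstein kernel is $\Lambda^d_\alpha(\lambda,x)=e^{-i\langle x',\lambda'\rangle}j_\alpha(x_{d+1}\lambda_{d+1})$, where $j_\alpha$ is the normalized Bessel function of index $\alpha$, $j_\alpha(t)=\Gamma(\alpha+1)\sum_{k\ge0}\frac{(-1)^k t^{2k}}{2^{2k}k!\,\Gamma(\alpha+k+1)}$. The Weinstein transform is $\mathcal{F}_{W,\alpha}(\varphi)(\lambda)=\int_{\mathbb{R}^{d+1}_+}\varphi(x)\Lambda^d_\alpha(\lambda,x)\,d\mu_\alpha(x)$ for $\varphi\in L^1_\alpha(\mathbb{R}^{d+1}_+)$, extended to $L^2_\alpha(\mathbb{R}^{d+1}_+)$ by the Plancherel theorem; the inverse transform is given by $\mathcal{F}^{-1}_{W,\alpha}g(\lambda)=\mathcal{F}_{W,\alpha}g(-\lambda)$. Multiplier operators: $m_\sigma(x)=m(\sigma x)$ and $\mathcal{T}_{w,m,\sigma}\varphi=\mathcal{F}^{-1}_{W,\alpha}\big(m_\sigma\,\mathcal{F}_{W,\alpha}(\varphi)\big)$.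 The Hilbert space $\mathcal{H}_\zeta(\mathbb{R}^{d+1}_+)=\{\varphi\in L^2_\alpha(\mathbb{R}^{d+1}_+):\sqrt\zeta\,\mathcal{F}_{W,\alpha}(\varphi)\in L^2_\alpha(\mathbb{R}^{d+1}_+)\}$ has inner product $\langle\varphi,\psi\rangle_\zeta=\int_{\mathbb{R}^{d+1}_+}\zeta(\xi)\mathcal{F}_{W,\alpha}(\varphi)(\xi)\overline{\mathcal{F}_{W,\alpha}(\psi)(\xi)}\,d\mu_\alpha(\xi)$ and norm $\|\varphi\|_\zeta=\sqrt{\langle\varphi,\varphi\rangle_\zeta}$.
   Formalization: Two printed formulas are corrected: the denominator in the measure is its square root, (2π)^{d/2} 2^α Γ(α+1), so the stated inversion formula holds; and Θ uses Λ(-x,ξ)Λ(y,ξ) in place of Λ(x,ξ)Λ(-y,ξ), the two agreeing when m and ζ are even in ξ'. *)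

theory Defs
  imports "HOL-Analysis.Analysis"
begin

text \<open>
  A point of $R^{d+1}$ is a pair (x', t) of type \<open>(real ^ 'd) \<times> real\<close>, with
  d = \<open>CARD('d)\<close> and t the last coordinate.  Functions on the open upper half-space are
  functions on this type; the measure lives on the half-space only, so values elsewhere are
  irrelevant.  Elements of the Lebesgue spaces are functions, and equality in these spaces is
  equality almost everywhere.
\<close>

definition half_space :: "((real ^ 'd) \<times> real) set" where
  "half_space = {x. 0 < snd x}"

definition reflect :: "(real ^ 'd) \<times> real \<Rightarrow> (real ^ 'd) \<times> real" where
  "reflect x = (- fst x, snd x)"

text \<open>
  The constant is the one for which the Gaussian exp (- |x|^2 / 2) is its own Weinstein
  transform, so that the transform is an isometry of L2 with inverse g \<open>\<mapsto>\<close> F g \<open>\<circ>\<close> reflect.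
  The literature also prints the square of this denominator, (2 pi)^d 2^(2 alpha)
  Gamma(alpha + 1)^2; if that constant is used both in the transform and in the norms,
  the inversion formula is off by a constant factor different from 1.
\<close>

definition weinstein_measure :: "real \<Rightarrow> ((real ^ 'd) \<times> real) measure" where
  "weinstein_measure \<alpha> = density (lebesgue_on half_space)
     (\<lambda>x. ennreal (snd x powr (2 * \<alpha> + 1) /
        ((2 * pi) powr (real CARD('d) / 2) * 2 powr \<alpha> * Gamma (\<alpha> + 1))))"

definition L2 :: "real \<Rightarrow> ((real ^ 'd) \<times> real \<Rightarrow> complex) set" where
  "L2 \<alpha> = {f. f \<in> borel_measurable (weinstein_measure \<alpha>) \<and>
              integrable (weinstein_measure \<alpha>) (\<lambda>x. (cmod (f x))\<^sup>2)}"

definition L2_norm :: "real \<Rightarrow> ((real ^ 'd) \<times> real \<Rightarrow> complex) \<Rightarrow> real" where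
  "L2_norm \<alpha> f = sqrt (\<integral>x. (cmod (f x))\<^sup>2 \<partial>weinstein_measure \<alpha>)"

definition Linfinity :: "real \<Rightarrow> ((real ^ 'd) \<times> real \<Rightarrow> complex) set" where
  "Linfinity \<alpha> = {f. f \<in> borel_measurable (weinstein_measure \<alpha>) \<and>
              (\<exists>C. AE x in weinstein_measure \<alpha>. cmod (f x) \<le> C)}"

definition L2_tendsto ::
  "real \<Rightarrow> (nat \<Rightarrow> (real ^ 'd) \<times> real \<Rightarrow> complex) \<Rightarrow> ((real ^ 'd) \<times> real \<Rightarrow> complex) \<Rightarrow> bool" where
  "L2_tendsto \<alpha> f g \<longleftrightarrow> (\<forall>n. f n \<in> L2 \<alpha>) \<and> g \<in> L2 \<alpha> \<and>
     (\<lambda>n. L2_norm \<alpha> (\<lambda>x. f n x - g x)) \<longlonglongrightarrow> 0"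

definition bessel_j :: "real \<Rightarrow> real \<Rightarrow> real" where
  "bessel_j \<alpha> t = Gamma (\<alpha> + 1) *
     (\<Sum>k. (-1) ^ k * t ^ (2 * k) / (2 ^ (2 * k) * fact k * Gamma (\<alpha> + real k + 1)))"

definition weinstein_kernel ::
  "real \<Rightarrow> (real ^ 'd) \<times> real \<Rightarrow> (real ^ 'd) \<times> real \<Rightarrow> complex" where
  "weinstein_kernel \<alpha> l x =
     exp (- (\<i> * complex_of_real (fst x \<bullet> fst l))) * complex_of_real (bessel_j \<alpha> (snd x * snd l))"

definition weinstein_integral ::
  "real \<Rightarrow> ((real ^ 'd) \<times> real \<Rightarrow> complex) \<Rightarrow> (real ^ 'd) \<times> real \<Rightarrow> complex" where
  "weinstein_integral \<alpha> \<phi> l = (\<integral>x. \<phi> x * weinstein_kernel \<alpha> l x \<partial>weinstein_measure \<alpha>)"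

text \<open>
  On L1 the transform is the integral.  On the rest of L2 it is the extension by density from
  the intersection of L1 and L2: a representative, determined up to null sets, of the L2 limit
  of the integrals along an approximating sequence.
\<close>

definition weinstein ::
  "real \<Rightarrow> ((real ^ 'd) \<times> real \<Rightarrow> complex) \<Rightarrow> (real ^ 'd) \<times> real \<Rightarrow> complex" where
  "weinstein \<alpha> \<phi> =
     (if integrable (weinstein_measure \<alpha>) \<phi> then weinstein_integral \<alpha> \<phi>
      else (SOME g. \<exists>f. (\<forall>n. integrable (weinstein_measure \<alpha>) (f n)) \<and> L2_tendsto \<alpha> f \<phi> \<and>
                         L2_tendsto \<alpha> (\<lambda>n. weinstein_integral \<alpha> (f n)) g))"

definition inverse_weinstein ::
  "real \<Rightarrow> ((real ^ 'd) \<times> real \<Rightarrow> complex) \<Rightarrow> (real ^ 'd) \<times> real \<Rightarrow> complex" where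
  "inverse_weinstein \<alpha> g l = weinstein \<alpha> g (reflect l)"

definition dilate ::
  "((real ^ 'd) \<times> real \<Rightarrow> complex) \<Rightarrow> real \<Rightarrow> (real ^ 'd) \<times> real \<Rightarrow> complex" where
  "dilate m \<sigma> x = m (\<sigma> *\<^sub>R x)"

definition multiplier_op ::
  "real \<Rightarrow> ((real ^ 'd) \<times> real \<Rightarrow> complex) \<Rightarrow> real \<Rightarrow>
   ((real ^ 'd) \<times> real \<Rightarrow> complex) \<Rightarrow> (real ^ 'd) \<times> real \<Rightarrow> complex" where
  "multiplier_op \<alpha> m \<sigma> \<phi> = inverse_weinstein \<alpha> (\<lambda>\<xi>. dilate m \<sigma> \<xi> * weinstein \<alpha> \<phi> \<xi>)"

definition H_space ::
  "real \<Rightarrow> ((real ^ 'd) \<times> real \<Rightarrow> real) \<Rightarrow> ((real ^ 'd) \<times> real \<Rightarrow> complex) set" where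
  "H_space \<alpha> \<zeta> = {\<phi> \<in> L2 \<alpha>. (\<lambda>\<xi>. complex_of_real (sqrt (\<zeta> \<xi>)) * weinstein \<alpha> \<phi> \<xi>) \<in> L2 \<alpha>}"

definition H_inner ::
  "real \<Rightarrow> ((real ^ 'd) \<times> real \<Rightarrow> real) \<Rightarrow> ((real ^ 'd) \<times> real \<Rightarrow> complex) \<Rightarrow>
   ((real ^ 'd) \<times> real \<Rightarrow> complex) \<Rightarrow> complex" where
  "H_inner \<alpha> \<zeta> \<phi> \<psi> =
     (\<integral>\<xi>. complex_of_real (\<zeta> \<xi>) * weinstein \<alpha> \<phi> \<xi> * cnj (weinstein \<alpha> \<psi> \<xi>) \<partial>weinstein_measure \<alpha>)"

definition H_norm ::
  "real \<Rightarrow> ((real ^ 'd) \<times> real \<Rightarrow> real) \<Rightarrow> ((real ^ 'd) \<times> real \<Rightarrow> complex) \<Rightarrow> real" where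
  "H_norm \<alpha> \<zeta> \<phi> = sqrt (Re (H_inner \<alpha> \<zeta> \<phi> \<phi>))"

definition tikhonov ::
  "real \<Rightarrow> ((real ^ 'd) \<times> real \<Rightarrow> real) \<Rightarrow> ((real ^ 'd) \<times> real \<Rightarrow> complex) \<Rightarrow> real \<Rightarrow> real \<Rightarrow>
   ((real ^ 'd) \<times> real \<Rightarrow> complex) \<Rightarrow> ((real ^ 'd) \<times> real \<Rightarrow> complex) \<Rightarrow> real" where
  "tikhonov \<alpha> \<zeta> m \<sigma> \<eta> h \<phi> =
     \<eta> * (H_norm \<alpha> \<zeta> \<phi>)\<^sup>2 + (L2_norm \<alpha> (\<lambda>x. h x - multiplier_op \<alpha> m \<sigma> \<phi> x))\<^sup>2"

text \<open>
  The reflection belongs on x: as a function of x, the kernel is the inverse transform of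
  m(sigma xi) Lambda(y, xi) / (eta zeta(xi) + |m(sigma xi)|^2), so that pairing h with it gives
  the inverse transform of cnj (m(sigma xi)) F h(xi) / (eta zeta(xi) + |m(sigma xi)|^2) at y.
  Written with the reflection on y instead, the kernel is the same when m and zeta are
  invariant under \<open>reflect\<close>, but for other m and zeta it does not represent the minimiser.
\<close>

definition theta_integrand ::
  "real \<Rightarrow> ((real ^ 'd) \<times> real \<Rightarrow> real) \<Rightarrow> ((real ^ 'd) \<times> real \<Rightarrow> complex) \<Rightarrow> real \<Rightarrow> real \<Rightarrow>
   (real ^ 'd) \<times> real \<Rightarrow> (real ^ 'd) \<times> real \<Rightarrow> (real ^ 'd) \<times> real \<Rightarrow> complex" where
  "theta_integrand \<alpha> \<zeta> m \<sigma> \<eta> x y \<xi> =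
     dilate m \<sigma> \<xi> * weinstein_kernel \<alpha> (reflect x) \<xi> /
       complex_of_real (\<eta> * \<zeta> \<xi> + (cmod (dilate m \<sigma> \<xi>))\<^sup>2) * weinstein_kernel \<alpha> y \<xi>"

definition theta ::
  "real \<Rightarrow> ((real ^ 'd) \<times> real \<Rightarrow> real) \<Rightarrow> ((real ^ 'd) \<times> real \<Rightarrow> complex) \<Rightarrow> real \<Rightarrow> real \<Rightarrow>
   (real ^ 'd) \<times> real \<Rightarrow> (real ^ 'd) \<times> real \<Rightarrow> complex" where
  "theta \<alpha> \<zeta> m \<sigma> \<eta> x y = (\<integral>\<xi>. theta_integrand \<alpha> \<zeta> m \<sigma> \<eta> x y \<xi> \<partial>weinstein_measure \<alpha>)"

end

theory Submission
  imports Defs "HOL-Probability.Probability" "HOL-Real_Asymp.Real_Asymp"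
begin

text \<open>
  On the transform side the functional is the integral of a pointwise quadratic expression, and
  completing the square identifies the transform of the minimiser as
  \<open>F = cnj m\<^sub>\<sigma> * H / (\<eta> * \<zeta> + \<bar>m\<^sub>\<sigma>\<bar>\<^sup>2)\<close>, where \<open>H\<close> is the transform of \<open>h\<close>.  By
  \<open>2 * sqrt (\<eta> * \<zeta>) * \<bar>m\<^sub>\<sigma>\<bar> \<le> \<eta> * \<zeta> + \<bar>m\<^sub>\<sigma>\<bar>\<^sup>2\<close> and integrability of \<open>1 / \<zeta>\<close>, \<open>F\<close> is both
  integrable and square integrable, so the minimiser is an absolutely convergent inverse transform;
  the integral formula is then Parseval's identity for \<open>h\<close> and \<open>\<Theta>(\<cdot>, y)\<close>.

  The Plancherel theorem behind this comes from the Gaussians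
  \<open>exp (a \<bullet> x' + \<i> b \<bullet> x' - \<bar>x'\<bar>\<^sup>2 / 2 - s t\<^sup>2 / 2)\<close>, whose transforms are Gaussians of the same family.
  On their span inversion is explicit, and with the multiplication formula it yields the isometry.
  The span is dense in \<open>L\<^sup>1\<close> and \<open>L\<^sup>2\<close> simultaneously; as the kernel is bounded by 1,
  convergence in \<open>L\<^sup>1\<close> makes the transforms converge everywhere, and Fatou's lemma carries the isometry
  over to all of \<open>L\<^sup>1 \<inter> L\<^sup>2\<close>.
\<close>


subsection \<open>Square-integrable complex functions\<close>

text \<open>Two obstacles shape the development. The half-space is not compact, and a product of two
  of these Gaussians has the wrong width in x', so Stone-Weierstrass does not apply to their span
  directly. One fixed Gaussian \<open>gauss 0 0 1\<close> therefore serves as a weight, and what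
  gets approximated is the quotient by it: the admissible factors form an algebra of bounded
  functions, and sine coordinates confine the argument to a compact ball. The last coordinate enters
  through \<open>exp (- t\<^sup>2 / 2)\<close>, which is injective for t > 0, so no sets of the
  half-space are lost. The other obstacle is that outside L1 the function \<open>weinstein\<close>
  is a choice among almost everywhere equal candidates. Linearity, isometry and inversion are
  therefore proved for a relation between functions, and \<open>weinstein\<close> is tied to it by a
  single theorem. The minimiser, by contrast, is given at every point by an integral; hence the
  formula holds at every y, while uniqueness is almost everywhere.\<close>

definition square_integrable :: "'a measure \<Rightarrow> ('a \<Rightarrow> complex) \<Rightarrow> bool" where
  "square_integrable M f \<longleftrightarrow> f \<in> borel_measurable M \<and> integrable M (\<lambda>x. (cmod (f x))\<^sup>2)"

definition norm2 :: "'a measure \<Rightarrow> ('a \<Rightarrow> complex) \<Rightarrow> real" where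
  "norm2 M f = sqrt (\<integral>x. (cmod (f x))\<^sup>2 \<partial>M)"

lemma norm2_nonneg [simp]: "0 \<le> norm2 M f"
  by (simp add: norm2_def)

lemma norm2_square: "(norm2 M f)\<^sup>2 = (\<integral>x. (cmod (f x))\<^sup>2 \<partial>M)"
  by (simp add: norm2_def)

lemma square_integrableD:
  assumes "square_integrable M f"
  shows "f \<in> borel_measurable M" "integrable M (\<lambda>x. (cmod (f x))\<^sup>2)"
  using assms by (auto simp: square_integrable_def)

lemma square_integrable_bound:
  assumes "square_integrable M f" "g \<in> borel_measurable M"
    and "AE x in M. cmod (g x) \<le> C * cmod (f x)"
  shows "square_integrable M g"
proof -
  have 1: "integrable M (\<lambda>x. C\<^sup>2 * (cmod (f x))\<^sup>2)"
    using square_integrableD[OF assms(1)] by auto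
  have 2: "AE x in M. norm ((cmod (g x))\<^sup>2) \<le> norm (C\<^sup>2 * (cmod (f x))\<^sup>2)"
    using assms(3)
  proof eventually_elim
    case (elim x)
    then show ?case using power_mono[OF elim, of 2] by (simp add: power_mult_distrib)
  qed
  have "integrable M (\<lambda>x. (cmod (g x))\<^sup>2)"
    by (rule Bochner_Integration.integrable_bound[OF 1 _ 2]) (use assms(2) in simp)
  then show ?thesis using assms(2) by (simp add: square_integrable_def)
qed

lemma square_integrable_add:
  assumes "square_integrable M f" "square_integrable M g"
  shows "square_integrable M (\<lambda>x. f x + g x)"
proof -
  have m: "(\<lambda>x. f x + g x) \<in> borel_measurable M"
    by (intro borel_measurable_add square_integrableD assms)
  have "integrable M (\<lambda>x. (cmod (f x + g x))\<^sup>2)"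
  proof (rule Bochner_Integration.integrable_bound)
    show "integrable M (\<lambda>x. 2 * (cmod (f x))\<^sup>2 + 2 * (cmod (g x))\<^sup>2)"
      using square_integrableD(2)[OF assms(1)] square_integrableD(2)[OF assms(2)] by simp
    show "(\<lambda>x. (cmod (f x + g x))\<^sup>2) \<in> borel_measurable M"
      using m by simp
    have "(cmod (f x + g x))\<^sup>2 \<le> 2 * (cmod (f x))\<^sup>2 + 2 * (cmod (g x))\<^sup>2" for x
    proof -
      have "(cmod (f x + g x))\<^sup>2 \<le> (cmod (f x) + cmod (g x))\<^sup>2"
        by (simp add: norm_triangle_ineq power_mono)
      also have "\<dots> \<le> 2 * (cmod (f x))\<^sup>2 + 2 * (cmod (g x))\<^sup>2"
        using sum_squares_bound[of "cmod (f x)" "cmod (g x)"] by (simp add: power2_sum)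
      finally show ?thesis .
    qed
    then show "AE x in M. norm ((cmod (f x + g x))\<^sup>2) \<le> norm (2 * (cmod (f x))\<^sup>2 + 2 * (cmod (g x))\<^sup>2)"
      by (intro AE_I2) simp
  qed
  with m show ?thesis by (simp add: square_integrable_def)
qed

lemma square_integrable_cmult:
  assumes "square_integrable M f"
  shows "square_integrable M (\<lambda>x. c * f x)"
  by (rule square_integrable_bound[OF assms, where C = "cmod c"])
    (use square_integrableD(1)[OF assms] in \<open>auto simp: norm_mult\<close>)

lemma square_integrable_diff:
  assumes "square_integrable M f" "square_integrable M g"
  shows "square_integrable M (\<lambda>x. f x - g x)"
  using square_integrable_add[OF assms(1) square_integrable_cmult[OF assms(2), of "-1"]] by simp

lemma square_integrable_cnj:
  assumes "square_integrable M f"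
  shows "square_integrable M (\<lambda>x. cnj (f x))"
  by (rule square_integrable_bound[OF assms, where C = 1])
    (auto intro!: measurable_compose[OF square_integrableD(1)[OF assms] borel_measurable_continuous_onI]
      continuous_intros)

lemma square_integrable_cong_AE:
  assumes "square_integrable M f" "g \<in> borel_measurable M" "AE x in M. f x = g x"
  shows "square_integrable M g"
  by (rule square_integrable_bound[OF assms(1,2), where C = 1]) (use assms(3) in auto)

lemma norm2_cong_AE:
  assumes "f \<in> borel_measurable M" "g \<in> borel_measurable M" "AE x in M. f x = g x"
  shows "norm2 M f = norm2 M g"
  unfolding norm2_def using assms by (intro arg_cong[where f=sqrt] integral_cong_AE) auto

lemma nn_integral_norm2:
  assumes "square_integrable M f"
  shows "(\<integral>\<^sup>+x. ennreal ((cmod (f x))\<^sup>2) \<partial>M) = ennreal ((norm2 M f)\<^sup>2)"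
  unfolding norm2_square using square_integrableD[OF assms]
  by (intro nn_integral_eq_integral) auto

lemma square_integrable_if_nn_integral_le:
  assumes "f \<in> borel_measurable M" "(\<integral>\<^sup>+x. ennreal ((cmod (f x))\<^sup>2) \<partial>M) \<le> ennreal (C\<^sup>2)" "0 \<le> C"
  shows "square_integrable M f" "norm2 M f \<le> C"
proof -
  show sq: "square_integrable M f"
    using assms unfolding square_integrable_def
    by (auto simp: integrable_iff_bounded intro: le_less_trans)
  have "(norm2 M f)\<^sup>2 \<le> C\<^sup>2"
    using assms(2) unfolding nn_integral_norm2[OF sq] by (simp add: ennreal_le_iff)
  then show "norm2 M f \<le> C" using assms(3) by (rule power2_le_imp_le)
qed

lemma square_integrable_mult:
  assumes "square_integrable M f" "square_integrable M g"
  shows "integrable M (\<lambda>x. f x * g x)"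
proof (rule Bochner_Integration.integrable_bound)
  show "integrable M (\<lambda>x. (cmod (f x))\<^sup>2 + (cmod (g x))\<^sup>2)"
    using square_integrableD(2)[OF assms(1)] square_integrableD(2)[OF assms(2)] by simp
  show "(\<lambda>x. f x * g x) \<in> borel_measurable M"
    by (intro borel_measurable_times square_integrableD assms)
  have "cmod (f x) * cmod (g x) \<le> \<bar>(cmod (f x))\<^sup>2 + (cmod (g x))\<^sup>2\<bar>" for x
  proof -
    have "0 \<le> cmod (f x) * cmod (g x)" by simp
    then show ?thesis using sum_squares_bound[of "cmod (f x)" "cmod (g x)"] by linarith
  qed
  then show "AE x in M. norm (f x * g x) \<le> norm ((cmod (f x))\<^sup>2 + (cmod (g x))\<^sup>2)"
    by (intro AE_I2) (simp add: norm_mult)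
qed

lemma norm2_cmult: "norm2 M (\<lambda>x. c * f x) = cmod c * norm2 M f"
  by (simp add: norm2_def norm_mult power_mult_distrib real_sqrt_mult)

lemma norm2_minus_commute: "norm2 M (\<lambda>x. f x - g x) = norm2 M (\<lambda>x. g x - f x)"
  by (simp add: norm2_def norm_minus_commute)

lemma norm2_add_square:
  assumes "square_integrable M f" "square_integrable M g"
  shows "(norm2 M (\<lambda>x. f x + g x))\<^sup>2 =
    (norm2 M f)\<^sup>2 + (norm2 M g)\<^sup>2 + 2 * Re (\<integral>x. f x * cnj (g x) \<partial>M)"
proof -
  have i: "integrable M (\<lambda>x. f x * cnj (g x))"
    using assms by (intro square_integrable_mult square_integrable_cnj)
  have "(norm2 M (\<lambda>x. f x + g x))\<^sup>2 =
    (\<integral>x. (cmod (f x))\<^sup>2 + (cmod (g x))\<^sup>2 + 2 * Re (f x * cnj (g x)) \<partial>M)"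
    unfolding norm2_square
    by (intro Bochner_Integration.integral_cong refl) (simp add: cmod_power2 power2_sum algebra_simps)
  also have "\<dots> = (norm2 M f)\<^sup>2 + (norm2 M g)\<^sup>2 + 2 * Re (\<integral>x. f x * cnj (g x) \<partial>M)"
    unfolding norm2_square using square_integrableD(2)[OF assms(1)] square_integrableD(2)[OF assms(2)] i
      integral_Re[OF i] integrable_Re[OF i]
    by (simp del: times_complex.sel)
  finally show ?thesis .
qed

text \<open>The Cauchy-Schwarz inequality for nonnegative integrals, applied to the moduli, bounds
  the cross term of \<open>norm2_add_square\<close>.\<close>

lemma norm2_triangle:
  assumes "square_integrable M f" "square_integrable M g"
  shows "norm2 M (\<lambda>x. f x + g x) \<le> norm2 M f + norm2 M g"
proof -
  note [measurable] = square_integrableD(1)[OF assms(1)] square_integrableD(1)[OF assms(2)]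
  have i: "integrable M (\<lambda>x. f x * cnj (g x))"
    using assms by (intro square_integrable_mult square_integrable_cnj)
  have "(\<integral>\<^sup>+x. ennreal (cmod (f x)) * ennreal (cmod (g x)) \<partial>M)\<^sup>2 \<le>
      (\<integral>\<^sup>+x. (ennreal (cmod (f x)))\<^sup>2 \<partial>M) * (\<integral>\<^sup>+x. (ennreal (cmod (g x)))\<^sup>2 \<partial>M)"
    by (intro Cauchy_Schwarz_nn_integral) auto
  also have "(\<integral>\<^sup>+x. ennreal (cmod (f x)) * ennreal (cmod (g x)) \<partial>M) =
      (\<integral>\<^sup>+x. ennreal (cmod (f x * cnj (g x))) \<partial>M)"
    by (simp add: norm_mult ennreal_mult)
  also have "\<dots> = ennreal (\<integral>x. cmod (f x * cnj (g x)) \<partial>M)"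
    using i by (intro nn_integral_eq_integral) auto
  finally have "(\<integral>x. cmod (f x * cnj (g x)) \<partial>M)\<^sup>2 \<le> (norm2 M f)\<^sup>2 * (norm2 M g)\<^sup>2"
    using assms by (simp add: ennreal_power nn_integral_norm2 flip: ennreal_mult'')
  then have "(\<integral>x. cmod (f x * cnj (g x)) \<partial>M)\<^sup>2 \<le> (norm2 M f * norm2 M g)\<^sup>2"
    by (simp add: power_mult_distrib)
  then have "(\<integral>x. cmod (f x * cnj (g x)) \<partial>M) \<le> norm2 M f * norm2 M g"
    by (rule power2_le_imp_le) simp
  moreover have "Re (\<integral>x. f x * cnj (g x) \<partial>M) \<le> (\<integral>x. cmod (f x * cnj (g x)) \<partial>M)"
    by (rule order_trans[OF complex_Re_le_cmod integral_norm_bound])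
  ultimately have "(norm2 M (\<lambda>x. f x + g x))\<^sup>2 \<le> (norm2 M f + norm2 M g)\<^sup>2"
    unfolding norm2_add_square[OF assms] by (simp add: power2_sum)
  then show ?thesis by (rule power2_le_imp_le) simp
qed

lemma norm2_triangle_diff:
  assumes "square_integrable M f" "square_integrable M g" "square_integrable M h"
  shows "norm2 M (\<lambda>x. f x - h x) \<le> norm2 M (\<lambda>x. f x - g x) + norm2 M (\<lambda>x. g x - h x)"
  using norm2_triangle[OF square_integrable_diff[OF assms(1,2)] square_integrable_diff[OF assms(2,3)]]
  by simp

lemma norm2_le_add_diff:
  assumes "square_integrable M f" "square_integrable M g"
  shows "norm2 M f \<le> norm2 M g + norm2 M (\<lambda>x. f x - g x)"
  using norm2_triangle[OF assms(2) square_integrable_diff[OF assms]] by simp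

lemma norm2_eq_0_imp_AE:
  assumes "square_integrable M (\<lambda>x. f x - g x)" "norm2 M (\<lambda>x. f x - g x) = 0"
  shows "AE x in M. f x = g x"
proof -
  have "(\<integral>x. (cmod (f x - g x))\<^sup>2 \<partial>M) = 0"
    using assms(2) by (metis norm2_square zero_power2)
  then have "AE x in M. (cmod (f x - g x))\<^sup>2 = 0"
    using square_integrableD(2)[OF assms(1)] by (subst (asm) integral_nonneg_eq_0_iff_AE) auto
  then show ?thesis by eventually_elim simp
qed

text \<open>Fatou's lemma for the squared modulus. Square integrability of the limit is part of the
  conclusion, so it applies to limits that are known only pointwise.\<close>

lemma norm2_liminf:
  assumes f: "\<And>n. square_integrable M (f n)" and g: "g \<in> borel_measurable M"
    and lim: "AE x in M. (\<lambda>n. f n x) \<longlonglongrightarrow> g x"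
    and le: "\<forall>\<^sub>F n in sequentially. norm2 M (f n) \<le> C" and C: "0 \<le> C"
  shows "square_integrable M g" "norm2 M g \<le> C"
proof -
  have "(\<integral>\<^sup>+x. ennreal ((cmod (g x))\<^sup>2) \<partial>M) =
      (\<integral>\<^sup>+x. liminf (\<lambda>n. ennreal ((cmod (f n x))\<^sup>2)) \<partial>M)"
  proof (rule nn_integral_cong_AE)
    show "AE x in M. ennreal ((cmod (g x))\<^sup>2) = liminf (\<lambda>n. ennreal ((cmod (f n x))\<^sup>2))"
      using lim
    proof eventually_elim
      case (elim x)
      have "(\<lambda>n. ennreal ((cmod (f n x))\<^sup>2)) \<longlonglongrightarrow> ennreal ((cmod (g x))\<^sup>2)"
        by (intro tendsto_ennrealI tendsto_intros elim)
      then show ?case by (intro lim_imp_Liminf[symmetric]) auto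
    qed
  qed
  also have "\<dots> \<le> liminf (\<lambda>n. \<integral>\<^sup>+x. ennreal ((cmod (f n x))\<^sup>2) \<partial>M)"
    using square_integrableD(1)[OF f] by (intro nn_integral_liminf) auto
  also have "\<dots> = liminf (\<lambda>n. ennreal ((norm2 M (f n))\<^sup>2))"
    by (simp add: nn_integral_norm2[OF f])
  also have "\<dots> \<le> liminf (\<lambda>n. ennreal (C\<^sup>2))"
    using le by (intro Liminf_mono) (auto elim!: eventually_mono intro!: ennreal_leI power_mono)
  also have "\<dots> = ennreal (C\<^sup>2)" by (simp add: Liminf_const)
  finally have *: "(\<integral>\<^sup>+x. ennreal ((cmod (g x))\<^sup>2) \<partial>M) \<le> ennreal (C\<^sup>2)" .
  from square_integrable_if_nn_integral_le[OF g * C]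
  show "square_integrable M g" "norm2 M g \<le> C" by auto
qed

text \<open>Riesz--Fischer: along a fast Cauchy subsequence the weighted sum
  \<open>\<Sum>k. 4 ^ k * \<bar>f\<^sub>k\<^sub>+\<^sub>1 - f\<^sub>k\<bar>\<^sup>2\<close> is integrable, which forces convergence almost everywhere.\<close>

theorem square_integrable_complete:
  assumes f: "\<And>n. square_integrable M (f n)"
    and Cauchy: "\<And>e. e > 0 \<Longrightarrow> \<exists>N. \<forall>m\<ge>N. \<forall>n\<ge>N. norm2 M (\<lambda>x. f m x - f n x) < e"
  obtains g where "square_integrable M g" "(\<lambda>n. norm2 M (\<lambda>x. f n x - g x)) \<longlonglongrightarrow> 0"
proof -
  note [measurable] = square_integrableD(1)[OF f]
  have "\<exists>N. \<forall>k. \<forall>m\<ge>N k. \<forall>n\<ge>N k. norm2 M (\<lambda>x. f m x - f n x) < (1/4) ^ k"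
    by (rule choice) (use Cauchy in auto)
  then obtain N where N: "\<And>k m n. m \<ge> N k \<Longrightarrow> n \<ge> N k \<Longrightarrow> norm2 M (\<lambda>x. f m x - f n x) < (1/4) ^ k"
    by blast
  \<comment> \<open>The sum makes \<open>r k\<close> at least every \<open>N i\<close> with
    \<open>i \<le> k\<close>, so that \<open>r k\<close> and \<open>r (Suc k)\<close> are both past
    \<open>N k\<close>; the summand k forces \<open>r k\<close> to tend to infinity.\<close>
  define r where "r k = k + (\<Sum>i\<le>k. N i)" for k
  have r: "r k \<ge> N k" "r (Suc k) \<ge> N k" "r k \<ge> k" for k
    using member_le_sum[of k "{..k}" N] by (auto simp: r_def)
  define d where "d k x = f (r (Suc k)) x - f (r k) x" for k x
  have [measurable]: "d k \<in> borel_measurable M" for k unfolding d_def by measurable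
  have dsq: "square_integrable M (d k)" for k unfolding d_def by (intro square_integrable_diff f)
  have dn: "norm2 M (d k) \<le> (1/4) ^ k" for k unfolding d_def using N[OF r(2) r(1), of k] by simp
  \<comment> \<open>The squared norm of \<open>d k\<close> is at most \<open>(1/16) ^ k\<close>, so
    the weight \<open>4 ^ k\<close> still leaves a convergent geometric series. Conversely,
    finiteness of the weighted sum at a point bounds \<open>d k x\<close> by a multiple of
    \<open>(1/2) ^ k\<close> there.\<close>
  have "(\<integral>\<^sup>+x. (\<Sum>k. ennreal (4 ^ k * (cmod (d k x))\<^sup>2)) \<partial>M)
      = (\<Sum>k. \<integral>\<^sup>+x. ennreal (4 ^ k * (cmod (d k x))\<^sup>2) \<partial>M)"
    by (intro nn_integral_suminf) auto
  also have "\<dots> \<le> (\<Sum>k. ennreal ((1/4) ^ k))"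
  proof (intro suminf_le)
    fix k
    have "(\<integral>\<^sup>+x. ennreal (4 ^ k * (cmod (d k x))\<^sup>2) \<partial>M) = ennreal (4 ^ k) * ennreal ((norm2 M (d k))\<^sup>2)"
      by (subst nn_integral_norm2[OF dsq, symmetric], subst nn_integral_cmult[symmetric])
        (auto simp flip: ennreal_mult)
    also have "\<dots> \<le> ennreal (4 ^ k) * ennreal (((1/4) ^ k)\<^sup>2)"
      by (intro mult_left_mono ennreal_leI power_mono dn) auto
    also have "\<dots> = ennreal ((1/4) ^ k)"
      by (subst ennreal_mult[symmetric]) (auto simp: power2_eq_square field_simps simp flip: power_mult_distrib)
    finally show "(\<integral>\<^sup>+x. ennreal (4 ^ k * (cmod (d k x))\<^sup>2) \<partial>M) \<le> ennreal ((1/4) ^ k)" .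
  qed auto
  also have "\<dots> < \<infinity>"
    by (subst suminf_ennreal2) (auto intro: summable_geometric)
  finally have "AE x in M. (\<Sum>k. ennreal (4 ^ k * (cmod (d k x))\<^sup>2)) \<noteq> \<infinity>"
    by (intro nn_integral_PInf_AE) auto
  then have conv: "AE x in M. convergent (\<lambda>k. f (r k) x)"
  proof eventually_elim
    case (elim x)
    define C where "C = enn2real (\<Sum>k. ennreal (4 ^ k * (cmod (d k x))\<^sup>2))"
    have C: "0 \<le> C" "(\<Sum>k. ennreal (4 ^ k * (cmod (d k x))\<^sup>2)) = ennreal C"
      unfolding C_def using elim by (simp_all add: less_top)
    have "cmod (d k x) \<le> sqrt C * (1/2) ^ k" for k
    proof -
      define F where "F k = ennreal (4 ^ k * (cmod (d k x))\<^sup>2)" for k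
      have "F k \<le> suminf F"
        using sum_le_suminf[OF summableI, of "{k}" F] by simp
      then have "4 ^ k * (cmod (d k x))\<^sup>2 \<le> C"
        using C unfolding F_def by (metis ennreal_le_iff)
      moreover have "(4::real) ^ k = 2 ^ k * 2 ^ k"
        by (simp flip: power_mult_distrib)
      ultimately have "(2 ^ k * cmod (d k x))\<^sup>2 \<le> C"
        by (simp only: power2_eq_square ac_simps)
      then have "2 ^ k * cmod (d k x) \<le> sqrt C" by (rule real_le_rsqrt)
      then show ?thesis
        by (simp add: power_one_over mult.commute pos_le_divide_eq)
    qed
    moreover have "summable (\<lambda>k. sqrt C * (1/2) ^ k)"
      by (intro summable_mult summable_geometric) simp
    ultimately have "summable (\<lambda>k. d k x)"
      by (metis summable_comparison_test')
    then have "convergent (\<lambda>n. (\<Sum>k<n. d k x))" by (simp add: summable_iff_convergent)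
    moreover have "(\<Sum>k<n. d k x) = f (r n) x - f (r 0) x" for n
      unfolding d_def by (rule sum_lessThan_telescope)
    ultimately have "convergent (\<lambda>n. (f (r n) x - f (r 0) x) + f (r 0) x)"
      by (intro convergent_add convergent_const) simp
    then show ?case by simp
  qed
  define g where "g x = lim (\<lambda>k. f (r k) x)" for x
  have [measurable]: "g \<in> borel_measurable M" unfolding g_def by measurable
  have lim: "AE x in M. (\<lambda>k. f (r k) x) \<longlonglongrightarrow> g x"
    using conv by eventually_elim (simp add: g_def convergent_LIMSEQ_iff)
  \<comment> \<open>Fatou's lemma in the second index: every late \<open>f m\<close> is compared
    with the subsequence \<open>f (r j)\<close> as j grows, which controls the whole sequence and
    not only the subsequence.\<close>
  have *: "square_integrable M (\<lambda>x. f m x - g x) \<and> norm2 M (\<lambda>x. f m x - g x) \<le> (1/4) ^ k" if "m \<ge> N k" for m k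
  proof -
    have "AE x in M. (\<lambda>j. f m x - f (r j) x) \<longlonglongrightarrow> f m x - g x"
      using lim by eventually_elim (intro tendsto_intros)
    moreover have "\<forall>\<^sub>F j in sequentially. norm2 M (\<lambda>x. f m x - f (r j) x) \<le> (1/4) ^ k"
      using eventually_ge_at_top[of "N k"]
    proof eventually_elim
      case (elim j)
      then show ?case using N[OF that, of "r j"] r(3)[of j] by simp
    qed
    ultimately show ?thesis
      using norm2_liminf[of M "\<lambda>j x. f m x - f (r j) x" "\<lambda>x. f m x - g x" "(1/4) ^ k"]
      by (auto intro: square_integrable_diff f)
  qed
  have "square_integrable M g"
    using square_integrable_diff[OF f[of "N 0"] conjunct1[OF *[of 0 "N 0"]]] by simp
  moreover have "(\<lambda>n. norm2 M (\<lambda>x. f n x - g x)) \<longlonglongrightarrow> 0"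
  proof (rule LIMSEQ_I)
    fix e :: real assume "e > 0"
    then obtain k where k: "(1/4) ^ k < e" using real_arch_pow_inv[of e "1/4"] by auto
    have "norm2 M (\<lambda>x. f n x - g x) < e" if "n \<ge> N k" for n
      using *[OF that] k by linarith
    then show "\<exists>no. \<forall>n\<ge>no. norm (norm2 M (\<lambda>x. f n x - g x) - 0) < e" by auto
  qed
  ultimately show ?thesis by (rule that)
qed

text \<open>Polarisation: the squared norm of \<open>f + c g\<close> isolates the real part of
  \<open>cnj c\<close> times the inner product, and the choices 1 and \<open>\<i>\<close> of c
  recover its real and imaginary parts.\<close>

lemma norm2_eq_imp_inner_eq:
  assumes f: "square_integrable M f" "square_integrable M g"
    and f': "square_integrable M f'" "square_integrable M g'"
    and eq: "\<And>c. norm2 M (\<lambda>x. f x + c * g x) = norm2 M (\<lambda>x. f' x + c * g' x)"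
    and eq0: "norm2 M g = norm2 M g'"
  shows "(\<integral>x. f x * cnj (g x) \<partial>M) = (\<integral>x. f' x * cnj (g' x) \<partial>M)"
proof -
  have e0: "norm2 M f = norm2 M f'" using eq[of 0] by simp
  have *: "Re (cnj c * (\<integral>x. f x * cnj (g x) \<partial>M)) = Re (cnj c * (\<integral>x. f' x * cnj (g' x) \<partial>M))" for c
  proof -
    have "(\<integral>x. f x * cnj (c * g x) \<partial>M) = cnj c * (\<integral>x. f x * cnj (g x) \<partial>M)"
      "(\<integral>x. f' x * cnj (c * g' x) \<partial>M) = cnj c * (\<integral>x. f' x * cnj (g' x) \<partial>M)"
      by (simp_all add: mult.left_commute)
    moreover have "(norm2 M (\<lambda>x. f x + c * g x))\<^sup>2 = (norm2 M (\<lambda>x. f' x + c * g' x))\<^sup>2"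
      using eq by simp
    ultimately show ?thesis
      using eq0 e0 f f' by (simp add: norm2_add_square square_integrable_cmult norm2_cmult)
  qed
  show ?thesis using *[of 1] *[of \<i>] by (intro complex_eqI) auto
qed

subsection \<open>The normalized Bessel function\<close>

text \<open>Coefficients in the variable \<open>u = t\<^sup>2\<close>, so \<open>4 ^ k\<close>
  stands for \<open>2 ^ (2 * k)\<close>. In u the function is an ordinary power series, to which
  termwise differentiation applies.\<close>

definition bessel_coeff :: "real \<Rightarrow> nat \<Rightarrow> real" where
  "bessel_coeff \<alpha> k = Gamma (\<alpha> + 1) * (-1) ^ k / (4 ^ k * fact k * Gamma (\<alpha> + real k + 1))"

lemma bessel_j_altdef: "bessel_j \<alpha> t = (\<Sum>k. bessel_coeff \<alpha> k * (t\<^sup>2) ^ k)"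
  if "summable (\<lambda>k. bessel_coeff \<alpha> k * (t\<^sup>2) ^ k)" "Gamma (\<alpha> + 1) \<noteq> 0"
proof -
  have eq: "bessel_coeff \<alpha> k * (t\<^sup>2) ^ k =
      Gamma (\<alpha> + 1) * ((-1) ^ k * t ^ (2 * k) / (2 ^ (2 * k) * fact k * Gamma (\<alpha> + real k + 1)))" for k
    unfolding bessel_coeff_def power_mult by simp
  have "summable (\<lambda>k. inverse (Gamma (\<alpha> + 1)) * (bessel_coeff \<alpha> k * (t\<^sup>2) ^ k))"
    by (rule summable_mult[OF that(1)])
  then have "summable (\<lambda>k. (-1) ^ k * t ^ (2 * k) / (2 ^ (2 * k) * fact k * Gamma (\<alpha> + real k + 1)))"
    unfolding eq using that(2) by (simp add: mult.assoc[symmetric])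
  from suminf_mult[OF this, of "Gamma (\<alpha> + 1)"] show ?thesis
    unfolding bessel_j_def eq by simp
qed

lemma bessel_coeff_0: "Gamma (\<alpha> + 1) \<noteq> 0 \<Longrightarrow> bessel_coeff \<alpha> 0 = 1"
  by (simp add: bessel_coeff_def)

text \<open>This recursion is the Bessel equation
  \<open>u J'' + (\<alpha> + 1) J' + J / 4 = 0\<close> read coefficientwise; it comes from the
  functional equation of Gamma.\<close>

lemma bessel_coeff_Suc:
  assumes "\<alpha> > -1"
  shows "real (Suc k) * (\<alpha> + real k + 1) * bessel_coeff \<alpha> (Suc k) = - bessel_coeff \<alpha> k / 4"
proof -
  have p: "\<alpha> + real k + 1 > 0" using assms by linarith
  then have "Gamma (\<alpha> + real k + 1 + 1) = (\<alpha> + real k + 1) * Gamma (\<alpha> + real k + 1)"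
    by (intro Gamma_plus1) (auto elim!: nonpos_Ints_cases)
  then have "Gamma (\<alpha> + real (Suc k) + 1) = (\<alpha> + real k + 1) * Gamma (\<alpha> + real k + 1)"
    by (simp add: algebra_simps)
  moreover have "Gamma (\<alpha> + real k + 1) > 0" using p by (rule Gamma_real_pos)
  moreover have "n * P * (A * (- e) / (4 * q * (n * f) * (P * G))) = - (A * e / (q * f * G)) / 4"
    if "n \<noteq> 0" "P \<noteq> 0" for n P A e q f G :: real
    using that by simp
  ultimately show ?thesis using p unfolding bessel_coeff_def
    by (simp del: of_nat_Suc)
qed

lemma summable_bessel:
  assumes "\<alpha> > -1/2"
  shows "summable (\<lambda>k. bessel_coeff \<alpha> k * y ^ k)"
\<comment> \<open>As \<open>\<alpha> + n + 1 \<ge> 1/2\<close>, the recursion bounds n + 1 times the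
  next coefficient by half of the current one; from the chosen N on, |y| is at most n + 1 and is
  absorbed by that factor.\<close>
proof (rule summable_ratio_test[where c="1/2" and N="nat \<lceil>\<bar>y\<bar>\<rceil>"])
  fix n assume "nat \<lceil>\<bar>y\<bar>\<rceil> \<le> n"
  then have n: "\<bar>y\<bar> \<le> real n" by linarith
  have p: "\<alpha> + real n + 1 \<ge> 1/2" using assms by linarith
  have "real (Suc n) * (1/2) * \<bar>bessel_coeff \<alpha> (Suc n)\<bar> \<le> real (Suc n) * (\<alpha> + real n + 1) * \<bar>bessel_coeff \<alpha> (Suc n)\<bar>"
    using p by (intro mult_right_mono mult_left_mono) auto
  also have "\<dots> = \<bar>bessel_coeff \<alpha> n\<bar> / 4"
    using arg_cong[OF bessel_coeff_Suc[of \<alpha> n], of abs] assms p by (simp add: abs_mult)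
  finally have *: "real (Suc n) * \<bar>bessel_coeff \<alpha> (Suc n)\<bar> \<le> \<bar>bessel_coeff \<alpha> n\<bar> / 2"
    by simp
  have "\<bar>bessel_coeff \<alpha> (Suc n)\<bar> * \<bar>y\<bar> \<le> \<bar>bessel_coeff \<alpha> (Suc n)\<bar> * real (Suc n)"
    using n by (intro mult_left_mono) auto
  also note *[unfolded mult.commute[of "real (Suc n)"]]
  finally have "\<bar>bessel_coeff \<alpha> (Suc n)\<bar> * \<bar>y\<bar> * \<bar>y\<bar> ^ n \<le> \<bar>bessel_coeff \<alpha> n\<bar> / 2 * \<bar>y\<bar> ^ n"
    by (intro mult_right_mono) auto
  then show "norm (bessel_coeff \<alpha> (Suc n) * y ^ Suc n) \<le> 1/2 * norm (bessel_coeff \<alpha> n * y ^ n)"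
    by (simp add: abs_mult power_abs mult.assoc)
qed simp

definition bessel_series :: "real \<Rightarrow> real \<Rightarrow> real" where
  "bessel_series \<alpha> u = (\<Sum>k. bessel_coeff \<alpha> k * u ^ k)"

lemma bessel_j_eq_series:
  assumes "\<alpha> > -1/2"
  shows "bessel_j \<alpha> t = bessel_series \<alpha> (t\<^sup>2)"
  unfolding bessel_series_def
proof (rule bessel_j_altdef)
  show "summable (\<lambda>k. bessel_coeff \<alpha> k * (t\<^sup>2) ^ k)" by (rule summable_bessel[OF assms])
  have "Gamma (\<alpha> + 1) > 0" using assms by (intro Gamma_real_pos) simp
  then show "Gamma (\<alpha> + 1) \<noteq> 0" by simp
qed

lemma has_field_derivative_bessel_series:
  assumes "\<alpha> > -1/2"
  shows "(bessel_series \<alpha> has_field_derivative (\<Sum>k. diffs (bessel_coeff \<alpha>) k * u ^ k)) (at u)"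
  unfolding bessel_series_def
  by (rule termdiffs_strong_converges_everywhere) (rule summable_bessel[OF assms])

text \<open>In the variable \<open>u = t\<^sup>2\<close> the energy \<open>j\<^sup>2 + j'\<^sup>2\<close> of the Bessel equation is
  \<open>J\<^sup>2 + 4 u J'\<^sup>2\<close>, whose derivative is \<open>- 4 (2 \<alpha> + 1) J'\<^sup>2 \<le> 0\<close>.\<close>

lemma abs_bessel_j_le_1:
  assumes \<alpha>: "\<alpha> > -1/2"
  shows "\<bar>bessel_j \<alpha> t\<bar> \<le> 1"
proof -
  let ?c = "bessel_coeff \<alpha>"
  define J where "J u = (\<Sum>k. ?c k * u ^ k)" for u
  define J1 where "J1 u = (\<Sum>k. diffs ?c k * u ^ k)" for u
  define J2 where "J2 u = (\<Sum>k. diffs (diffs ?c) k * u ^ k)" for u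
  have s0: "summable (\<lambda>k. ?c k * u ^ k)" for u by (rule summable_bessel[OF \<alpha>])
  have s1: "summable (\<lambda>k. diffs ?c k * u ^ k)" for u by (rule termdiff_converges_all[OF s0])
  have s2: "summable (\<lambda>k. diffs (diffs ?c) k * u ^ k)" for u by (rule termdiff_converges_all[OF s1])
  have d0: "(J has_field_derivative J1 u) (at u)" for u
    unfolding J_def J1_def by (rule termdiffs_strong_converges_everywhere[OF s0])
  have d1: "(J1 has_field_derivative J2 u) (at u)" for u
    unfolding J1_def J2_def by (rule termdiffs_strong_converges_everywhere[OF s1])
  \<comment> \<open>The Bessel equation in u, checked on coefficients through
    \<open>bessel_coeff_Suc\<close>; multiplying \<open>J2\<close> by u shifts its series so that
    all three run over the same powers.\<close>
  have ode: "u * J2 u + (\<alpha> + 1) * J1 u + J u / 4 = 0" for u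
  proof -
    have "(\<lambda>n. u * (real n * diffs ?c n * u ^ (n - Suc 0))) sums (u * J2 u)"
      unfolding J2_def by (intro sums_mult) (use diffs_equiv[OF s2] in simp)
    moreover have "u * (real n * diffs ?c n * u ^ (n - Suc 0)) = real n * diffs ?c n * u ^ n" for n
      by (cases n) auto
    ultimately have "(\<lambda>n. real n * diffs ?c n * u ^ n) sums (u * J2 u)" by simp
    moreover have "(\<lambda>n. (\<alpha> + 1) * (diffs ?c n * u ^ n)) sums ((\<alpha> + 1) * J1 u)"
      unfolding J1_def by (intro sums_mult summable_sums s1)
    moreover have "(\<lambda>n. ?c n * u ^ n / 4) sums (J u / 4)"
      unfolding J_def by (intro sums_divide summable_sums s0)
    ultimately have *: "(\<lambda>n. real n * diffs ?c n * u ^ n + (\<alpha> + 1) * (diffs ?c n * u ^ n) + ?c n * u ^ n / 4)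
      sums (u * J2 u + (\<alpha> + 1) * J1 u + J u / 4)"
      by (intro sums_add)
    have "real n * diffs ?c n * u ^ n + (\<alpha> + 1) * (diffs ?c n * u ^ n) + ?c n * u ^ n / 4 = 0" for n
    proof -
      have "real n * diffs ?c n * u ^ n + (\<alpha> + 1) * (diffs ?c n * u ^ n) + ?c n * u ^ n / 4
        = (real (Suc n) * (\<alpha> + real n + 1) * ?c (Suc n) + ?c n / 4) * u ^ n"
        by (simp add: diffs_def algebra_simps)
      then show ?thesis using bessel_coeff_Suc[of \<alpha> n] \<alpha> by simp
    qed
    with * show ?thesis by (simp add: sums_iff)
  qed
  define E where "E u = (J u)\<^sup>2 + 4 * u * (J1 u)\<^sup>2" for u
  have "E (t\<^sup>2) \<le> E 0"
  proof (rule DERIV_nonpos_imp_nonincreasing[of 0 "t\<^sup>2" E])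
    fix u :: real
    assume "0 \<le> u"
    have "(E has_field_derivative (2 * J u * J1 u + (4 * (J1 u)\<^sup>2 + 4 * u * (2 * J1 u * J2 u)))) (at u)"
      unfolding E_def
      by (auto intro!: derivative_eq_intros d0 d1 simp: algebra_simps power2_eq_square)
    moreover have "2 * J u * J1 u + (4 * (J1 u)\<^sup>2 + 4 * u * (2 * J1 u * J2 u)) = - (4 * (2 * \<alpha> + 1)) * (J1 u)\<^sup>2"
    proof -
      have *: "u * J2 u = - (\<alpha> + 1) * J1 u - J u / 4" using ode[of u] by (simp add: algebra_simps)
      have "2 * J u * J1 u + (4 * (J1 u)\<^sup>2 + 4 * u * (2 * J1 u * J2 u))
        = 2 * J u * J1 u + 4 * (J1 u)\<^sup>2 + 8 * J1 u * (u * J2 u)" by simp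
      then show ?thesis unfolding * by (simp add: algebra_simps power2_eq_square)
    qed
    moreover have "\<dots> \<le> 0" using \<alpha> by (intro mult_nonpos_nonneg) auto
    ultimately show "\<exists>y. (E has_field_derivative y) (at u) \<and> y \<le> 0" by auto
  qed simp
  moreover have "E 0 = 1"
    using \<alpha> less_imp_neq[OF Gamma_real_pos, of "\<alpha> + 1"]
    by (simp add: E_def J_def powser_zero bessel_coeff_0)
  moreover have "(J (t\<^sup>2))\<^sup>2 \<le> E (t\<^sup>2)" by (simp add: E_def)
  ultimately have "(J (t\<^sup>2))\<^sup>2 \<le> 1" by linarith
  then show ?thesis
    using \<alpha> by (simp add: bessel_j_eq_series bessel_series_def J_def abs_square_le_1)
qed

lemma continuous_on_bessel_j:
  assumes "\<alpha> > -1/2"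
  shows "continuous_on UNIV (bessel_j \<alpha>)"
proof -
  have "continuous_on UNIV (bessel_series \<alpha>)"
    using has_field_derivative_bessel_series[OF assms] by (intro DERIV_continuous_on) (auto intro: DERIV_subset)
  then have "continuous_on UNIV (\<lambda>t. bessel_series \<alpha> (t\<^sup>2))"
    by (rule continuous_on_compose2) (auto intro: continuous_intros)
  then show ?thesis by (simp add: bessel_j_eq_series[OF assms, abs_def])
qed

lemma borel_measurable_bessel_j [measurable]:
  "\<alpha> > -1/2 \<Longrightarrow> bessel_j \<alpha> \<in> borel_measurable borel"
  by (intro borel_measurable_continuous_onI continuous_on_bessel_j)

text \<open>The substitution \<open>t = s * r\<^sup>2 / 2\<close> in the Gamma integral. With
  \<open>a = \<alpha> + k + 1\<close> it gives the moments needed to integrate the Bessel series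
  term by term.\<close>

lemma has_bochner_integral_gaussian_powr:
  fixes a s :: real
  assumes a: "a > 0" and s: "s > 0"
  shows "has_bochner_integral lborel
    (\<lambda>r. indicator {0<..} r * (r powr (2 * a - 1) * exp (- s * r\<^sup>2 / 2)))
    (2 powr (a - 1) * Gamma a / s powr a)"
proof -
  define f :: "real \<Rightarrow> real" where "f = (\<lambda>t. t powr (a - 1) / exp t)"
  define g where "g r = s * r\<^sup>2 / 2" for r
  have im: "g ` {0<..} = {0<..}"
  proof safe
    fix t :: real assume t: "0 < t"
    then have "g (sqrt (2 * t / s)) = t" "sqrt (2 * t / s) \<in> {0<..}" using s by (auto simp: g_def)
    then show "t \<in> g ` {0<..}" by (metis imageI)
  qed (use s in \<open>auto simp: g_def\<close>)
  have "(f has_integral Gamma a) {0..}" unfolding f_def by (rule Gamma_integral_real[OF a])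
  then have f0: "(f has_integral Gamma a) {0<..}"
    by (subst has_integral_spike_set_eq[of _ "{0..}"]) (auto intro: negligible_subset[of "{0}"])
  then have "f absolutely_integrable_on {0<..}"
    by (intro nonnegative_absolutely_integrable_1) (auto simp: f_def has_integral_integrable)
  then have "f absolutely_integrable_on g ` {0<..} \<and> integral (g ` {0<..}) f = Gamma a"
    unfolding im using f0 by (simp add: integral_unique)
  moreover have "(\<lambda>x. \<bar>s * x\<bar> * f (g x)) absolutely_integrable_on {0<..} \<and>
      integral {0<..} (\<lambda>x. \<bar>s * x\<bar> * f (g x)) = Gamma a
    \<longleftrightarrow> f absolutely_integrable_on g ` {0<..} \<and> integral (g ` {0<..}) f = Gamma a"
  proof (rule has_absolute_integral_change_of_variables_1')
    show "(g has_field_derivative s * x) (at x within {0<..})" for x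
      unfolding g_def by (auto intro!: derivative_eq_intros)
    show "inj_on g {0<..}" using s by (auto simp: inj_on_def g_def)
  qed simp
  ultimately have *: "(\<lambda>x. \<bar>s * x\<bar> * f (g x)) absolutely_integrable_on {0<..}"
      "integral {0<..} (\<lambda>x. \<bar>s * x\<bar> * f (g x)) = Gamma a" by auto
  \<comment> \<open>The substitution turns \<open>t powr (a - 1)\<close> together with the Jacobian
    \<open>s * r\<close> into C times \<open>r powr (2 * a - 1)\<close>.\<close>
  define C where "C = s powr a / 2 powr (a - 1)"
  have C: "C > 0" using s by (simp add: C_def)
  define h where "h r = r powr (2 * a - 1) * exp (- s * r\<^sup>2 / 2)" for r
  have eq: "\<bar>s * x\<bar> * f (g x) = C * h x" if "x > 0" for x
  proof -
    have "(g x) powr (a - 1) = s powr (a - 1) * (x powr 2) powr (a - 1) / 2 powr (a - 1)"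
      using s that by (simp add: g_def powr_mult powr_divide powr_numeral)
    also have "(x powr 2) powr (a - 1) = x powr (2 * a - 2)"
      by (simp add: powr_powr algebra_simps)
    finally have "\<bar>s * x\<bar> * f (g x) = (s * s powr (a - 1)) * (x * x powr (2 * a - 2)) / 2 powr (a - 1) / exp (g x)"
      using s that by (simp add: f_def)
    also have "s * s powr (a - 1) = s powr a" using s by (simp add: powr_mult_base)
    also have "x * x powr (2 * a - 2) = x powr (2 * a - 1)" using that by (simp add: powr_mult_base)
    finally show ?thesis
      by (simp add: C_def h_def g_def exp_minus field_simps)
  qed
  have ab: "(\<lambda>x. C * h x) absolutely_integrable_on {0<..}"
    using *(1) by (rule absolutely_integrable_spike[where S="{}"]) (auto simp: eq)
  have int: "integral {0<..} (\<lambda>x. C * h x) = Gamma a"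
    using *(2) by (subst integral_cong[of _ _ "\<lambda>x. \<bar>s * x\<bar> * f (g x)"]) (auto simp: eq)
  have m: "(\<lambda>x. indicator {0<..} x * (C * h x)) \<in> borel_measurable lborel"
    unfolding h_def by measurable
  have "integrable lebesgue (\<lambda>x. indicator {0<..} x * (C * h x))"
    using ab by (simp add: set_integrable_def)
  then have i: "integrable lborel (\<lambda>x. indicator {0<..} x * (C * h x))"
    using m by (simp add: integrable_completion)
  have "(\<integral>x. indicator {0<..} x * (C * h x) \<partial>lborel) = (LINT x:{0<..}|lebesgue. C * h x)"
    unfolding set_lebesgue_integral_def real_scaleR_def by (rule integral_completion[OF m, symmetric])
  also have "\<dots> = Gamma a"
    unfolding set_lebesgue_integral_eq_integral(2)[OF ab] by (rule int)
  finally have "has_bochner_integral lborel (\<lambda>x. indicator {0<..} x * (C * h x)) (Gamma a)"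
    using i by (simp add: has_bochner_integral_iff)
  then have "has_bochner_integral lborel (\<lambda>x. inverse C * (indicator {0<..} x * (C * h x))) (inverse C * Gamma a)"
    by (rule has_bochner_integral_mult_right)
  moreover have "inverse C * (indicator {0<..} x * (C * h x)) = indicator {0<..} x * h x" for x
    using C by simp
  ultimately show ?thesis by (simp add: h_def C_def field_simps)
qed

text \<open>Integrate the power series of \<open>j\<^sub>\<alpha>\<close> term by term against the Gaussian.\<close>

lemma has_bochner_integral_gaussian_bessel:
  fixes \<alpha> s \<rho> :: real
  assumes \<alpha>: "\<alpha> > -1/2" and s: "s > 0"
  shows "has_bochner_integral lborel
    (\<lambda>r. indicator {0<..} r * (r powr (2 * \<alpha> + 1) * (exp (- s * r\<^sup>2 / 2) * bessel_j \<alpha> (r * \<rho>))))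
    (2 powr \<alpha> * Gamma (\<alpha> + 1) / s powr (\<alpha> + 1) * exp (- \<rho>\<^sup>2 / (2 * s)))"
proof -
  define w where "w k r = indicator {0<..} r * (r powr (2 * (\<alpha> + real k + 1) - 1) * exp (- s * r\<^sup>2 / 2))" for k r
  define I where "I k = 2 powr (\<alpha> + real k) * Gamma (\<alpha> + real k + 1) / s powr (\<alpha> + real k + 1)" for k
  define A where "A = 2 powr \<alpha> * Gamma (\<alpha> + 1) / s powr (\<alpha> + 1)"
  have w: "has_bochner_integral lborel (w k) (I k)" for k
    using has_bochner_integral_gaussian_powr[of "\<alpha> + real k + 1" s] \<alpha> s
    unfolding w_def[abs_def] I_def by simp
  have w0: "w k r \<ge> 0" for k r by (simp add: w_def)
  define c where "c k = bessel_coeff \<alpha> k * (\<rho>\<^sup>2) ^ k" for k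
  \<comment> \<open>The Gamma value of the moment cancels that of the coefficient, which leaves an
    exponential series. The version with absolute values justifies exchanging sum and
    integral.\<close>
  have cI: "c k * I k = A * ((- \<rho>\<^sup>2 / (2 * s)) ^ k / fact k)"
    and acI: "\<bar>c k\<bar> * I k = A * ((\<rho>\<^sup>2 / (2 * s)) ^ k / fact k)" for k
  proof -
    have G: "Gamma (\<alpha> + real k + 1) > 0" "Gamma (\<alpha> + 1) > 0" using \<alpha> by (auto intro!: Gamma_real_pos)
    have p: "2 powr (\<alpha> + real k) = 2 powr \<alpha> * 2 ^ k" "s powr (\<alpha> + real k + 1) = s powr (\<alpha> + 1) * s ^ k"
      using s by (simp_all add: powr_add powr_realpow)
    have four: "(4::real) ^ k = 2 ^ k * 2 ^ k" by (simp flip: power_mult_distrib)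
    have "c k * I k = (Gamma (\<alpha> + 1) * (-1) ^ k * (\<rho>\<^sup>2) ^ k * 2 powr \<alpha> * 2 ^ k * Gamma (\<alpha> + real k + 1)) /
       (4 ^ k * fact k * Gamma (\<alpha> + real k + 1) * s powr (\<alpha> + 1) * s ^ k)"
      unfolding c_def I_def bessel_coeff_def p by (simp add: mult_ac)
    also have "\<dots> = A * ((- 1) ^ k * (\<rho>\<^sup>2) ^ k / (2 ^ k * s ^ k) / fact k)"
      unfolding A_def four using G s by (simp add: field_simps)
    also have "(- 1) ^ k * (\<rho>\<^sup>2) ^ k / (2 ^ k * s ^ k) = (- \<rho>\<^sup>2 / (2 * s)) ^ k"
      unfolding power_divide power_mult_distrib by (subst power_minus) (rule refl)
    finally show 1: "c k * I k = A * ((- \<rho>\<^sup>2 / (2 * s)) ^ k / fact k)" .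
    have "I k \<ge> 0" "A \<ge> 0" using G s by (simp_all add: I_def A_def)
    then have "\<bar>c k\<bar> * I k = \<bar>c k * I k\<bar>" by (simp add: abs_mult)
    also have "\<dots> = A * ((\<rho>\<^sup>2 / (2 * s)) ^ k / fact k)"
      unfolding 1 using \<open>A \<ge> 0\<close> s by (simp add: abs_mult power_abs)
    finally show "\<bar>c k\<bar> * I k = A * ((\<rho>\<^sup>2 / (2 * s)) ^ k / fact k)" .
  qed
  have int: "integrable lborel (\<lambda>r. c k * w k r)" for k
    using w[of k] by (auto simp: has_bochner_integral_iff)
  have "norm (c k * w k r) = \<bar>c k\<bar> * w k r" for k r
    using w0 by (simp add: abs_mult)
  then have nint: "(\<integral>r. norm (c k * w k r) \<partial>lborel) = A * ((\<rho>\<^sup>2 / (2 * s)) ^ k / fact k)" for k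
    using w[of k] by (simp add: has_bochner_integral_iff acI)
  have series: "(\<lambda>k. c k * w k r) sums
      (indicator {0<..} r * (r powr (2 * \<alpha> + 1) * (exp (- s * r\<^sup>2 / 2) * bessel_j \<alpha> (r * \<rho>))))"
    and abs_series: "summable (\<lambda>k. norm (c k * w k r))" for r
  proof -
    let ?B = "indicator {0<..} r * (r powr (2 * \<alpha> + 1) * exp (- s * r\<^sup>2 / 2))"
    have eq: "c k * w k r = ?B * (bessel_coeff \<alpha> k * ((r * \<rho>)\<^sup>2) ^ k)" for k
    proof (cases "r > 0")
      case True
      then have "r powr (2 * (\<alpha> + real k + 1) - 1) = r powr (2 * \<alpha> + 1) * r powr (real (2 * k))"
        by (simp flip: powr_add) (simp add: algebra_simps)
      also have "r powr (real (2 * k)) = (r\<^sup>2) ^ k"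
        using True by (subst powr_realpow) (auto simp: power_mult)
      finally show ?thesis by (simp add: c_def w_def power_mult_distrib)
    qed (simp add: w_def)
    have "(\<lambda>k. bessel_coeff \<alpha> k * ((r * \<rho>)\<^sup>2) ^ k) sums bessel_j \<alpha> (r * \<rho>)"
      using summable_sums[OF summable_bessel[OF \<alpha>]] by (simp add: bessel_j_eq_series[OF \<alpha>] bessel_series_def)
    from sums_mult[OF this, of ?B] show "(\<lambda>k. c k * w k r) sums
      (indicator {0<..} r * (r powr (2 * \<alpha> + 1) * (exp (- s * r\<^sup>2 / 2) * bessel_j \<alpha> (r * \<rho>))))"
      unfolding eq by (simp add: mult.assoc)
    \<comment> \<open>A power series converges absolutely at every point of smaller modulus than a
      point of convergence, hence the shift by 1.\<close>
    have "summable (\<lambda>k. norm (bessel_coeff \<alpha> k * ((r * \<rho>)\<^sup>2) ^ k))"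
      by (rule powser_insidea[OF summable_bessel[OF \<alpha>, of "(r * \<rho>)\<^sup>2 + 1"]]) simp
    then show "summable (\<lambda>k. norm (c k * w k r))"
      unfolding eq norm_mult[of ?B] by (rule summable_mult)
  qed
  have snint: "summable (\<lambda>k. \<integral>r. norm (c k * w k r) \<partial>lborel)"
    unfolding nint by (intro summable_mult) (use summable_exp[of "\<rho>\<^sup>2 / (2 * s)"] in \<open>simp add: field_simps\<close>)
  have "has_bochner_integral lborel (\<lambda>r. \<Sum>k. c k * w k r) (\<Sum>k. \<integral>r. c k * w k r \<partial>lborel)"
    unfolding has_bochner_integral_iff
    using integrable_suminf[OF int _ snint] integral_suminf[OF int _ snint] abs_series by auto
  moreover have "(\<Sum>k. c k * w k r) = indicator {0<..} r * (r powr (2 * \<alpha> + 1) * (exp (- s * r\<^sup>2 / 2) * bessel_j \<alpha> (r * \<rho>)))" for r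
    using series[of r] by (simp add: sums_iff)
  moreover have "(\<Sum>k. \<integral>r. c k * w k r \<partial>lborel) = A * exp (- \<rho>\<^sup>2 / (2 * s))"
  proof -
    have "(\<integral>r. c k * w k r \<partial>lborel) = A * ((- \<rho>\<^sup>2 / (2 * s)) ^ k / fact k)" for k
      using w[of k] by (simp add: has_bochner_integral_iff cI)
    moreover have "(\<lambda>k. A * ((- \<rho>\<^sup>2 / (2 * s)) ^ k / fact k)) sums (A * exp (- \<rho>\<^sup>2 / (2 * s)))"
      using exp_converges[of "- \<rho>\<^sup>2 / (2 * s)"] by (intro sums_mult) (simp add: field_simps)
    ultimately show ?thesis by (simp add: sums_iff)
  qed
  ultimately show ?thesis by (simp add: A_def)
qed

subsection \<open>Gaussians and the Weinstein transform\<close>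

text \<open>Fubini in coordinates: \<open>lborel\<close> on a Euclidean space is the image of a
  product of one-dimensional copies of \<open>lborel\<close>.\<close>

lemma has_bochner_integral_lborel_prod:
  fixes f :: "'a::euclidean_space \<Rightarrow> real \<Rightarrow> complex"
  assumes f: "\<And>b. b \<in> Basis \<Longrightarrow> has_bochner_integral lborel (f b) (I b)"
  shows "has_bochner_integral lborel (\<lambda>x::'a. \<Prod>b\<in>Basis. f b (x \<bullet> b)) (\<Prod>b\<in>Basis. I b)"
proof -
  interpret product_sigma_finite "\<lambda>_::'a. lborel :: real measure" ..
  define T :: "('a \<Rightarrow> real) \<Rightarrow> 'a" where "T g = (\<Sum>b\<in>Basis. g b *\<^sub>R b)" for g
  let ?P = "\<Pi>\<^sub>M b\<in>(Basis::'a set). (lborel :: real measure)"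
  have L: "(lborel :: 'a measure) = distr ?P borel T"
    unfolding T_def[abs_def] by (rule lborel_eq)
  have int: "integrable lborel (f b)" "(\<integral>x. f b x \<partial>lborel) = I b" if "b \<in> Basis" for b
    using f[OF that] by (simp_all add: has_bochner_integral_iff)
  have [measurable]: "f b \<in> borel_measurable borel" if "b \<in> Basis" for b
    using borel_measurable_integrable[OF int(1)[OF that]] by simp
  have T: "T \<in> measurable ?P borel" unfolding T_def by measurable
  have m: "(\<lambda>x::'a. \<Prod>b\<in>Basis. f b (x \<bullet> b)) \<in> borel_measurable borel" by measurable
  have eq: "(\<Prod>b\<in>Basis. f b (T g \<bullet> b)) = (\<Prod>b\<in>Basis. f b (g b))" for g
    unfolding T_def by (intro prod.cong refl) simp
  have "integrable ?P (\<lambda>g. \<Prod>b\<in>Basis. f b (g b))"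
    by (rule product_integrable_prod) (use int in auto)
  moreover have "(\<integral>g. (\<Prod>b\<in>Basis. f b (g b)) \<partial>?P) = (\<Prod>b\<in>Basis. I b)"
    by (subst product_integral_prod) (use int in auto)
  ultimately show ?thesis
    unfolding L has_bochner_integral_iff integrable_distr_eq[OF T m] integral_distr[OF T m] eq by simp
qed

text \<open>Up to the normalisation \<open>sqrt (2 * pi)\<close>, this is the characteristic
  function of the standard normal distribution at b.\<close>

lemma has_bochner_integral_std_gaussian:
  "has_bochner_integral lborel (\<lambda>x. exp (- complex_of_real (x\<^sup>2 / 2) + \<i> * complex_of_real (b * x)))
     (complex_of_real (sqrt (2 * pi) * exp (- b\<^sup>2 / 2)))"
proof -
  let ?f = "\<lambda>x. exp (- complex_of_real (x\<^sup>2 / 2) + \<i> * complex_of_real (b * x))"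
  have eq: "?f x = sqrt (2 * pi) * (std_normal_density x *\<^sub>R iexp (b * x))" for x
  proof -
    have "?f x = complex_of_real (exp (- (x\<^sup>2 / 2))) * iexp (b * x)"
      by (simp only: exp_add exp_of_real of_real_minus[symmetric])
    also have "complex_of_real (exp (- (x\<^sup>2 / 2))) = complex_of_real (sqrt (2 * pi)) * complex_of_real (std_normal_density x)"
      unfolding std_normal_density_def of_real_mult[symmetric] by simp
    finally show ?thesis by (simp add: scaleR_conv_of_real mult.assoc)
  qed
  have i: "integrable lborel (\<lambda>x. std_normal_density x *\<^sub>R iexp (b * x))"
    by (rule Bochner_Integration.integrable_bound[of _ std_normal_density])
      (auto simp: integrable_std_normal_distribution_moment)
  have "(\<integral>x. std_normal_density x *\<^sub>R iexp (b * x) \<partial>lborel) = char std_normal_distribution b"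
    unfolding char_def by (subst integral_density) auto
  also have "\<dots> = complex_of_real (exp (- b\<^sup>2 / 2))"
    unfolding char_std_normal_distribution by simp
  finally have "has_bochner_integral lborel (\<lambda>x. std_normal_density x *\<^sub>R iexp (b * x))
      (complex_of_real (exp (- b\<^sup>2 / 2)))"
    using i by (simp add: has_bochner_integral_iff)
  then have "has_bochner_integral lborel (\<lambda>x. complex_of_real (sqrt (2 * pi)) * (std_normal_density x *\<^sub>R iexp (b * x)))
      (complex_of_real (sqrt (2 * pi)) * complex_of_real (exp (- b\<^sup>2 / 2)))"
    by (rule has_bochner_integral_mult_right)
  then show ?thesis unfolding eq by (simp only: of_real_mult)
qed

text \<open>For \<open>a = 0\<close> the integral splits into coordinates. The real linear term is
  then absorbed by the translation \<open>x \<mapsto> a + x\<close>, so completing the square needs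
  no contour shift.\<close>

lemma has_bochner_integral_gaussian:
  fixes a b :: "'a::euclidean_space"
  shows "has_bochner_integral lborel
    (\<lambda>x. exp (complex_of_real (a \<bullet> x - (norm x)\<^sup>2 / 2) + \<i> * complex_of_real (b \<bullet> x)))
    (complex_of_real (sqrt (2 * pi)) ^ DIM('a) *
      exp (complex_of_real (((norm a)\<^sup>2 - (norm b)\<^sup>2) / 2) + \<i> * complex_of_real (a \<bullet> b)))"
proof -
  define F where "F x = exp (complex_of_real (a \<bullet> x - (norm x)\<^sup>2 / 2) + \<i> * complex_of_real (b \<bullet> x))" for x :: 'a
  have [measurable]: "F \<in> borel_measurable borel"
    unfolding F_def by measurable
  define F0 where "F0 x = (\<Prod>j\<in>Basis. exp (- complex_of_real ((x \<bullet> j)\<^sup>2 / 2) + \<i> * complex_of_real ((b \<bullet> j) * (x \<bullet> j))))" for x :: 'a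
  have F0': "has_bochner_integral lborel F0 (\<Prod>j\<in>(Basis::'a set). complex_of_real (sqrt (2 * pi) * exp (- (b \<bullet> j)\<^sup>2 / 2)))"
    unfolding F0_def by (intro has_bochner_integral_lborel_prod has_bochner_integral_std_gaussian)
  have sq: "(\<Sum>j\<in>Basis. (x \<bullet> j)\<^sup>2) = (norm x)\<^sup>2" for x :: 'a
    using euclidean_inner[of x x] by (simp add: power2_eq_square dot_square_norm)
  have "(\<Prod>j\<in>(Basis::'a set). exp (- (b \<bullet> j)\<^sup>2 / 2)) = exp (\<Sum>j\<in>Basis. - (b \<bullet> j)\<^sup>2 / 2)"
    by (rule exp_sum[symmetric]) simp
  also have "(\<Sum>j\<in>Basis. - (b \<bullet> j)\<^sup>2 / 2) = - (norm b)\<^sup>2 / 2"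
    unfolding sq[symmetric] by (simp add: sum_negf sum_divide_distrib)
  finally have "(\<Prod>j\<in>(Basis::'a set). complex_of_real (sqrt (2 * pi) * exp (- (b \<bullet> j)\<^sup>2 / 2)))
    = complex_of_real (sqrt (2 * pi) ^ DIM('a) * exp (- (norm b)\<^sup>2 / 2))"
    unfolding of_real_prod[symmetric] prod.distrib by simp
  with F0' have F0: "has_bochner_integral lborel F0
      (complex_of_real (sqrt (2 * pi)) ^ DIM('a) * complex_of_real (exp (- (norm b)\<^sup>2 / 2)))" by simp
  have F0_eq: "F0 x = exp (- complex_of_real ((norm x)\<^sup>2 / 2) + \<i> * complex_of_real (b \<bullet> x))" for x
  proof -
    have "F0 x = exp (\<Sum>j\<in>Basis. - complex_of_real ((x \<bullet> j)\<^sup>2 / 2) + \<i> * complex_of_real ((b \<bullet> j) * (x \<bullet> j)))"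
      unfolding F0_def by (simp add: exp_sum)
    also have "(\<Sum>j\<in>Basis. - complex_of_real ((x \<bullet> j)\<^sup>2 / 2) + \<i> * complex_of_real ((b \<bullet> j) * (x \<bullet> j)))
       = - complex_of_real ((\<Sum>j\<in>Basis. (x \<bullet> j)\<^sup>2) / 2) + \<i> * complex_of_real (\<Sum>j\<in>Basis. (b \<bullet> j) * (x \<bullet> j))"
      by (simp add: sum.distrib sum_negf sum_subtractf sum_distrib_left sum_divide_distrib)
    finally show ?thesis unfolding sq euclidean_inner[of b x, symmetric] .
  qed
  define k where "k = exp (complex_of_real ((norm a)\<^sup>2 / 2) + \<i> * complex_of_real (a \<bullet> b))"
  have shift: "F (a + x) = k * F0 x" for x
  proof -
    have "(norm (a + x))\<^sup>2 = (norm a)\<^sup>2 + 2 * (a \<bullet> x) + (norm x)\<^sup>2"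
      by (simp add: power2_norm_eq_inner inner_add_left inner_add_right inner_commute)
    moreover have "a \<bullet> (a + x) = (norm a)\<^sup>2 + a \<bullet> x"
      by (simp add: power2_norm_eq_inner inner_add)
    ultimately have sh1: "a \<bullet> (a + x) - (norm (a + x))\<^sup>2 / 2 = (norm a)\<^sup>2 / 2 - (norm x)\<^sup>2 / 2"
      by (simp add: field_simps)
    have sh2: "b \<bullet> (a + x) = a \<bullet> b + b \<bullet> x" by (simp add: inner_add_right inner_commute)
    show ?thesis
      unfolding F_def F0_eq k_def exp_add[symmetric] sh1 sh2
      by (intro arg_cong[where f=exp]) (simp add: algebra_simps)
  qed
  have L: "(lborel :: 'a measure) = distr lborel borel ((+) a)"
    by (rule lborel_distr_plus[symmetric])
  have "has_bochner_integral lborel (\<lambda>x. F (a + x))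
     (k * (complex_of_real (sqrt (2 * pi)) ^ DIM('a) * complex_of_real (exp (- (norm b)\<^sup>2 / 2))))"
    unfolding shift by (intro has_bochner_integral_mult_right F0)
  then have "has_bochner_integral lborel F
     (k * (complex_of_real (sqrt (2 * pi)) ^ DIM('a) * complex_of_real (exp (- (norm b)\<^sup>2 / 2))))"
    by (subst L) (simp add: has_bochner_integral_iff integrable_distr_eq integral_distr)
  moreover have "k * complex_of_real (exp (- (norm b)\<^sup>2 / 2)) =
      exp (complex_of_real (((norm a)\<^sup>2 - (norm b)\<^sup>2) / 2) + \<i> * complex_of_real (a \<bullet> b))"
    unfolding k_def by (simp add: exp_of_real[symmetric] exp_add[symmetric] diff_divide_distrib algebra_simps)
  then have "k * (complex_of_real (sqrt (2 * pi)) ^ DIM('a) * complex_of_real (exp (- (norm b)\<^sup>2 / 2))) =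
      complex_of_real (sqrt (2 * pi)) ^ DIM('a) *
      exp (complex_of_real (((norm a)\<^sup>2 - (norm b)\<^sup>2) / 2) + \<i> * complex_of_real (a \<bullet> b))"
    by (subst mult.left_commute) (simp only:)
  with calculation show ?thesis
    unfolding F_def[abs_def] by (simp only:)
qed


section \<open>The Weinstein measure: null sets, measurability and reduction of integrals to
  \<open>lborel\<close>\<close>

definition weinstein_density :: "real \<Rightarrow> (real ^ 'd) \<times> real \<Rightarrow> real" where
  "weinstein_density \<alpha> x = snd x powr (2 * \<alpha> + 1) /
     ((2 * pi) powr (real CARD('d) / 2) * 2 powr \<alpha> * Gamma (\<alpha> + 1))"

lemma weinstein_measure_altdef:
  "weinstein_measure \<alpha> = density (lebesgue_on half_space) (\<lambda>x. ennreal (weinstein_density \<alpha> x))"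
  by (simp add: weinstein_measure_def weinstein_density_def)

lemma weinstein_density_nonneg: "\<alpha> > -1/2 \<Longrightarrow> 0 \<le> weinstein_density \<alpha> x"
  using Gamma_real_pos[of "\<alpha> + 1"] by (simp add: weinstein_density_def)

lemma borel_measurable_weinstein_density [measurable]: "weinstein_density \<alpha> \<in> borel_measurable borel"
  unfolding weinstein_density_def[abs_def] borel_prod[symmetric] by measurable

lemma borel_measurable_weinstein_density_half_space:
  "(weinstein_density \<alpha> :: (real ^ 'd) \<times> real \<Rightarrow> real) \<in> borel_measurable (lebesgue_on half_space)"
  using borel_measurable_weinstein_density by (simp add: measurable_completion measurable_restrict_space1)

lemma half_space_borel [measurable]: "(half_space :: ((real ^ 'd) \<times> real) set) \<in> sets borel"
proof -
  have "open {x :: (real ^ 'd) \<times> real. 0 < snd x}"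
    by (intro open_Collect_less continuous_intros)
  then show ?thesis by (simp add: half_space_def)
qed

lemma half_space_lebesgue: "half_space \<in> sets lebesgue"
  using half_space_borel by (simp add: sets_completionI_sets)

lemma weinstein_density_pos: "\<alpha> > -1/2 \<Longrightarrow> x \<in> half_space \<Longrightarrow> 0 < weinstein_density \<alpha> x"
  using Gamma_real_pos[of "\<alpha> + 1"] by (simp add: weinstein_density_def half_space_def)

text \<open>The density is strictly positive on the half-space, so it creates no new null
  sets.\<close>

lemma AE_weinstein_measure_iff:
  fixes P :: "(real ^ 'd) \<times> real \<Rightarrow> bool"
  assumes \<alpha>: "\<alpha> > -1/2"
  shows "(AE x in weinstein_measure \<alpha>. P x) \<longleftrightarrow> (AE x in lebesgue. x \<in> half_space \<longrightarrow> P x)"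
proof -
  have m: "(\<lambda>x :: (real ^ 'd) \<times> real. ennreal (weinstein_density \<alpha> x)) \<in> borel_measurable (lebesgue_on half_space)"
    by (rule measurable_compose[OF borel_measurable_weinstein_density_half_space measurable_ennreal])
  have half: "(half_space :: ((real ^ 'd) \<times> real) set) \<inter> space lebesgue \<in> sets lebesgue"
    using half_space_lebesgue by simp
  show ?thesis
    unfolding weinstein_measure_altdef AE_density[OF m] AE_restrict_space_iff[OF half]
    using weinstein_density_pos[OF \<alpha>] by (intro AE_cong) auto
qed

lemma space_weinstein_measure [simp]: "space (weinstein_measure \<alpha>) = half_space"
  by (simp add: weinstein_measure_altdef)

lemma borel_measurable_weinstein_measure:
  "f \<in> borel_measurable borel \<Longrightarrow> f \<in> borel_measurable (weinstein_measure \<alpha>)"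
  unfolding weinstein_measure_altdef
  by (simp add: measurable_completion measurable_restrict_space1)

text \<open>The measure lives on a completed sigma-algebra, whereas explicit product integrals are
  computed with \<open>lborel\<close>; for Borel integrands the two agree.\<close>

lemma has_bochner_integral_weinstein_measure:
  fixes f :: "(real ^ 'd) \<times> real \<Rightarrow> complex"
  assumes \<alpha>: "\<alpha> > -1/2" and f: "f \<in> borel_measurable borel"
    and I: "has_bochner_integral lborel (\<lambda>x. indicator half_space x *\<^sub>R (weinstein_density \<alpha> x *\<^sub>R f x)) I"
  shows "has_bochner_integral (weinstein_measure \<alpha>) f I"
proof -
  have f': "f \<in> borel_measurable (lebesgue_on half_space)"
    using f by (simp add: measurable_completion measurable_restrict_space1)
  note w' = borel_measurable_weinstein_density_half_space
  have w0: "AE x in lebesgue_on half_space. 0 \<le> weinstein_density \<alpha> (x :: (real ^ 'd) \<times> real)"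
    by (intro AE_I2 weinstein_density_nonneg \<alpha>)
  have m: "(\<lambda>x. indicator half_space x *\<^sub>R (weinstein_density \<alpha> x *\<^sub>R f x)) \<in> borel_measurable lborel"
    using f by simp
  have half: "(half_space :: ((real ^ 'd) \<times> real) set) \<inter> space lebesgue \<in> sets lebesgue"
    using half_space_lebesgue by simp
  show ?thesis
    using I unfolding has_bochner_integral_iff weinstein_measure_altdef
      integrable_density[OF f' w' w0] integral_density[OF f' w' w0]
      integrable_restrict_space[OF half] integral_restrict_space[OF half]
      integrable_completion[OF m] integral_completion[OF m] .
qed

lemma has_bochner_integral_weinstein_prod:
  fixes u :: "real ^ 'd \<Rightarrow> complex"
  assumes \<alpha>: "\<alpha> > -1/2" and u: "has_bochner_integral lborel u I"
    and v: "has_bochner_integral lborel (\<lambda>r. indicator {0<..} r *\<^sub>R (r powr (2 * \<alpha> + 1) *\<^sub>R v r)) J"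
    and v_borel [measurable]: "v \<in> borel_measurable borel"
  shows "has_bochner_integral (weinstein_measure \<alpha>) (\<lambda>x. u (fst x) * v (snd x))
    (I * J / complex_of_real ((2 * pi) powr (real CARD('d) / 2) * 2 powr \<alpha> * Gamma (\<alpha> + 1)))"
proof (rule has_bochner_integral_weinstein_measure[OF \<alpha>])
  define V where "V r = indicator {0<..} r *\<^sub>R (r powr (2 * \<alpha> + 1) *\<^sub>R v r)" for r
  define C where "C = (2 * pi) powr (real CARD('d) / 2) * 2 powr \<alpha> * Gamma (\<alpha> + 1)"
  have ui: "integrable lborel u" "(\<integral>x. u x \<partial>lborel) = I" using u by (simp_all add: has_bochner_integral_iff)
  have vi: "integrable lborel V" "(\<integral>x. V x \<partial>lborel) = J"
    using v unfolding V_def[abs_def] by (simp_all add: has_bochner_integral_iff)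
  have [measurable]: "u \<in> borel_measurable borel" "V \<in> borel_measurable borel"
    using borel_measurable_integrable[OF ui(1)] borel_measurable_integrable[OF vi(1)] by simp_all
  show "(\<lambda>x. u (fst x) * v (snd x)) \<in> borel_measurable borel"
    unfolding borel_prod[symmetric] by measurable
  let ?F = "\<lambda>(x, r). u x * V r"
  have int: "integrable (lborel \<Otimes>\<^sub>M lborel) ?F"
  proof (rule lborel_pair.Fubini_integrable)
    show "integrable lborel (\<lambda>x. \<integral>y. norm (case (x, y) of (x, r) \<Rightarrow> u x * V r) \<partial>lborel)"
      using ui(1) by (simp add: norm_mult)
    show "AE x in lborel. integrable lborel (\<lambda>y. case (x, y) of (x, r) \<Rightarrow> u x * V r)"
      using vi(1) by simp
  qed simp
  have "(\<integral>z. ?F z \<partial>(lborel \<Otimes>\<^sub>M lborel)) = (\<integral>x. \<integral>r. u x * V r \<partial>lborel \<partial>lborel)"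
    using lborel_pair.integral_fst'[OF int] by simp
  also have "\<dots> = I * J" using ui vi by simp
  finally have "has_bochner_integral lborel ?F (I * J)"
    using int by (simp add: has_bochner_integral_iff lborel_prod)
  then have "has_bochner_integral lborel (\<lambda>z. ?F z / complex_of_real C) (I * J / complex_of_real C)"
    by (rule has_bochner_integral_divide)
  also have "(\<lambda>z. ?F z / complex_of_real C) = (\<lambda>x. indicator half_space x *\<^sub>R (weinstein_density \<alpha> x *\<^sub>R (u (fst x) * v (snd x))))"
    by (auto simp: fun_eq_iff V_def weinstein_density_def half_space_def indicator_def C_def scaleR_conv_of_real)
  finally show "has_bochner_integral lborel (\<lambda>x. indicator half_space x *\<^sub>R (weinstein_density \<alpha> x *\<^sub>R (u (fst x) * v (snd x))))
    (I * J / complex_of_real ((2 * pi) powr (real CARD('d) / 2) * 2 powr \<alpha> * Gamma (\<alpha> + 1)))"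
    unfolding C_def .
qed

text \<open>In x' the quadratic part is fixed and only the complex linear term a + i b varies; in
  the last coordinate the parameter s varies. The transform sends (a, b, s) to (b, -a, 1/s). The
  fixed width in x' is thus self-dual, and the real term a has to be present because modulations b
  turn into it.\<close>

definition gauss :: "real ^ 'd \<Rightarrow> real ^ 'd \<Rightarrow> real \<Rightarrow> (real ^ 'd) \<times> real \<Rightarrow> complex" where
  "gauss a b s x = exp (complex_of_real (a \<bullet> fst x - (norm (fst x))\<^sup>2 / 2) + \<i> * complex_of_real (b \<bullet> fst x)) *
     complex_of_real (exp (- s * (snd x)\<^sup>2 / 2))"

text \<open>The scalar that the transform produces: the power of s comes from the Bessel integral,
  the exponential from completing the square in x'.\<close>

definition gauss_factor :: "real \<Rightarrow> real ^ 'd \<Rightarrow> real ^ 'd \<Rightarrow> real \<Rightarrow> complex" where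
  "gauss_factor \<alpha> a b s = complex_of_real (s powr (- (\<alpha> + 1))) *
     exp (complex_of_real (((norm a)\<^sup>2 - (norm b)\<^sup>2) / 2) + \<i> * complex_of_real (a \<bullet> b))"

lemma borel_measurable_gauss [measurable]: "gauss a b s \<in> borel_measurable borel"
  unfolding gauss_def[abs_def] borel_prod[symmetric] by measurable

text \<open>The integral factors over x' and the last coordinate. The frequency l changes b into
  \<open>b - fst l\<close> in the first factor, and the constants (2 pi)^(d/2) and
  \<open>2 powr \<alpha> * Gamma (\<alpha> + 1)\<close> of the two integrals cancel the denominator
  of the density exactly.\<close>

lemma has_bochner_integral_gauss_kernel:
  fixes a b :: "real ^ 'd"
  assumes \<alpha>: "\<alpha> > -1/2" and s: "s > 0"
  shows "has_bochner_integral (weinstein_measure \<alpha>) (\<lambda>x. gauss a b s x * weinstein_kernel \<alpha> l x)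
    (gauss_factor \<alpha> a b s * gauss b (- a) (1 / s) l)"
proof -
  define u where "u x = exp (complex_of_real (a \<bullet> x - (norm x)\<^sup>2 / 2) + \<i> * complex_of_real ((b - fst l) \<bullet> x))" for x
  define v where "v r = complex_of_real (exp (- s * r\<^sup>2 / 2) * bessel_j \<alpha> (r * snd l))" for r
  define n where "n = complex_of_real (sqrt (2 * pi)) ^ CARD('d)"
  define G where "G = 2 powr \<alpha> * Gamma (\<alpha> + 1)"
  have G: "G > 0" using \<alpha> Gamma_real_pos[of "\<alpha> + 1"] by (simp add: G_def)
  have [measurable]: "v \<in> borel_measurable borel"
    unfolding v_def using borel_measurable_bessel_j[OF \<alpha>] by measurable
  have u: "has_bochner_integral lborel u
      (n * exp (complex_of_real (((norm a)\<^sup>2 - (norm (b - fst l))\<^sup>2) / 2) + \<i> * complex_of_real (a \<bullet> (b - fst l))))"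
    unfolding u_def[abs_def] n_def using has_bochner_integral_gaussian[of a "b - fst l"] by simp
  have "has_bochner_integral lborel
    (\<lambda>r. complex_of_real (indicator {0<..} r * (r powr (2 * \<alpha> + 1) * (exp (- s * r\<^sup>2 / 2) * bessel_j \<alpha> (r * snd l)))))
    (complex_of_real (G / s powr (\<alpha> + 1) * exp (- (snd l)\<^sup>2 / (2 * s))))"
    unfolding G_def by (intro has_bochner_integral_of_real has_bochner_integral_gaussian_bessel \<alpha> s)
  then have v: "has_bochner_integral lborel (\<lambda>r. indicator {0<..} r *\<^sub>R (r powr (2 * \<alpha> + 1) *\<^sub>R v r))
    (complex_of_real (G / s powr (\<alpha> + 1) * exp (- (snd l)\<^sup>2 / (2 * s))))"
    unfolding v_def scaleR_conv_of_real of_real_mult .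
  have C: "complex_of_real ((2 * pi) powr (real CARD('d) / 2) * 2 powr \<alpha> * Gamma (\<alpha> + 1)) = n * complex_of_real G"
  proof -
    have "(2 * pi) powr (real CARD('d) / 2) = ((2 * pi) powr (1 / 2)) powr real CARD('d)"
      by (simp add: powr_powr)
    also have "\<dots> = sqrt (2 * pi) ^ CARD('d)"
      by (subst powr_realpow) (simp_all add: powr_half_sqrt)
    finally show ?thesis by (simp add: n_def G_def)
  qed
  have n: "n \<noteq> 0" by (simp add: n_def)
  define E where "E = exp (complex_of_real (((norm a)\<^sup>2 - (norm (b - fst l))\<^sup>2) / 2) + \<i> * complex_of_real (a \<bullet> (b - fst l)))"
  have E: "E = exp (complex_of_real (((norm a)\<^sup>2 - (norm b)\<^sup>2) / 2) + \<i> * complex_of_real (a \<bullet> b)) *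
    exp (complex_of_real (b \<bullet> fst l - (norm (fst l))\<^sup>2 / 2) + \<i> * complex_of_real ((- a) \<bullet> fst l))"
  proof -
    have "(norm (b - fst l))\<^sup>2 = (norm b)\<^sup>2 - 2 * (b \<bullet> fst l) + (norm (fst l))\<^sup>2"
      by (simp add: power2_norm_eq_inner inner_diff_left inner_diff_right inner_commute)
    then have e1: "((norm a)\<^sup>2 - (norm (b - fst l))\<^sup>2) / 2 = ((norm a)\<^sup>2 - (norm b)\<^sup>2) / 2 + (b \<bullet> fst l - (norm (fst l))\<^sup>2 / 2)"
      by (simp add: field_simps)
    have e2: "a \<bullet> (b - fst l) = a \<bullet> b + (- a) \<bullet> fst l" by (simp add: inner_diff_right)
    show ?thesis unfolding E_def e1 e2 of_real_add exp_add[symmetric] by (simp add: algebra_simps)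
  qed
  have "has_bochner_integral (weinstein_measure \<alpha>) (\<lambda>x. u (fst x) * v (snd x))
    (n * E * complex_of_real (G / s powr (\<alpha> + 1) * exp (- (snd l)\<^sup>2 / (2 * s))) / (n * complex_of_real G))"
    unfolding C[symmetric] E_def by (rule has_bochner_integral_weinstein_prod[OF \<alpha> u v]) measurable
  moreover have "u (fst x) * v (snd x) = gauss a b s x * weinstein_kernel \<alpha> l x" for x
  proof -
    have "u (fst x) = exp (complex_of_real (a \<bullet> fst x - (norm (fst x))\<^sup>2 / 2) + \<i> * complex_of_real (b \<bullet> fst x)) *
      exp (- (\<i> * complex_of_real (fst x \<bullet> fst l)))"
      unfolding u_def exp_add[symmetric] by (simp add: inner_diff_left inner_commute algebra_simps)
    then show ?thesis by (simp add: gauss_def weinstein_kernel_def v_def)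
  qed
  moreover have "n * E * complex_of_real (G / s powr (\<alpha> + 1) * exp (- (snd l)\<^sup>2 / (2 * s))) / (n * complex_of_real G)
    = gauss_factor \<alpha> a b s * gauss b (- a) (1 / s) l"
    unfolding E gauss_factor_def gauss_def powr_minus_divide using n G s by (simp add: field_simps)
  ultimately show ?thesis by simp
qed

lemma bessel_j_0 [simp]: "\<alpha> > -1/2 \<Longrightarrow> bessel_j \<alpha> 0 = 1"
  using less_imp_neq[OF Gamma_real_pos, of "\<alpha> + 1"]
  by (simp add: bessel_j_eq_series bessel_series_def powser_zero bessel_coeff_0)

text \<open>At frequency 0 the kernel is constantly 1, so the formula for the transform already
  contains integrability.\<close>

lemma integrable_gauss:
  fixes a b :: "real ^ 'd"
  assumes "\<alpha> > -1/2" "s > 0"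
  shows "integrable (weinstein_measure \<alpha>) (gauss a b s)"
proof -
  have "weinstein_kernel \<alpha> 0 x = 1" for x :: "(real ^ 'd) \<times> real"
    using assms by (simp add: weinstein_kernel_def)
  then show ?thesis
    using has_bochner_integral_gauss_kernel[OF assms, of a b 0] by (simp add: has_bochner_integral_iff)
qed

lemma norm_gauss_le: "0 < s \<Longrightarrow> cmod (gauss a b s x) \<le> exp ((norm a)\<^sup>2 / 2)"
proof -
  assume s: "0 < s"
  have "a \<bullet> fst x \<le> norm a * norm (fst x)" by (rule norm_cauchy_schwarz)
  also have "\<dots> \<le> ((norm a)\<^sup>2 + (norm (fst x))\<^sup>2) / 2"
    using sum_squares_bound[of "norm a" "norm (fst x)"] by simp
  finally have "exp (a \<bullet> fst x - (norm (fst x))\<^sup>2 / 2) \<le> exp ((norm a)\<^sup>2 / 2)" by simp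
  moreover have "exp (- s * (snd x)\<^sup>2 / 2) \<le> 1" using s by simp
  ultimately have "exp (a \<bullet> fst x - (norm (fst x))\<^sup>2 / 2) * exp (- s * (snd x)\<^sup>2 / 2) \<le> exp ((norm a)\<^sup>2 / 2) * 1"
    by (intro mult_mono) auto
  then show ?thesis by (simp add: gauss_def norm_mult)
qed


section \<open>Kernel bounds and elementary rules for the integral transform\<close>

lemma reflect_in_half_space [simp]: "reflect x \<in> half_space \<longleftrightarrow> x \<in> half_space"
  by (simp add: reflect_def half_space_def)

lemma continuous_weinstein_kernel:
  assumes "\<alpha> > -1/2"
  shows "continuous_on UNIV (\<lambda>p :: ((real ^ 'd) \<times> real) \<times> ((real ^ 'd) \<times> real). weinstein_kernel \<alpha> (fst p) (snd p))"
proof -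
  have "continuous_on UNIV (\<lambda>p :: ((real ^ 'd) \<times> real) \<times> ((real ^ 'd) \<times> real). bessel_j \<alpha> (snd (snd p) * snd (fst p)))"
    by (rule continuous_on_compose2[OF continuous_on_bessel_j[OF assms]]) (auto intro!: continuous_intros)
  then show ?thesis unfolding weinstein_kernel_def by (intro continuous_intros)
qed

lemma borel_measurable_weinstein_kernel:
  assumes "\<alpha> > -1/2"
  shows "weinstein_kernel \<alpha> l \<in> borel_measurable borel"
proof (rule borel_measurable_continuous_onI)
  have "continuous_on UNIV (\<lambda>x. (l, x))" by (intro continuous_on_Pair continuous_intros)
  then show "continuous_on UNIV (weinstein_kernel \<alpha> l)"
    using continuous_on_compose2[OF continuous_weinstein_kernel[OF assms], of UNIV "\<lambda>x. (l, x)"]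
    by simp
qed

lemma norm_weinstein_kernel_le:
  assumes "\<alpha> > -1/2"
  shows "cmod (weinstein_kernel \<alpha> l x) \<le> 1"
  using abs_bessel_j_le_1[OF assms] by (simp add: weinstein_kernel_def norm_mult)

text \<open>This symmetry makes the multiplication formula hold for one and the same transform on
  both sides.\<close>

lemma weinstein_kernel_commute: "weinstein_kernel \<alpha> l x = weinstein_kernel \<alpha> x l"
  by (simp add: weinstein_kernel_def inner_commute mult.commute)

lemma weinstein_kernel_reflect: "weinstein_kernel \<alpha> (reflect l) x = cnj (weinstein_kernel \<alpha> l x)"
  by (simp add: weinstein_kernel_def reflect_def exp_cnj)

text \<open>The kernel is bounded by 1, so f itself is a dominating function at every
  frequency.\<close>

lemma integrable_mult_weinstein_kernel:
  assumes "\<alpha> > -1/2" and f: "integrable (weinstein_measure \<alpha>) f"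
  shows "integrable (weinstein_measure \<alpha>) (\<lambda>x. f x * weinstein_kernel \<alpha> l x)"
proof (rule Bochner_Integration.integrable_bound[OF f])
  show "(\<lambda>x. f x * weinstein_kernel \<alpha> l x) \<in> borel_measurable (weinstein_measure \<alpha>)"
    using borel_measurable_integrable[OF f]
      borel_measurable_weinstein_measure[OF borel_measurable_weinstein_kernel[OF assms(1)]]
    by (rule borel_measurable_times)
  have "cmod (f x) * cmod (weinstein_kernel \<alpha> l x) \<le> cmod (f x) * 1" for x
    by (intro mult_left_mono norm_weinstein_kernel_le assms) auto
  then show "AE x in weinstein_measure \<alpha>. norm (f x * weinstein_kernel \<alpha> l x) \<le> norm (f x)"
    by (intro AE_I2) (simp add: norm_mult)
qed

lemma norm_weinstein_integral_le:
  assumes "\<alpha> > -1/2" and f: "integrable (weinstein_measure \<alpha>) f"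
  shows "cmod (weinstein_integral \<alpha> f l) \<le> (\<integral>x. cmod (f x) \<partial>weinstein_measure \<alpha>)"
proof -
  have "cmod (weinstein_integral \<alpha> f l) \<le> (\<integral>x. cmod (f x * weinstein_kernel \<alpha> l x) \<partial>weinstein_measure \<alpha>)"
    unfolding weinstein_integral_def by (rule integral_norm_bound)
  also have "\<dots> \<le> (\<integral>x. cmod (f x) \<partial>weinstein_measure \<alpha>)"
  proof (rule integral_mono)
    show "integrable (weinstein_measure \<alpha>) (\<lambda>x. cmod (f x * weinstein_kernel \<alpha> l x))"
      by (intro integrable_norm integrable_mult_weinstein_kernel assms)
    show "integrable (weinstein_measure \<alpha>) (\<lambda>x. cmod (f x))" using f by simp
    show "cmod (f x * weinstein_kernel \<alpha> l x) \<le> cmod (f x)" for x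
      using mult_left_mono[OF norm_weinstein_kernel_le[OF assms(1), of l x], of "cmod (f x)"]
      by (simp add: norm_mult)
  qed
  finally show ?thesis .
qed

lemma weinstein_integral_add:
  assumes "\<alpha> > -1/2" "integrable (weinstein_measure \<alpha>) f" "integrable (weinstein_measure \<alpha>) g"
  shows "weinstein_integral \<alpha> (\<lambda>x. f x + g x) l = weinstein_integral \<alpha> f l + weinstein_integral \<alpha> g l"
  unfolding weinstein_integral_def distrib_right
  by (intro Bochner_Integration.integral_add integrable_mult_weinstein_kernel assms)

lemma weinstein_integral_cmult: "weinstein_integral \<alpha> (\<lambda>x. c * f x) l = c * weinstein_integral \<alpha> f l"
  by (simp add: weinstein_integral_def mult.assoc)

lemma weinstein_integral_diff:
  assumes "\<alpha> > -1/2" "integrable (weinstein_measure \<alpha>) f" "integrable (weinstein_measure \<alpha>) g"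
  shows "weinstein_integral \<alpha> (\<lambda>x. f x - g x) l = weinstein_integral \<alpha> f l - weinstein_integral \<alpha> g l"
  unfolding weinstein_integral_def left_diff_distrib
  by (intro Bochner_Integration.integral_diff integrable_mult_weinstein_kernel assms)

text \<open>Required for Fubini: Lebesgue measure inherits the countable cover of
  \<open>lborel\<close>, and a density with finite values preserves sigma-finiteness.\<close>

lemma sigma_finite_weinstein_measure:
  assumes "\<alpha> > -1/2"
  shows "sigma_finite_measure (weinstein_measure \<alpha> :: ((real ^ 'd) \<times> real) measure)"
proof -
  have "sigma_finite_measure (lebesgue :: ((real ^ 'd) \<times> real) measure)"
  proof
    obtain A :: "((real ^ 'd) \<times> real) set set" where A: "countable A" "A \<subseteq> sets lborel" "\<Union>A = space lborel" "\<forall>a\<in>A. emeasure lborel a \<noteq> \<infinity>"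
      using lborel.sigma_finite_countable by blast
    then show "\<exists>A :: ((real ^ 'd) \<times> real) set set. countable A \<and> A \<subseteq> sets lebesgue \<and> \<Union>A = space lebesgue \<and> (\<forall>a\<in>A. emeasure lebesgue a \<noteq> \<infinity>)"
      by (intro exI[of _ A]) (auto simp: subset_iff)
  qed
  then interpret H: sigma_finite_measure "lebesgue_on (half_space :: ((real ^ 'd) \<times> real) set)"
    by (intro sigma_finite_measure_restrict_space half_space_lebesgue)
  show ?thesis
    unfolding weinstein_measure_altdef
    by (subst H.sigma_finite_iff_density_finite)
      (auto intro: measurable_compose[OF borel_measurable_weinstein_density_half_space measurable_ennreal])
qed

text \<open>A complex linear span. The scalar sits in the generators, so closure properties and
  identities reduce to a single Gaussian and to sums, and scalar multiples follow.\<close>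

inductive_set gauss_span :: "((real ^ 'd) \<times> real \<Rightarrow> complex) set" where
  gauss: "0 < s \<Longrightarrow> (\<lambda>x. c * gauss a b s x) \<in> gauss_span"
| add: "f \<in> gauss_span \<Longrightarrow> g \<in> gauss_span \<Longrightarrow> (\<lambda>x. f x + g x) \<in> gauss_span"

lemma gauss_span_cmult: "f \<in> gauss_span \<Longrightarrow> (\<lambda>x. c * f x) \<in> gauss_span"
proof (induction rule: gauss_span.induct)
  case (gauss s c' a b)
  then show ?case using gauss_span.gauss[of s "c * c'" a b] by (simp add: mult.assoc)
next
  case (add f g)
  then show ?case using gauss_span.add[of "\<lambda>x. c * f x" "\<lambda>x. c * g x"] by (simp add: distrib_left)
qed

lemma gauss_reflect: "gauss a b s (reflect x) = gauss (- a) (- b) s x"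
  by (simp add: gauss_def reflect_def)

lemma gauss_cnj: "cnj (gauss a b s x) = gauss a (- b) s x"
  by (simp add: gauss_def exp_cnj)

lemma gauss_span_reflect: "f \<in> gauss_span \<Longrightarrow> (\<lambda>x. f (reflect x)) \<in> gauss_span"
  by (induction rule: gauss_span.induct) (simp_all add: gauss_reflect gauss_span.intros)

lemma gauss_span_cnj: "f \<in> gauss_span \<Longrightarrow> (\<lambda>x. cnj (f x)) \<in> gauss_span"
  by (induction rule: gauss_span.induct) (simp_all add: gauss_cnj gauss_span.intros)

lemma gauss_span_borel: "f \<in> gauss_span \<Longrightarrow> f \<in> borel_measurable borel"
  by (induction rule: gauss_span.induct) simp_all

lemma gauss_span_bounded: "f \<in> gauss_span \<Longrightarrow> \<exists>B. \<forall>x. cmod (f x) \<le> B"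
proof (induction rule: gauss_span.induct)
  case (gauss s c a b)
  have "cmod (c * gauss a b s x) \<le> cmod c * exp ((norm a)\<^sup>2 / 2)" for x
    unfolding norm_mult by (intro mult_left_mono norm_gauss_le gauss) simp
  then show ?case by blast
next
  case (add f g)
  then obtain A B where "\<forall>x. cmod (f x) \<le> A" "\<forall>x. cmod (g x) \<le> B" by blast
  then have "cmod (f x + g x) \<le> A + B" for x by (meson add_mono norm_triangle_le)
  then show ?case by blast
qed

lemma gauss_span_integrable:
  assumes "\<alpha> > -1/2" "f \<in> gauss_span"
  shows "integrable (weinstein_measure \<alpha>) f"
  using assms(2)
  by (induction rule: gauss_span.induct)
    (intro integrable_mult_right integrable_gauss assms Bochner_Integration.integrable_add; assumption)+

lemma square_integrable_if_bounded:
  assumes f: "integrable M f" and B: "AE x in M. cmod (f x) \<le> B"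
  shows "square_integrable M f"
proof -
  have "integrable M (\<lambda>x. (cmod (f x))\<^sup>2)"
  proof (rule Bochner_Integration.integrable_bound)
    show "integrable M (\<lambda>x. B * cmod (f x))" using f by simp
    show "(\<lambda>x. (cmod (f x))\<^sup>2) \<in> borel_measurable M"
      using borel_measurable_integrable[OF f] by simp
    show "AE x in M. norm ((cmod (f x))\<^sup>2) \<le> norm (B * cmod (f x))"
      using B
    proof eventually_elim
      case (elim x)
      then have "cmod (f x) * cmod (f x) \<le> B * cmod (f x)" by (rule mult_right_mono) simp
      then show ?case by (simp add: power2_eq_square)
    qed
  qed
  then show ?thesis using f by (auto simp: square_integrable_def)
qed

lemma gauss_span_square_integrable:
  assumes "\<alpha> > -1/2" "f \<in> gauss_span"
  shows "square_integrable (weinstein_measure \<alpha>) f"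
proof -
  obtain B where "\<forall>x. cmod (f x) \<le> B" using gauss_span_bounded[OF assms(2)] by blast
  then show ?thesis
    by (intro square_integrable_if_bounded[where B=B] gauss_span_integrable assms AE_I2) blast
qed

lemma weinstein_integral_gauss:
  assumes "\<alpha> > -1/2" "0 < s"
  shows "weinstein_integral \<alpha> (gauss a b s) l = gauss_factor \<alpha> a b s * gauss b (- a) (1 / s) l"
  using has_bochner_integral_gauss_kernel[OF assms, of a b l]
  by (simp add: weinstein_integral_def has_bochner_integral_iff)

lemma weinstein_integral_gauss_span:
  assumes "\<alpha> > -1/2" "f \<in> gauss_span"
  shows "weinstein_integral \<alpha> f \<in> gauss_span"
  using assms(2)
proof (induction rule: gauss_span.induct)
  case (gauss s c a b)
  then have "weinstein_integral \<alpha> (\<lambda>x. c * gauss a b s x) = (\<lambda>l. (c * gauss_factor \<alpha> a b s) * gauss b (- a) (1 / s) l)"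
    using assms(1) by (simp add: fun_eq_iff weinstein_integral_cmult weinstein_integral_gauss)
  then show ?case using gauss by (simp only:) (rule gauss_span.gauss, simp)
next
  case (add f g)
  then have "weinstein_integral \<alpha> (\<lambda>x. f x + g x) = (\<lambda>l. weinstein_integral \<alpha> f l + weinstein_integral \<alpha> g l)"
    using assms(1) by (simp add: fun_eq_iff weinstein_integral_add gauss_span_integrable)
  then show ?case using add by (simp only:) (rule gauss_span.add)
qed

text \<open>Transform, reflect, transform moves (a, b, s) through (b, -a, 1/s) and (-b, a, 1/s) back
  to (a, b, s); transforming twice and reflecting does so through (b, -a, 1/s) and (-a, -b, s). The
  two equations are the scalars collected on these two routes.\<close>

lemma gauss_factor_inverse:
  assumes "0 < s"
  shows "gauss_factor \<alpha> a b s * gauss_factor \<alpha> (- b) a (1 / s) = 1"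
    "gauss_factor \<alpha> a b s * gauss_factor \<alpha> b (- a) (1 / s) = 1"
proof -
  have "s powr (- (\<alpha> + 1)) * (1 / s) powr (- (\<alpha> + 1)) = 1"
    using assms by (simp flip: powr_mult)
  then have p: "complex_of_real (s powr (- (\<alpha> + 1))) * complex_of_real ((1 / s) powr (- (\<alpha> + 1))) = 1"
    by (metis of_real_1 of_real_mult)
  have e: "exp (complex_of_real (((norm a)\<^sup>2 - (norm b)\<^sup>2) / 2) + \<i> * complex_of_real (a \<bullet> b)) *
    exp (complex_of_real (((norm b)\<^sup>2 - (norm a)\<^sup>2) / 2) + \<i> * complex_of_real (- (a \<bullet> b))) = 1"
    unfolding exp_add[symmetric] by (simp add: diff_divide_distrib)
  have e1: "exp (complex_of_real (((norm (- b))\<^sup>2 - (norm a)\<^sup>2) / 2) + \<i> * complex_of_real ((- b) \<bullet> a)) =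
     exp (complex_of_real (((norm b)\<^sup>2 - (norm a)\<^sup>2) / 2) + \<i> * complex_of_real (- (a \<bullet> b)))"
   "exp (complex_of_real (((norm b)\<^sup>2 - (norm (- a))\<^sup>2) / 2) + \<i> * complex_of_real (b \<bullet> (- a))) =
     exp (complex_of_real (((norm b)\<^sup>2 - (norm a)\<^sup>2) / 2) + \<i> * complex_of_real (- (a \<bullet> b)))"
    by (simp_all add: inner_commute)
  have "x * y * (x' * y') = 1" if "x * x' = 1" "y * y' = 1" for x y x' y' :: complex
    using that by (metis mult.assoc mult.left_commute mult.right_neutral)
  from this[OF p e] show "gauss_factor \<alpha> a b s * gauss_factor \<alpha> (- b) a (1 / s) = 1"
    "gauss_factor \<alpha> a b s * gauss_factor \<alpha> b (- a) (1 / s) = 1"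
    unfolding gauss_factor_def e1 by simp_all
qed

text \<open>Both orders occur later: the first gives inversion for \<open>transform_pair\<close>,
  the second the isometry on the span.\<close>

lemma weinstein_integral_inverse_gauss_span:
  assumes \<alpha>: "\<alpha> > -1/2" and "f \<in> gauss_span"
  shows "weinstein_integral \<alpha> (\<lambda>x. weinstein_integral \<alpha> f (reflect x)) l = f l"
    "weinstein_integral \<alpha> (weinstein_integral \<alpha> f) (reflect l) = f l"
proof -
  have "weinstein_integral \<alpha> (\<lambda>x. weinstein_integral \<alpha> f (reflect x)) l = f l \<and>
    weinstein_integral \<alpha> (weinstein_integral \<alpha> f) (reflect l) = f l"
    using assms(2)
  proof (induction rule: gauss_span.induct)
    case (gauss s c a b)
    have 1: "weinstein_integral \<alpha> (\<lambda>x. c * gauss a b s x) = (\<lambda>l. (c * gauss_factor \<alpha> a b s) * gauss b (- a) (1 / s) l)"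
      using \<alpha> gauss by (simp add: fun_eq_iff weinstein_integral_cmult weinstein_integral_gauss)
    have s: "0 < 1 / s" using gauss by simp
    show ?case
      unfolding 1 gauss_reflect weinstein_integral_cmult weinstein_integral_gauss[OF \<alpha> s]
      using gauss_factor_inverse[OF gauss, of \<alpha> a b]
      by (simp add: mult.assoc)
  next
    case (add f g)
    have 1: "weinstein_integral \<alpha> (\<lambda>x. f x + g x) = (\<lambda>l. weinstein_integral \<alpha> f l + weinstein_integral \<alpha> g l)"
      using \<alpha> add by (simp add: fun_eq_iff weinstein_integral_add gauss_span_integrable)
    have "integrable (weinstein_measure \<alpha>) (weinstein_integral \<alpha> f)"
      "integrable (weinstein_measure \<alpha>) (weinstein_integral \<alpha> g)"
      "integrable (weinstein_measure \<alpha>) (\<lambda>x. weinstein_integral \<alpha> f (reflect x))"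
      "integrable (weinstein_measure \<alpha>) (\<lambda>x. weinstein_integral \<alpha> g (reflect x))"
      by (intro gauss_span_integrable gauss_span_reflect weinstein_integral_gauss_span \<alpha> add)+
    then show ?case
      unfolding 1 using \<alpha> add by (simp add: weinstein_integral_add)
  qed
  then show "weinstein_integral \<alpha> (\<lambda>x. weinstein_integral \<alpha> f (reflect x)) l = f l"
    "weinstein_integral \<alpha> (weinstein_integral \<alpha> f) (reflect l) = f l" by auto
qed

text \<open>Fubini for \<open>f x * g y\<close> times the kernel, which is symmetric and bounded by
  1.\<close>

lemma weinstein_integral_multiplication_formula:
  fixes f g :: "(real ^ 'd) \<times> real \<Rightarrow> complex"
  assumes \<alpha>: "\<alpha> > -1/2" and f: "integrable (weinstein_measure \<alpha>) f" and g: "integrable (weinstein_measure \<alpha>) g"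
  shows "(\<integral>x. weinstein_integral \<alpha> f x * g x \<partial>weinstein_measure \<alpha>) =
    (\<integral>x. f x * weinstein_integral \<alpha> g x \<partial>weinstein_measure \<alpha>)"
proof -
  let ?M = "weinstein_measure \<alpha> :: ((real ^ 'd) \<times> real) measure"
  interpret pair_sigma_finite ?M ?M
    unfolding pair_sigma_finite_def using sigma_finite_weinstein_measure[OF \<alpha>] by blast
  let ?F = "\<lambda>(x, y). f x * g y * weinstein_kernel \<alpha> x y"
  \<comment> \<open>The factors carry completed sigma-algebras, so joint measurability is obtained
    on the Borel product, where the kernel is continuous, and pulled back along the
    identity.\<close>
  have K: "(\<lambda>p. weinstein_kernel \<alpha> (fst p) (snd p)) \<in> borel_measurable (?M \<Otimes>\<^sub>M ?M)"
  proof -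
    have id: "(\<lambda>x. x) \<in> measurable ?M borel"
      by (rule borel_measurable_weinstein_measure) simp
    have "(\<lambda>p. (fst p, snd p)) \<in> measurable (?M \<Otimes>\<^sub>M ?M) (borel \<Otimes>\<^sub>M borel)"
      by (intro measurable_Pair measurable_compose[OF measurable_fst id] measurable_compose[OF measurable_snd id])
    moreover have "(\<lambda>p :: ((real ^ 'd) \<times> real) \<times> ((real ^ 'd) \<times> real). weinstein_kernel \<alpha> (fst p) (snd p)) \<in> borel_measurable (borel \<Otimes>\<^sub>M borel)"
      unfolding borel_prod by (rule borel_measurable_continuous_onI[OF continuous_weinstein_kernel[OF \<alpha>]])
    ultimately show ?thesis by (auto dest: measurable_compose)
  qed
  have fm: "(\<lambda>p. f (fst p)) \<in> borel_measurable (?M \<Otimes>\<^sub>M ?M)" "(\<lambda>p. g (snd p)) \<in> borel_measurable (?M \<Otimes>\<^sub>M ?M)"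
    using f g by (auto intro!: measurable_compose[OF measurable_fst] measurable_compose[OF measurable_snd])
  have Fm: "?F \<in> borel_measurable (?M \<Otimes>\<^sub>M ?M)"
    unfolding case_prod_beta by (intro borel_measurable_times fm K)
  have Fm0: "(\<lambda>(x, y). f x * g y) \<in> borel_measurable (?M \<Otimes>\<^sub>M ?M)"
    unfolding case_prod_beta by (intro borel_measurable_times fm)
  have "integrable (?M \<Otimes>\<^sub>M ?M) (\<lambda>(x, y). f x * g y)"
  proof (rule Fubini_integrable[OF Fm0])
    show "integrable ?M (\<lambda>x. \<integral>y. norm (case (x, y) of (x, y) \<Rightarrow> f x * g y) \<partial>?M)"
      using f by (simp add: norm_mult)
    show "AE x in ?M. integrable ?M (\<lambda>y. case (x, y) of (x, y) \<Rightarrow> f x * g y)"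
      using g by simp
  qed
  then have int: "integrable (?M \<Otimes>\<^sub>M ?M) ?F"
  proof (rule Bochner_Integration.integrable_bound[OF _ Fm])
    have "cmod (f x * g y) * cmod (weinstein_kernel \<alpha> x y) \<le> cmod (f x * g y) * 1" for x y
      by (intro mult_left_mono norm_weinstein_kernel_le \<alpha>) auto
    then show "AE p in ?M \<Otimes>\<^sub>M ?M. norm (?F p) \<le> norm (case p of (x, y) \<Rightarrow> f x * g y)"
      by (intro AE_I2) (auto simp: norm_mult)
  qed
  have "(\<integral>x. weinstein_integral \<alpha> f x * g x \<partial>?M) = (\<integral>y. \<integral>x. f x * g y * weinstein_kernel \<alpha> x y \<partial>?M \<partial>?M)"
    unfolding weinstein_integral_def integral_mult_left_zero[symmetric]
    by (intro Bochner_Integration.integral_cong refl) (simp add: weinstein_kernel_commute mult_ac)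
  also have "\<dots> = (\<integral>x. \<integral>y. f x * g y * weinstein_kernel \<alpha> x y \<partial>?M \<partial>?M)"
    using Fubini_integral[OF int] by simp
  also have "\<dots> = (\<integral>x. f x * weinstein_integral \<alpha> g x \<partial>?M)"
    by (simp add: weinstein_integral_def mult.assoc)
  finally show ?thesis .
qed

lemma norm2_weinstein_integral_gauss_span:
  assumes \<alpha>: "\<alpha> > -1/2" and f: "f \<in> gauss_span"
  shows "norm2 (weinstein_measure \<alpha>) (weinstein_integral \<alpha> f) = norm2 (weinstein_measure \<alpha>) f"
proof -
  let ?M = "weinstein_measure \<alpha>"
  let ?W = "weinstein_integral \<alpha>"
  have Wf: "?W f \<in> gauss_span" by (rule weinstein_integral_gauss_span[OF \<alpha> f])
  \<comment> \<open>Conjugating a transform reflects its frequency, so inversion shows that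
    \<open>cnj (?W f)\<close> has the transform \<open>cnj f\<close>; the multiplication formula for
    f and \<open>cnj (?W f)\<close> then is the isometry.\<close>
  have Wh: "?W (\<lambda>x. cnj (?W f x)) l = cnj (f l)" for l
  proof -
    have "?W (\<lambda>x. cnj (?W f x)) l = cnj (?W (?W f) (reflect l))"
      unfolding weinstein_integral_def[of \<alpha> "?W f"] weinstein_kernel_reflect
      unfolding weinstein_integral_def[of \<alpha> "\<lambda>x. cnj (?W f x)"]
      by (subst Bochner_Integration.integral_cnj[symmetric]) simp
    then show ?thesis using weinstein_integral_inverse_gauss_span(2)[OF \<alpha> f] by simp
  qed
  have "complex_of_real ((norm2 ?M (?W f))\<^sup>2) = (\<integral>x. ?W f x * cnj (?W f x) \<partial>?M)"
    unfolding norm2_square integral_complex_of_real[symmetric] complex_norm_square ..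
  also have "\<dots> = (\<integral>x. f x * ?W (\<lambda>x. cnj (?W f x)) x \<partial>?M)"
    by (intro weinstein_integral_multiplication_formula gauss_span_integrable gauss_span_cnj \<alpha> f Wf)
  also have "\<dots> = complex_of_real ((norm2 ?M f)\<^sup>2)"
    unfolding norm2_square integral_complex_of_real[symmetric] complex_norm_square Wh ..
  finally have "(norm2 ?M (?W f))\<^sup>2 = (norm2 ?M f)\<^sup>2" by (simp only: of_real_eq_iff)
  then show ?thesis by (simp add: power2_eq_iff_nonneg)
qed

subsection \<open>Density of the Gaussians\<close>

text \<open>The same g must be close in both norms. Membership of f in L1 and L2 belongs to the
  notion, so that each closure lemma carries it along.\<close>

definition approximable :: "'a measure \<Rightarrow> ('a \<Rightarrow> complex) set \<Rightarrow> ('a \<Rightarrow> complex) \<Rightarrow> bool" where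
  "approximable M S f \<longleftrightarrow> integrable M f \<and> square_integrable M f \<and>
     (\<forall>e>0. \<exists>g\<in>S. integrable M g \<and> square_integrable M g \<and>
        (\<integral>x. cmod (f x - g x) \<partial>M) < e \<and> norm2 M (\<lambda>x. f x - g x) < e)"

lemma approximableD:
  assumes "approximable M S f"
  shows "integrable M f" "square_integrable M f"
    "e > 0 \<Longrightarrow> \<exists>g\<in>S. integrable M g \<and> square_integrable M g \<and>
        (\<integral>x. cmod (f x - g x) \<partial>M) < e \<and> norm2 M (\<lambda>x. f x - g x) < e"
  using assms unfolding approximable_def by blast+

lemma approximable_mem:
  assumes "g \<in> S" "integrable M g" "square_integrable M g"
  shows "approximable M S g"
  unfolding approximable_def using assms by (auto simp: norm2_def intro!: bexI[of _ g])

lemma approximable_cong_AE: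
  assumes f: "approximable M S f" and g: "g \<in> borel_measurable M" and eq: "AE x in M. f x = g x"
  shows "approximable M S g"
  unfolding approximable_def
proof (intro conjI allI impI)
  note [measurable] = g borel_measurable_integrable[OF approximableD(1)[OF f]]
  show "integrable M g"
    using approximableD(1)[OF f] eq g by (subst integrable_cong_AE[of _ _ f]) auto
  show "square_integrable M g" by (rule square_integrable_cong_AE[OF approximableD(2)[OF f] g eq])
  fix e :: real assume "e > 0"
  then obtain k where k: "k \<in> S" "integrable M k" "square_integrable M k"
      "(\<integral>x. cmod (f x - k x) \<partial>M) < e" "norm2 M (\<lambda>x. f x - k x) < e"
    using approximableD(3)[OF f] by blast
  note [measurable] = borel_measurable_integrable[OF k(2)]
  have "(\<integral>x. cmod (g x - k x) \<partial>M) = (\<integral>x. cmod (f x - k x) \<partial>M)"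
    using eq by (intro integral_cong_AE) auto
  moreover have "norm2 M (\<lambda>x. g x - k x) = norm2 M (\<lambda>x. f x - k x)"
    using eq by (intro norm2_cong_AE) auto
  ultimately show "\<exists>k\<in>S. integrable M k \<and> square_integrable M k \<and>
        (\<integral>x. cmod (g x - k x) \<partial>M) < e \<and> norm2 M (\<lambda>x. g x - k x) < e"
    using k by auto
qed

lemma approximable_add:
  assumes S: "\<And>f g. f \<in> S \<Longrightarrow> g \<in> S \<Longrightarrow> (\<lambda>x. f x + g x) \<in> S"
    and f: "approximable M S f" and g: "approximable M S g"
  shows "approximable M S (\<lambda>x. f x + g x)"
  unfolding approximable_def
proof (intro conjI allI impI)
  note fi = approximableD[OF f] and gi = approximableD[OF g]
  show "integrable M (\<lambda>x. f x + g x)" using fi gi by simp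
  show "square_integrable M (\<lambda>x. f x + g x)" by (intro square_integrable_add fi gi)
  fix e :: real assume e: "e > 0"
  obtain f' where f': "f' \<in> S" "integrable M f'" "square_integrable M f'"
      "(\<integral>x. cmod (f x - f' x) \<partial>M) < e / 2" "norm2 M (\<lambda>x. f x - f' x) < e / 2"
    using fi(3)[of "e / 2"] e by auto
  obtain g' where g': "g' \<in> S" "integrable M g'" "square_integrable M g'"
      "(\<integral>x. cmod (g x - g' x) \<partial>M) < e / 2" "norm2 M (\<lambda>x. g x - g' x) < e / 2"
    using gi(3)[of "e / 2"] e by auto
  have d: "f x + g x - (f' x + g' x) = (f x - f' x) + (g x - g' x)" for x by simp
  have i: "integrable M (\<lambda>x. f x - f' x)" "integrable M (\<lambda>x. g x - g' x)"
    using fi gi f' g' by auto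
  have "(\<integral>x. cmod ((f x - f' x) + (g x - g' x)) \<partial>M) \<le> (\<integral>x. cmod (f x - f' x) + cmod (g x - g' x) \<partial>M)"
    using i by (intro integral_mono norm_triangle_ineq integrable_norm Bochner_Integration.integrable_add) auto
  also have "\<dots> = (\<integral>x. cmod (f x - f' x) \<partial>M) + (\<integral>x. cmod (g x - g' x) \<partial>M)"
    using i by simp
  finally have 1: "(\<integral>x. cmod (f x + g x - (f' x + g' x)) \<partial>M) < e"
    using f'(4) g'(4) unfolding d by linarith
  have 2: "norm2 M (\<lambda>x. f x + g x - (f' x + g' x)) < e"
    using norm2_triangle[OF square_integrable_diff[OF fi(2) f'(3)] square_integrable_diff[OF gi(2) g'(3)]]
      f'(5) g'(5) unfolding d by linarith
  show "\<exists>k\<in>S. integrable M k \<and> square_integrable M k \<and>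
        (\<integral>x. cmod (f x + g x - k x) \<partial>M) < e \<and> norm2 M (\<lambda>x. f x + g x - k x) < e"
    by (rule bexI[of _ "\<lambda>x. f' x + g' x"])
      (use 1 2 S[OF f'(1) g'(1)] f' g' square_integrable_add[OF f'(3) g'(3)] in auto)
qed

lemma approximable_cmult:
  assumes S: "\<And>f c. f \<in> S \<Longrightarrow> (\<lambda>x. c * f x) \<in> S" and f: "approximable M S f"
  shows "approximable M S (\<lambda>x. c * f x)"
  unfolding approximable_def
proof (intro conjI allI impI)
  note fi = approximableD[OF f]
  show "integrable M (\<lambda>x. c * f x)" using fi by simp
  show "square_integrable M (\<lambda>x. c * f x)" by (intro square_integrable_cmult fi)
  fix e :: real assume e: "e > 0"
  \<comment> \<open>The summand 1 covers the case c = 0.\<close>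
  then have "e / (cmod c + 1) > 0" by (simp add: add_nonneg_pos)
  from fi(3)[OF this] obtain k where k: "k \<in> S" "integrable M k" "square_integrable M k"
      "(\<integral>x. cmod (f x - k x) \<partial>M) < e / (cmod c + 1)" "norm2 M (\<lambda>x. f x - k x) < e / (cmod c + 1)"
    by blast
  have lt: "cmod c * t < e" if t: "0 \<le> t" "t < e / (cmod c + 1)" for t
  proof -
    have "cmod c * t \<le> (cmod c + 1) * t" using t by (intro mult_right_mono) auto
    also have "\<dots> < (cmod c + 1) * (e / (cmod c + 1))" using t by (intro mult_strict_left_mono) (auto simp: add_nonneg_pos)
    also have "\<dots> = e" using norm_ge_zero[of c] by (simp add: add_nonneg_eq_0_iff)
    finally show ?thesis .
  qed
  have d: "c * f x - c * k x = c * (f x - k x)" for x by (simp add: right_diff_distrib)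
  have "(\<integral>x. cmod (c * f x - c * k x) \<partial>M) < e"
    unfolding d norm_mult integral_mult_right_zero using k(4) by (intro lt) auto
  moreover have "norm2 M (\<lambda>x. c * f x - c * k x) < e"
    unfolding d norm2_cmult using k(5) by (intro lt) auto
  ultimately show "\<exists>k\<in>S. integrable M k \<and> square_integrable M k \<and>
        (\<integral>x. cmod (c * f x - k x) \<partial>M) < e \<and> norm2 M (\<lambda>x. c * f x - k x) < e"
    by (intro bexI[of _ "\<lambda>x. c * k x"]) (use S[OF k(1)] k square_integrable_cmult[OF k(3)] in auto)
qed

text \<open>Dominated convergence in both norms: \<open>2 * w x\<close> dominates the differences
  and \<open>4 * (w x)\<^sup>2\<close> their squares, hence the two integrability conditions on w.
  One late \<open>f n\<close> is then approximated within S.\<close>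

lemma approximable_limit:
  fixes w :: "'a \<Rightarrow> real"
  assumes f: "\<And>n. approximable M S (f n)" and g: "g \<in> borel_measurable M"
    and lim: "AE x in M. (\<lambda>n. f n x) \<longlonglongrightarrow> g x"
    and bound: "\<And>n. AE x in M. cmod (f n x) \<le> w x"
    and w: "integrable M w" "integrable M (\<lambda>x. (w x)\<^sup>2)"
  shows "approximable M S g"
  unfolding approximable_def
proof (intro conjI allI impI)
  note fi = approximableD[OF f]
  have fm [measurable]: "f n \<in> borel_measurable M" for n using fi(1) by auto
  note [measurable] = g borel_measurable_integrable[OF w(1)]
  have "AE x in M. \<forall>n. cmod (f n x) \<le> w x" using bound by (simp add: AE_all_countable)
  with lim have gw: "AE x in M. cmod (g x) \<le> w x"
  proof eventually_elim
    case (elim x)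
    have "(\<lambda>n. cmod (f n x)) \<longlonglongrightarrow> cmod (g x)" by (intro tendsto_norm elim)
    then show ?case by (rule LIMSEQ_le_const2) (use elim in auto)
  qed
  show ig: "integrable M g"
    by (rule Bochner_Integration.integrable_bound[OF w(1) g]) (use gw in \<open>auto elim: eventually_mono\<close>)
  have "integrable M (\<lambda>x. (cmod (g x))\<^sup>2)"
  proof (rule Bochner_Integration.integrable_bound[OF w(2)])
    show "AE x in M. norm ((cmod (g x))\<^sup>2) \<le> norm ((w x)\<^sup>2)"
      using gw by eventually_elim (simp add: power_mono)
  qed simp
  then show sg: "square_integrable M g" using g by (simp add: square_integrable_def)
  have b2: "AE x in M. cmod (f n x - g x) \<le> 2 * w x" for n
    using bound[of n] gw
  proof eventually_elim
    case (elim x)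
    then show ?case using norm_triangle_ineq4[of "f n x" "g x"] by linarith
  qed
  have z: "AE x in M. (\<lambda>n. cmod (f n x - g x)) \<longlonglongrightarrow> 0"
    using lim
  proof eventually_elim
    case (elim x)
    then show ?case by (intro tendsto_norm_zero) (simp add: LIM_zero)
  qed
  have 1: "(\<lambda>n. \<integral>x. cmod (f n x - g x) \<partial>M) \<longlonglongrightarrow> (\<integral>x. 0 \<partial>M)"
    by (rule integral_dominated_convergence[where w = "\<lambda>x. 2 * w x"]) (use w z b2 in auto)
  have "(\<lambda>n. \<integral>x. (cmod (f n x - g x))\<^sup>2 \<partial>M) \<longlonglongrightarrow> (\<integral>x. 0 \<partial>M)"
  proof (rule integral_dominated_convergence[where w = "\<lambda>x. 4 * (w x)\<^sup>2"])
    show "AE x in M. (\<lambda>n. (cmod (f n x - g x))\<^sup>2) \<longlonglongrightarrow> 0"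
      using z
    proof eventually_elim
      case (elim x)
      from tendsto_power[OF this, of 2] show ?case by simp
    qed
    show "AE x in M. norm ((cmod (f n x - g x))\<^sup>2) \<le> 4 * (w x)\<^sup>2" for n
      using b2[of n]
    proof eventually_elim
      case (elim x)
      from power_mono[OF this, of 2] show ?case by (simp add: power_mult_distrib)
    qed
  qed (use w in auto)
  then have 2: "(\<lambda>n. norm2 M (\<lambda>x. f n x - g x)) \<longlonglongrightarrow> 0"
    unfolding norm2_def using tendsto_real_sqrt by fastforce
  fix e :: real assume e: "e > 0"
  have "\<forall>\<^sub>F n in sequentially. (\<integral>x. cmod (f n x - g x) \<partial>M) < e / 2"
    by (rule order_tendstoD(2)[OF 1]) (use e in simp)
  moreover have "\<forall>\<^sub>F n in sequentially. norm2 M (\<lambda>x. f n x - g x) < e / 2"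
    by (rule order_tendstoD(2)[OF 2]) (use e in simp)
  ultimately have "\<forall>\<^sub>F n in sequentially. (\<integral>x. cmod (f n x - g x) \<partial>M) < e / 2 \<and> norm2 M (\<lambda>x. f n x - g x) < e / 2"
    by (rule eventually_conj)
  then obtain n where n: "(\<integral>x. cmod (f n x - g x) \<partial>M) < e / 2" "norm2 M (\<lambda>x. f n x - g x) < e / 2"
    by (auto simp: eventually_sequentially)
  obtain k where k: "k \<in> S" "integrable M k" "square_integrable M k"
      "(\<integral>x. cmod (f n x - k x) \<partial>M) < e / 2" "norm2 M (\<lambda>x. f n x - k x) < e / 2"
    using fi(3)[of "e / 2" n] e by auto
  have i: "integrable M (\<lambda>x. f n x - g x)" "integrable M (\<lambda>x. f n x - k x)"
    using fi(1)[of n] ig k(2) by auto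
  have "(\<integral>x. cmod (g x - k x) \<partial>M) \<le> (\<integral>x. cmod (f n x - g x) + cmod (f n x - k x) \<partial>M)"
  proof (rule integral_mono)
    show "cmod (g x - k x) \<le> cmod (f n x - g x) + cmod (f n x - k x)" for x
      using norm_triangle_ineq4[of "f n x - k x" "f n x - g x"] by simp
  qed (use i ig k(2) in auto)
  also have "\<dots> = (\<integral>x. cmod (f n x - g x) \<partial>M) + (\<integral>x. cmod (f n x - k x) \<partial>M)"
    using i by simp
  finally have 3: "(\<integral>x. cmod (g x - k x) \<partial>M) < e" using n k by linarith
  have 4: "norm2 M (\<lambda>x. g x - k x) < e"
    using norm2_triangle_diff[OF sg fi(2) k(3), of n] n(2) k(5)
    unfolding norm2_minus_commute[of M g "f n"] by linarith
  show "\<exists>k\<in>S. integrable M k \<and> square_integrable M k \<and>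
        (\<integral>x. cmod (g x - k x) \<partial>M) < e \<and> norm2 M (\<lambda>x. g x - k x) < e"
    using k 3 4 by blast
qed

text \<open>These are the multipliers of the Gaussian weight: \<open>gauss 0 0 1\<close> times
  \<open>trig b k\<close> is again a Gaussian, with parameter \<open>1 + k\<close>, and unlike the
  Gaussians the functions \<open>trig\<close> are closed under products.\<close>

definition trig :: "real ^ 'd \<Rightarrow> real \<Rightarrow> (real ^ 'd) \<times> real \<Rightarrow> complex" where
  "trig b k x = exp (\<i> * complex_of_real (b \<bullet> fst x)) * complex_of_real (exp (- k * (snd x)\<^sup>2 / 2))"

text \<open>Admitting \<open>k = 0\<close> puts the constants in. Together with products this makes
  a unital algebra, as substitution into polynomials requires.\<close>

inductive_set trig_span :: "((real ^ 'd) \<times> real \<Rightarrow> complex) set" where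
  trig: "0 \<le> k \<Longrightarrow> (\<lambda>x. c * trig b k x) \<in> trig_span"
| add: "f \<in> trig_span \<Longrightarrow> g \<in> trig_span \<Longrightarrow> (\<lambda>x. f x + g x) \<in> trig_span"

lemma trig_mult: "trig b k x * trig b' k' x = trig (b + b') (k + k') x"
proof -
  have e: "- (k + k') * (snd x)\<^sup>2 / 2 = - k * (snd x)\<^sup>2 / 2 + - k' * (snd x)\<^sup>2 / 2"
    by (simp add: field_simps)
  show ?thesis
    unfolding trig_def e inner_add_left of_real_add distrib_left exp_add of_real_mult
    by (simp only: mult_ac)
qed

lemma gauss_mult_trig: "gauss 0 0 1 x * trig b k x = gauss 0 b (1 + k) x"
proof -
  have e: "- (1 + k) * (snd x)\<^sup>2 / 2 = - 1 * (snd x)\<^sup>2 / 2 + - k * (snd x)\<^sup>2 / 2"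
    by (simp add: field_simps)
  show ?thesis
    unfolding trig_def gauss_def e exp_add of_real_mult
    by (simp only: inner_zero_left of_real_0 mult_zero_right exp_zero mult_1_right mult_1_left mult_ac)
qed

lemma gauss_mult_trig_span: "f \<in> trig_span \<Longrightarrow> (\<lambda>x. gauss 0 0 1 x * f x) \<in> gauss_span"
proof (induction rule: trig_span.induct)
  case (trig k c b)
  have "gauss 0 0 1 x * (c * trig b k x) = c * gauss 0 b (1 + k) x" for x
    unfolding gauss_mult_trig[symmetric] by simp
  then show ?case
    using gauss_span.gauss[of "1 + k" c 0 b] trig by (simp only:)
next
  case (add f g)
  then show ?case using gauss_span.add[OF add.IH] by (simp add: distrib_left)
qed

lemma trig_span_mult:
  assumes "f \<in> trig_span" "g \<in> trig_span"
  shows "(\<lambda>x. f x * g x) \<in> trig_span"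
  using assms
proof (induction f rule: trig_span.induct)
  case (trig k c b)
  note k = \<open>0 \<le> k\<close>
  from \<open>g \<in> trig_span\<close> show ?case
  proof (induction g rule: trig_span.induct)
    case (trig k' c' b')
    have "c * trig b k x * (c' * trig b' k' x) = (c * c') * trig (b + b') (k + k') x" for x
      by (simp add: trig_mult[symmetric])
    moreover have "0 \<le> k + k'" using k trig by simp
    ultimately show ?case using trig_span.trig[of "k + k'" "c * c'" "b + b'"] by (simp only:)
  next
    case (add f g)
    then show ?case using trig_span.add[OF add.IH] by (simp add: distrib_left)
  qed
next
  case (add f f')
  then show ?case using trig_span.add[of "\<lambda>x. f x * g x" "\<lambda>x. f' x * g x"] by (simp add: distrib_right)
qed

lemma trig_span_const: "(\<lambda>x. c) \<in> trig_span"
  using trig_span.trig[of 0 c 0] by (simp add: trig_def)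

lemma trig_span_cmult: "f \<in> trig_span \<Longrightarrow> (\<lambda>x. c * f x) \<in> trig_span"
  by (intro trig_span_mult trig_span_const)

lemma trig_span_sum: "(\<And>i. i \<in> I \<Longrightarrow> f i \<in> trig_span) \<Longrightarrow> (\<lambda>x. \<Sum>i\<in>I. f i x) \<in> trig_span"
  by (induction I rule: infinite_finite_induct) (simp_all add: trig_span_const trig_span.add)

text \<open>Bounded coordinates: the components of this map are trigonometric in \<open>x'\<close>
  and exponential in the last coordinate, and it tends to \<open>(x', exp (- x\<^sub>d\<^sub>+\<^sub>1\<^sup>2 / 2))\<close>.\<close>

definition trig_coords :: "nat \<Rightarrow> (real ^ 'd) \<times> real \<Rightarrow> (real ^ 'd) \<times> real" where
  "trig_coords n x = (\<Sum>j\<in>Basis. (real (Suc n) * sin ((j \<bullet> fst x) / real (Suc n))) *\<^sub>R j, exp (- (snd x)\<^sup>2 / 2))"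

lemma trig_span_sin: "(\<lambda>x. complex_of_real (sin (b \<bullet> fst x))) \<in> trig_span"
proof -
  have "complex_of_real (sin (b \<bullet> fst x)) = (1 / (2 * \<i>)) * trig b 0 x + (- 1 / (2 * \<i>)) * trig (- b) 0 x" for x
    unfolding sin_of_real[symmetric] sin_exp_eq trig_def by (simp add: field_simps)
  then show ?thesis
    using trig_span.add[OF trig_span.trig[of 0 "1 / (2 * \<i>)" b] trig_span.trig[of 0 "- 1 / (2 * \<i>)" "- b"]] by simp
qed

text \<open>A linear form is determined on the basis, so only the sine coordinates and the
  exponential coordinate matter; the latter is \<open>trig 0 1\<close>.\<close>

lemma trig_span_linear:
  fixes f :: "(real ^ 'd) \<times> real \<Rightarrow> real"
  assumes "bounded_linear f"
  shows "(\<lambda>x. complex_of_real (f (trig_coords n x))) \<in> trig_span"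
proof -
  interpret bounded_linear f by fact
  let ?s = "\<lambda>j x. real (Suc n) * sin ((j \<bullet> fst x) / real (Suc n))"
  have eq: "f (trig_coords n x) = (\<Sum>j\<in>Basis. ?s j x * f (j, 0)) + exp (- (snd x)\<^sup>2 / 2) * f (0, 1)" for x
  proof -
    have "trig_coords n x = (\<Sum>j\<in>Basis. ?s j x *\<^sub>R (j, 0)) + exp (- (snd x)\<^sup>2 / 2) *\<^sub>R (0, 1)"
      unfolding trig_coords_def by (simp add: prod_eq_iff fst_sum snd_sum)
    then show ?thesis unfolding add sum scaleR by (simp only: add sum scaleR real_scaleR_def)
  qed
  have "(\<lambda>x. complex_of_real (?s j x * f (j, 0))) \<in> trig_span" for j :: "real ^ 'd"
  proof -
    have "complex_of_real (?s j x * f (j, 0)) =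
       complex_of_real (real (Suc n) * f (j, 0)) * complex_of_real (sin (((1 / real (Suc n)) *\<^sub>R j) \<bullet> fst x))" for x :: "(real ^ 'd) \<times> real"
      by (simp del: of_nat_Suc)
    then show ?thesis by (simp only:) (intro trig_span_cmult trig_span_sin)
  qed
  then have 1: "(\<lambda>x. \<Sum>j\<in>Basis. complex_of_real (?s j x * f (j, 0))) \<in> trig_span"
    by (intro trig_span_sum)
  have "complex_of_real (exp (- (snd x)\<^sup>2 / 2) * f (0, 1)) = complex_of_real (f (0, 1)) * trig 0 1 x" for x :: "(real ^ 'd) \<times> real"
    by (simp add: trig_def)
  then have 2: "(\<lambda>x :: (real ^ 'd) \<times> real. complex_of_real (exp (- (snd x)\<^sup>2 / 2) * f (0, 1))) \<in> trig_span"
    by (simp only:) (rule trig_span.trig, simp)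
  show ?thesis
    using trig_span.add[OF 1 2] unfolding eq of_real_add of_real_sum .
qed

lemma trig_span_polynomial:
  "real_polynomial_function p \<Longrightarrow> (\<lambda>x. complex_of_real (p (trig_coords n x))) \<in> trig_span"
proof (induction p rule: real_polynomial_function.induct)
  case (linear f)
  then show ?case by (rule trig_span_linear)
next
  case (const c)
  show ?case by (rule trig_span_const)
next
  case (add f g)
  then show ?case using trig_span.add by (simp only: of_real_add)
next
  case (mult f g)
  then show ?case using trig_span_mult by (simp only: of_real_mult)
qed

text \<open>For fixed n the range lies in one compact ball, the set on which Stone-Weierstrass is
  applied.\<close>

lemma norm_trig_coords_le: "norm (trig_coords n (x :: (real ^ 'd) \<times> real)) \<le> real (Suc n) * CARD('d) + 1"
proof -
  have "norm (\<Sum>j\<in>(Basis :: (real ^ 'd) set). (real (Suc n) * sin ((j \<bullet> fst x) / real (Suc n))) *\<^sub>R j)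
      \<le> (\<Sum>j\<in>(Basis :: (real ^ 'd) set). real (Suc n))"
  proof (intro order_trans[OF norm_sum] sum_mono)
    fix j :: "real ^ 'd" assume "j \<in> Basis"
    then have "norm ((real (Suc n) * sin ((j \<bullet> fst x) / real (Suc n))) *\<^sub>R j) = real (Suc n) * \<bar>sin ((j \<bullet> fst x) / real (Suc n))\<bar>"
      by (simp add: abs_mult del: of_nat_Suc)
    also have "\<dots> \<le> real (Suc n) * 1" by (intro mult_left_mono abs_sin_le_one) simp
    finally show "norm ((real (Suc n) * sin ((j \<bullet> fst x) / real (Suc n))) *\<^sub>R j) \<le> real (Suc n)" by simp
  qed
  also have "\<dots> = real (Suc n) * CARD('d)" by simp
  finally have 1: "norm (fst (trig_coords n x)) \<le> real (Suc n) * CARD('d)" by (simp add: trig_coords_def)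
  have 2: "norm (snd (trig_coords n x)) \<le> 1" by (simp add: trig_coords_def)
  show ?thesis
    using norm_Pair_le[of "fst (trig_coords n x)" "snd (trig_coords n x)"] 1 2 by simp
qed

lemma trig_coords_tendsto: "(\<lambda>n. trig_coords n x) \<longlonglongrightarrow> (fst x, exp (- (snd x)\<^sup>2 / 2))"
proof -
  have s: "(\<lambda>n. real (Suc n) * sin (t / real (Suc n))) \<longlonglongrightarrow> t" for t :: real
    by real_asymp
  have "(\<lambda>n. \<Sum>j\<in>Basis. (real (Suc n) * sin ((j \<bullet> fst x) / real (Suc n))) *\<^sub>R j) \<longlonglongrightarrow> (\<Sum>j\<in>Basis. (j \<bullet> fst x) *\<^sub>R j)"
    by (intro tendsto_sum tendsto_scaleR s tendsto_const)
  also have "(\<Sum>j\<in>Basis. (j \<bullet> fst x) *\<^sub>R j) = fst x"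
    using euclidean_representation[of "fst x"] by (simp add: inner_commute)
  finally show ?thesis unfolding trig_coords_def by (intro tendsto_Pair tendsto_const)
qed


lemma approximable_gauss_span_add:
  "approximable M gauss_span f \<Longrightarrow> approximable M gauss_span g \<Longrightarrow> approximable M gauss_span (\<lambda>x. f x + g x)"
  by (rule approximable_add) (rule gauss_span.add)

lemma approximable_gauss_span_cmult:
  "approximable M gauss_span f \<Longrightarrow> approximable M gauss_span (\<lambda>x. c * f x)"
  by (rule approximable_cmult) (rule gauss_span_cmult)

text \<open>Under a uniform bound B the weighted functions are dominated by
  \<open>B * cmod (gauss 0 0 1 x)\<close>, which is in L1 and in L2; limits of multipliers may
  therefore be taken pointwise on the half-space.\<close>

lemma approximable_gauss_mult_limit:
  fixes g :: "(real ^ 'd) \<times> real \<Rightarrow> complex"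
  assumes \<alpha>: "\<alpha> > -1/2"
    and f: "\<And>n. approximable (weinstein_measure \<alpha>) gauss_span (\<lambda>x. gauss 0 0 1 x * f n x)"
    and g: "g \<in> borel_measurable (weinstein_measure \<alpha>)"
    and lim: "\<And>x. x \<in> half_space \<Longrightarrow> (\<lambda>n. f n x) \<longlonglongrightarrow> g x"
    and bound: "\<And>n x. x \<in> half_space \<Longrightarrow> cmod (f n x) \<le> B"
  shows "approximable (weinstein_measure \<alpha>) gauss_span (\<lambda>x. gauss 0 0 1 x * g x)"
proof (rule approximable_limit[OF f])
  let ?M = "weinstein_measure \<alpha> :: ((real ^ 'd) \<times> real) measure" and ?\<gamma> = "gauss 0 0 1 :: (real ^ 'd) \<times> real \<Rightarrow> complex"
  have \<gamma>: "?\<gamma> \<in> gauss_span" using gauss_span.gauss[of 1 1 0 0] by simp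
  show "(\<lambda>x. ?\<gamma> x * g x) \<in> borel_measurable ?M"
    by (intro borel_measurable_times g borel_measurable_weinstein_measure borel_measurable_gauss)
  show "AE x in ?M. (\<lambda>n. ?\<gamma> x * f n x) \<longlonglongrightarrow> ?\<gamma> x * g x"
    by (intro AE_I2 tendsto_mult_left lim) simp
  show "AE x in ?M. cmod (?\<gamma> x * f n x) \<le> B * cmod (?\<gamma> x)" for n
    by (intro AE_I2) (simp add: norm_mult bound mult_right_mono mult.commute[of B] mult_left_mono)
  show "integrable ?M (\<lambda>x. B * cmod (?\<gamma> x))"
    using gauss_span_integrable[OF \<alpha> \<gamma>] by simp
  show "integrable ?M (\<lambda>x. (B * cmod (?\<gamma> x))\<^sup>2)"
    using square_integrableD(2)[OF gauss_span_square_integrable[OF \<alpha> \<gamma>]] by (simp add: power_mult_distrib)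
qed

lemma continuous_trig_coords: "continuous_on UNIV (trig_coords n)"
  unfolding trig_coords_def[abs_def] by (intro continuous_intros) auto

text \<open>On the ball containing the range of \<open>trig_coords n\<close>, \<phi> is a uniform
  limit of polynomials, and a polynomial in these coordinates times the weight is a combination of
  Gaussians.\<close>

lemma approximable_continuous_trig_coords:
  fixes \<phi> :: "(real ^ 'd) \<times> real \<Rightarrow> real"
  assumes \<alpha>: "\<alpha> > -1/2" and \<phi>: "continuous_on UNIV \<phi>" "\<And>x. \<bar>\<phi> x\<bar> \<le> B"
  shows "approximable (weinstein_measure \<alpha>) gauss_span (\<lambda>x. gauss 0 0 1 x * complex_of_real (\<phi> (trig_coords n x)))"
proof -
  let ?K = "cball (0 :: (real ^ 'd) \<times> real) (real (Suc n) * CARD('d) + 1)"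
  have K: "trig_coords n x \<in> ?K" for x :: "(real ^ 'd) \<times> real"
    using norm_trig_coords_le[of n x] by (simp add: dist_norm norm_minus_commute)
  have "\<exists>p. real_polynomial_function p \<and> (\<forall>x\<in>?K. \<bar>\<phi> x - p x\<bar> < 1 / real (Suc k))" for k
  proof -
    have "continuous_on ?K \<phi>" using \<phi>(1) continuous_on_subset by blast
    from Stone_Weierstrass_real_polynomial_function[OF compact_cball this, of "1 / real (Suc k)"]
    show ?thesis by (metis of_nat_0_less_iff zero_less_Suc zero_less_divide_1_iff)
  qed
  then obtain p where p: "\<And>k. real_polynomial_function (p k)"
      "\<And>k x. x \<in> ?K \<Longrightarrow> \<bar>\<phi> x - p k x\<bar> < 1 / real (Suc k)" by metis
  show ?thesis
  \<comment> \<open>The k-th polynomial is off by less than 1/(k + 1), so by at most 1, which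
    accounts for \<open>B + 1\<close>.\<close>
  proof (rule approximable_gauss_mult_limit[OF \<alpha>, where f = "\<lambda>k x. complex_of_real (p k (trig_coords n x))" and B = "B + 1"])
    show "approximable (weinstein_measure \<alpha>) gauss_span (\<lambda>x. gauss 0 0 1 x * complex_of_real (p k (trig_coords n x)))" for k
    proof -
      have "(\<lambda>x. gauss 0 0 1 x * complex_of_real (p k (trig_coords n x))) \<in> gauss_span"
        by (rule gauss_mult_trig_span[OF trig_span_polynomial[OF p(1)]])
      then show ?thesis
        using gauss_span_integrable[OF \<alpha>] gauss_span_square_integrable[OF \<alpha>] by (intro approximable_mem) auto
    qed
    have "continuous_on UNIV (\<lambda>x. complex_of_real (\<phi> (trig_coords n x)))"
      by (intro continuous_on_of_real continuous_on_compose2[OF \<phi>(1) continuous_trig_coords]) simp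
    then show "(\<lambda>x. complex_of_real (\<phi> (trig_coords n x))) \<in> borel_measurable (weinstein_measure \<alpha>)"
      by (intro borel_measurable_weinstein_measure borel_measurable_continuous_onI)
    fix x :: "(real ^ 'd) \<times> real"
    have "(\<lambda>k. p k (trig_coords n x)) \<longlonglongrightarrow> \<phi> (trig_coords n x)"
    proof (rule Lim_transform_bound[THEN LIM_zero_cancel])
      show "(\<lambda>k. 1 / real (Suc k)) \<longlonglongrightarrow> 0"
        by (rule LIMSEQ_Suc[OF lim_1_over_n])
      show "\<forall>\<^sub>F k in sequentially. norm (p k (trig_coords n x) - \<phi> (trig_coords n x)) \<le> norm (1 / real (Suc k))"
        using p(2)[OF K[of x]] by (intro always_eventually allI) (simp add: abs_minus_commute less_imp_le)
    qed
    then show "(\<lambda>k. complex_of_real (p k (trig_coords n x))) \<longlonglongrightarrow> complex_of_real (\<phi> (trig_coords n x))"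
      by (rule tendsto_of_real)
    fix k
    have "\<bar>\<phi> (trig_coords n x) - p k (trig_coords n x)\<bar> < 1 / real (Suc k)" by (rule p(2)[OF K])
    moreover have "1 / real (Suc k) \<le> 1" by simp
    ultimately show "cmod (complex_of_real (p k (trig_coords n x))) \<le> B + 1"
      using \<phi>(2)[of "trig_coords n x"] by (simp only: norm_of_real)
  qed
qed

text \<open>As n grows the sine coordinates straighten out; continuity of \<phi> and its bound make
  this a uniformly bounded pointwise limit.\<close>

lemma approximable_continuous:
  fixes \<phi> :: "(real ^ 'd) \<times> real \<Rightarrow> real"
  assumes \<alpha>: "\<alpha> > -1/2" and \<phi>: "continuous_on UNIV \<phi>" "\<And>x. \<bar>\<phi> x\<bar> \<le> B"
  shows "approximable (weinstein_measure \<alpha>) gauss_span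
    (\<lambda>x. gauss 0 0 1 x * complex_of_real (\<phi> (fst x, exp (- (snd x)\<^sup>2 / 2))))"
proof (rule approximable_gauss_mult_limit[OF \<alpha> approximable_continuous_trig_coords[OF assms]])
  have "continuous_on UNIV (\<lambda>x. complex_of_real (\<phi> (fst x, exp (- (snd x)\<^sup>2 / 2))))"
    by (intro continuous_on_of_real continuous_on_compose2[OF \<phi>(1)] continuous_intros) auto
  then show "(\<lambda>x. complex_of_real (\<phi> (fst x, exp (- (snd x)\<^sup>2 / 2)))) \<in> borel_measurable (weinstein_measure \<alpha>)"
    by (intro borel_measurable_weinstein_measure borel_measurable_continuous_onI)
  fix x :: "(real ^ 'd) \<times> real"
  have "isCont \<phi> (fst x, exp (- (snd x)\<^sup>2 / 2))" using \<phi>(1) by (simp add: continuous_on_eq_continuous_at)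
  from isCont_tendsto_compose[OF this trig_coords_tendsto]
  show "(\<lambda>n. complex_of_real (\<phi> (trig_coords n x))) \<longlonglongrightarrow> complex_of_real (\<phi> (fst x, exp (- (snd x)\<^sup>2 / 2)))"
    by (rule tendsto_of_real)
  show "cmod (complex_of_real (\<phi> (trig_coords n x))) \<le> B" for n
    using \<phi>(2) by simp
qed

lemma approximable_closed:
  fixes C :: "((real ^ 'd) \<times> real) set"
  assumes \<alpha>: "\<alpha> > -1/2" and C: "closed C" "C \<noteq> {}"
  shows "approximable (weinstein_measure \<alpha>) gauss_span
    (\<lambda>x. gauss 0 0 1 x * complex_of_real (indicator C (fst x, exp (- (snd x)\<^sup>2 / 2))))"
proof (rule approximable_gauss_mult_limit[OF \<alpha>, where B = 1])
  \<comment> \<open>Continuous functions decreasing to the indicator of C. Nonemptiness matters: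
    \<open>infdist\<close> to the empty set is 0 by convention, which would make every \<phi>
    constantly 1.\<close>
  define \<phi> where "\<phi> n z = max 0 (1 - real n * infdist z C)" for n z
  have \<phi>1: "\<bar>\<phi> n z\<bar> \<le> 1" for n z using infdist_nonneg[of z C] by (simp add: \<phi>_def)
  have \<phi>c: "continuous_on UNIV (\<phi> n)" for n
    unfolding \<phi>_def[abs_def] by (intro continuous_intros)
  show "approximable (weinstein_measure \<alpha>) gauss_span
    (\<lambda>x. gauss 0 0 1 x * complex_of_real (\<phi> n (fst x, exp (- (snd x)\<^sup>2 / 2))))" for n
    by (rule approximable_continuous[OF \<alpha> \<phi>c \<phi>1])
  have cont: "continuous_on UNIV (\<lambda>x :: (real ^ 'd) \<times> real. (fst x, exp (- (snd x)\<^sup>2 / 2)))"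
    by (intro continuous_intros) auto
  have "(\<lambda>x :: (real ^ 'd) \<times> real. (fst x, exp (- (snd x)\<^sup>2 / 2))) \<in> borel_measurable borel"
    by (rule borel_measurable_continuous_onI[OF cont])
  moreover have "(\<lambda>z. complex_of_real (indicator C z)) \<in> borel_measurable borel"
    using borel_closed[OF C(1)] by measurable
  ultimately have "(\<lambda>x. complex_of_real (indicator C (fst x, exp (- (snd x)\<^sup>2 / 2)))) \<in> borel_measurable borel"
    by (rule measurable_compose)
  then show "(\<lambda>x. complex_of_real (indicator C (fst x, exp (- (snd x)\<^sup>2 / 2)))) \<in> borel_measurable (weinstein_measure \<alpha>)"
    by (rule borel_measurable_weinstein_measure)
  fix x :: "(real ^ 'd) \<times> real"
  show "cmod (complex_of_real (\<phi> n (fst x, exp (- (snd x)\<^sup>2 / 2)))) \<le> 1" for n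
    using \<phi>1 by simp
  have "(\<lambda>n. \<phi> n z) \<longlonglongrightarrow> indicator C z" for z
  proof (cases "z \<in> C")
    case True
    then show ?thesis by (simp add: \<phi>_def)
  next
    case False
    then have pos: "infdist z C > 0"
      using C in_closed_iff_infdist_zero[of C z] infdist_nonneg[of z C] by linarith
    then obtain N where N: "1 < real N * infdist z C" using reals_Archimedean3 by blast
    have "\<phi> n z = 0" if "n \<ge> N" for n
    proof -
      have "real N * infdist z C \<le> real n * infdist z C" using that pos by (intro mult_right_mono) auto
      with N show ?thesis by (simp add: \<phi>_def)
    qed
    then have "\<forall>\<^sub>F n in sequentially. \<phi> n z = 0" by (auto simp: eventually_sequentially)
    then show ?thesis using False by (simp add: tendsto_eventually)
  qed
  then show "(\<lambda>n. complex_of_real (\<phi> n (fst x, exp (- (snd x)\<^sup>2 / 2)))) \<longlonglongrightarrow> complex_of_real (indicator C (fst x, exp (- (snd x)\<^sup>2 / 2)))"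
    by (intro tendsto_of_real)
qed

text \<open>Dynkin's argument: closed sets are an intersection-stable generator, complements and
  finite disjoint unions come from linearity, countable unions from the bounded limit. The empty
  set, excluded from the closed case, is obtained as the zero multiple of the whole space.\<close>

lemma approximable_borel_exp:
  fixes A :: "((real ^ 'd) \<times> real) set"
  assumes \<alpha>: "\<alpha> > -1/2" and A: "A \<in> sets borel"
  shows "approximable (weinstein_measure \<alpha>) gauss_span
    (\<lambda>x. gauss 0 0 1 x * complex_of_real (indicator A (fst x, exp (- (snd x)\<^sup>2 / 2))))"
proof -
  define \<iota> :: "(real ^ 'd) \<times> real \<Rightarrow> (real ^ 'd) \<times> real" where "\<iota> x = (fst x, exp (- (snd x)\<^sup>2 / 2))" for x
  let ?P = "\<lambda>A. approximable (weinstein_measure \<alpha>) gauss_span (\<lambda>x. gauss 0 0 1 x * complex_of_real (indicator A (\<iota> x)))"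
  have cont: "continuous_on UNIV \<iota>"
    unfolding \<iota>_def[abs_def] by (intro continuous_intros) auto
  have \<iota>: "\<iota> \<in> borel_measurable borel"
    by (rule borel_measurable_continuous_onI[OF cont])
  have meas: "(\<lambda>x. complex_of_real (indicator A (\<iota> x))) \<in> borel_measurable (weinstein_measure \<alpha>)"
    if "A \<in> sets borel" for A
  proof -
    have "(\<lambda>z. complex_of_real (indicator A z)) \<in> borel_measurable borel"
      using that by measurable
    from measurable_compose[OF \<iota> this] show ?thesis by (rule borel_measurable_weinstein_measure)
  qed
  have P: "?P C" if "closed C" "C \<noteq> {}" for C
    unfolding \<iota>_def by (rule approximable_closed[OF \<alpha> that])
  have U: "?P UNIV" by (rule P) auto
  have E: "?P {}"
    using approximable_gauss_span_cmult[OF U, of 0] by simp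
  have sig: "A \<in> sigma_sets UNIV (Collect closed)"
    using A unfolding borel_eq_closed by (simp add: sets_measure_of)
  have Int: "Int_stable (Collect closed :: ((real ^ 'd) \<times> real) set set)" by (auto simp: Int_stable_def)
  have Pow: "Collect closed \<subseteq> Pow (UNIV :: ((real ^ 'd) \<times> real) set)" by simp
  from Int Pow sig have "?P A"
  proof (induction A rule: sigma_sets_induct_disjoint)
    case (basic A)
    then show ?case using P[of A] E by (cases "A = {}") auto
  next
    case empty
    show ?case by (rule E)
  next
    case (compl A)
    have eq: "(\<lambda>x. gauss 0 0 1 x * complex_of_real (indicator (UNIV - A) (\<iota> x))) =
      (\<lambda>x. gauss 0 0 1 x * complex_of_real (indicator UNIV (\<iota> x)) + (-1) * (gauss 0 0 1 x * complex_of_real (indicator A (\<iota> x))))"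
      by (rule ext) (simp add: indicator_def)
    have "approximable (weinstein_measure \<alpha>) gauss_span
      (\<lambda>x. gauss 0 0 1 x * complex_of_real (indicator UNIV (\<iota> x)) + (-1) * (gauss 0 0 1 x * complex_of_real (indicator A (\<iota> x))))"
      by (rule approximable_gauss_span_add[OF U approximable_gauss_span_cmult[OF compl(2)]])
    then show ?case
        using eq[symmetric] by (rule back_subst[where P = "approximable (weinstein_measure \<alpha>) gauss_span"])
  next
    case (union A)
    have AB: "A i \<in> sets borel" for i
      using union(2) unfolding borel_eq_closed by (auto simp: sets_measure_of)
    have fin: "?P (\<Union>i<n. A i)" for n
    proof (induction n)
      case 0
      show ?case using E by simp
    next
      case (Suc n)
      have "A n \<inter> A i = {}" if "i < n" for i
        using disjoint_family_onD[OF union(1), of n i] that by simp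
      then have eq: "(\<lambda>x. gauss 0 0 1 x * complex_of_real (indicator (\<Union>i<Suc n. A i) (\<iota> x))) =
        (\<lambda>x. gauss 0 0 1 x * complex_of_real (indicator (\<Union>i<n. A i) (\<iota> x)) + gauss 0 0 1 x * complex_of_real (indicator (A n) (\<iota> x)))"
        by (intro ext) (fastforce simp: indicator_def lessThan_Suc split: if_splits)
      have "approximable (weinstein_measure \<alpha>) gauss_span
        (\<lambda>x. gauss 0 0 1 x * complex_of_real (indicator (\<Union>i<n. A i) (\<iota> x)) + gauss 0 0 1 x * complex_of_real (indicator (A n) (\<iota> x)))"
        by (rule approximable_gauss_span_add[OF Suc union(3)])
      then show ?case
        using eq[symmetric] by (rule back_subst[where P = "approximable (weinstein_measure \<alpha>) gauss_span"])
    qed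
    show ?case
    proof (rule approximable_gauss_mult_limit[OF \<alpha> fin, where B = 1])
      show "(\<lambda>x. complex_of_real (indicator (\<Union>i. A i) (\<iota> x))) \<in> borel_measurable (weinstein_measure \<alpha>)"
        using AB by (intro meas) auto
      show "(\<lambda>n. complex_of_real (indicator (\<Union>i<n. A i) (\<iota> x))) \<longlonglongrightarrow> complex_of_real (indicator (\<Union>i. A i) (\<iota> x))" for x
        by (intro tendsto_of_real LIMSEQ_indicator_UN)
      show "cmod (complex_of_real (indicator (\<Union>i<n. A i) (\<iota> x))) \<le> 1" for n x
        by (simp add: indicator_def)
    qed
  qed
  then show ?thesis unfolding \<iota>_def .
qed

text \<open>Two reductions: up to a null set A is a Borel set S, and on the half-space the change to
  \<open>exp (- t\<^sup>2 / 2)\<close> is undone by \<kappa>, since t is positive there. The Borel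
  set to use is therefore the preimage of S under \<kappa>.\<close>

lemma approximable_indicator:
  fixes A :: "((real ^ 'd) \<times> real) set"
  assumes \<alpha>: "\<alpha> > -1/2" and A: "A \<in> sets (weinstein_measure \<alpha>)"
  shows "approximable (weinstein_measure \<alpha>) gauss_span (\<lambda>x. gauss 0 0 1 x * complex_of_real (indicator A x))"
proof -
  have "A \<in> sets lebesgue"
    using A half_space_lebesgue by (auto simp: weinstein_measure_altdef sets_restrict_space)
  then obtain S N N' where S: "A = S \<union> N" "N \<subseteq> N'" "N' \<in> null_sets lborel" "S \<in> sets lborel"
    by (rule sets_completionE)
  define \<kappa> :: "(real ^ 'd) \<times> real \<Rightarrow> (real ^ 'd) \<times> real" where "\<kappa> z = (fst z, sqrt (- 2 * ln (snd z)))" for z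
  have \<kappa>m: "\<kappa> \<in> borel_measurable borel"
    unfolding \<kappa>_def[abs_def] borel_prod[symmetric] by measurable
  then have B: "\<kappa> -` S \<in> sets borel" using measurable_sets[OF \<kappa>m, of S] S(4) by simp
  have \<kappa>: "\<kappa> (fst x, exp (- (snd x)\<^sup>2 / 2)) = x" if "x \<in> half_space" for x
    using that by (simp add: \<kappa>_def half_space_def prod_eq_iff)
  show ?thesis
  proof (rule approximable_cong_AE[OF approximable_borel_exp[OF \<alpha> B]])
    have "(\<lambda>x. complex_of_real (indicator A x)) \<in> borel_measurable (weinstein_measure \<alpha>)"
      using A by measurable
    with borel_measurable_weinstein_measure[OF borel_measurable_gauss]
    show "(\<lambda>x. gauss 0 0 1 x * complex_of_real (indicator A x)) \<in> borel_measurable (weinstein_measure \<alpha>)"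
      by (rule borel_measurable_times)
    have "AE x in weinstein_measure \<alpha>. x \<notin> N'"
      unfolding AE_weinstein_measure_iff[OF \<alpha>]
      using AE_completion[OF AE_not_in[OF S(3)]] by (auto elim: eventually_mono)
    with AE_space show "AE x in weinstein_measure \<alpha>.
       gauss 0 0 1 x * complex_of_real (indicator (\<kappa> -` S) (fst x, exp (- (snd x)\<^sup>2 / 2))) =
       gauss 0 0 1 x * complex_of_real (indicator A x)"
    proof eventually_elim
      case (elim x)
      then have "\<kappa> (fst x, exp (- (snd x)\<^sup>2 / 2)) = x" "x \<in> A \<longleftrightarrow> x \<in> S"
        using \<kappa>[of x] S by auto
      then show ?case by (simp add: indicator_def)
    qed
  qed
qed

text \<open>The Gaussian has no zeros, so f can be divided by it. Simple functions tend to the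
  quotient with at most twice its modulus; multiplied back they are dominated by
  \<open>2 * cmod (f x)\<close>, in L1 and in L2.\<close>

theorem approximable_gauss_span:
  fixes f :: "(real ^ 'd) \<times> real \<Rightarrow> complex"
  assumes \<alpha>: "\<alpha> > -1/2" and f: "integrable (weinstein_measure \<alpha>) f" "square_integrable (weinstein_measure \<alpha>) f"
  shows "approximable (weinstein_measure \<alpha>) gauss_span f"
proof -
  let ?M = "weinstein_measure \<alpha> :: ((real ^ 'd) \<times> real) measure" and ?\<gamma> = "gauss 0 0 1 :: (real ^ 'd) \<times> real \<Rightarrow> complex"
  have \<gamma>: "?\<gamma> x \<noteq> 0" for x by (simp add: gauss_def)
  have \<gamma>m: "?\<gamma> \<in> borel_measurable ?M"
    by (intro borel_measurable_weinstein_measure borel_measurable_gauss)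
  have "(\<lambda>x. f x / ?\<gamma> x) \<in> borel_measurable ?M"
    using borel_measurable_integrable[OF f(1)] \<gamma>m by (rule borel_measurable_divide)
  from borel_measurable_implies_sequence_metric[OF this, of 0] obtain F where
    F': "\<forall>i. simple_function ?M (F i)" "\<forall>x\<in>space ?M. (\<lambda>i. F i x) \<longlonglongrightarrow> f x / ?\<gamma> x"
      "\<forall>i. \<forall>x\<in>space ?M. dist (F i x) 0 \<le> 2 * dist (f x / ?\<gamma> x) 0"
    by blast
  have F: "simple_function ?M (F i)" "x \<in> space ?M \<Longrightarrow> (\<lambda>i. F i x) \<longlonglongrightarrow> f x / ?\<gamma> x"
      "x \<in> space ?M \<Longrightarrow> cmod (F i x) \<le> 2 * cmod (f x / ?\<gamma> x)" for i x
    using F' unfolding dist_norm diff_zero by blast+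
  have simple: "approximable ?M gauss_span (\<lambda>x. ?\<gamma> x * F i x)" for i
  proof -
    have Fm: "F i \<in> borel_measurable ?M" by (rule borel_measurable_simple_function[OF F(1)])
    let ?g = "\<lambda>x. \<Sum>y\<in>F i ` space ?M. y * (?\<gamma> x * complex_of_real (indicator (F i -` {y} \<inter> space ?M) x))"
    have "approximable ?M gauss_span (\<lambda>x. \<Sum>y\<in>Y. y * (?\<gamma> x * complex_of_real (indicator (F i -` {y} \<inter> space ?M) x)))"
      if "finite Y" for Y
      using that
    proof induction
      case empty
      show ?case
        using approximable_gauss_span_cmult[OF approximable_indicator[OF \<alpha> sets.top], of 0] by simp
    next
      case (insert y Y)
      have "F i -` {y} \<inter> space ?M \<in> sets ?M" using Fm by (rule measurable_sets) simp
      show ?case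
        unfolding sum.insert[OF insert.hyps]
        by (intro approximable_gauss_span_add insert.IH approximable_gauss_span_cmult approximable_indicator \<alpha>) fact
    qed
    then have g: "approximable ?M gauss_span ?g"
      using F(1)[of i] by (simp add: simple_function_def)
    have eq: "?g x = ?\<gamma> x * F i x" if x: "x \<in> space ?M" for x
    proof -
      have "?g x = (\<Sum>y\<in>F i ` space ?M. if y = F i x then y * ?\<gamma> x else 0)"
        using x by (intro sum.cong refl) (auto simp: indicator_def)
      also have "\<dots> = ?\<gamma> x * F i x"
        using F(1)[of i] x by (subst sum.delta) (auto simp: simple_function_def)
      finally show ?thesis .
    qed
    show ?thesis
    proof (rule approximable_cong_AE[OF g])
      show "(\<lambda>x. ?\<gamma> x * F i x) \<in> borel_measurable ?M" by (rule borel_measurable_times[OF \<gamma>m Fm])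
      show "AE x in ?M. ?g x = ?\<gamma> x * F i x" by (rule AE_I2[OF eq])
    qed
  qed
  show ?thesis
  proof (rule approximable_limit[OF simple])
    show "f \<in> borel_measurable ?M" using f(1) by simp
    show "AE x in ?M. (\<lambda>i. ?\<gamma> x * F i x) \<longlonglongrightarrow> f x"
    proof (rule AE_I2)
      fix x assume "x \<in> space ?M"
      from tendsto_mult_left[OF F(2)[OF this], of "?\<gamma> x"] show "(\<lambda>i. ?\<gamma> x * F i x) \<longlonglongrightarrow> f x"
        using \<gamma>[of x] by simp
    qed
    show "AE x in ?M. cmod (?\<gamma> x * F i x) \<le> 2 * cmod (f x)" for i
    proof (rule AE_I2)
      fix x assume "x \<in> space ?M"
      from mult_left_mono[OF F(3)[OF this], of "cmod (?\<gamma> x)" i] show "cmod (?\<gamma> x * F i x) \<le> 2 * cmod (f x)"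
        using \<gamma>[of x] by (simp add: norm_mult norm_divide)
    qed
    show "integrable ?M (\<lambda>x. 2 * cmod (f x))" using f(1) by simp
    show "integrable ?M (\<lambda>x. (2 * cmod (f x))\<^sup>2)"
      using square_integrableD(2)[OF f(2)] by (simp add: power_mult_distrib)
  qed
qed

subsection \<open>The Plancherel theorem\<close>

lemma approximable_sequence:
  assumes "approximable M S f"
  obtains g where "\<And>n. g n \<in> S" "\<And>n. integrable M (g n)" "\<And>n. square_integrable M (g n)"
    "\<And>n. (\<integral>x. cmod (f x - g n x) \<partial>M) < 1 / real (Suc n)"
    "\<And>n. norm2 M (\<lambda>x. f x - g n x) < 1 / real (Suc n)"
proof -
  have "\<forall>n. \<exists>k. k \<in> S \<and> integrable M k \<and> square_integrable M k \<and>
      (\<integral>x. cmod (f x - k x) \<partial>M) < 1 / real (Suc n) \<and> norm2 M (\<lambda>x. f x - k x) < 1 / real (Suc n)"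
  proof
    fix n
    have "1 / real (Suc n) > 0" by simp
    from approximableD(3)[OF assms this] show "\<exists>k. k \<in> S \<and> integrable M k \<and> square_integrable M k \<and>
      (\<integral>x. cmod (f x - k x) \<partial>M) < 1 / real (Suc n) \<and> norm2 M (\<lambda>x. f x - k x) < 1 / real (Suc n)" by blast
  qed
  from choice[OF this] show ?thesis using that by blast
qed

text \<open>Fatou's lemma gives only an inequality at this point. The Gaussian approximants also
  supply measurability of the transform, as a pointwise limit of Borel functions.\<close>

lemma weinstein_integral_contraction:
  assumes \<alpha>: "\<alpha> > -1/2"
    and f: "integrable (weinstein_measure \<alpha>) f" "square_integrable (weinstein_measure \<alpha>) f"
  shows "square_integrable (weinstein_measure \<alpha>) (weinstein_integral \<alpha> f)"
    "norm2 (weinstein_measure \<alpha>) (weinstein_integral \<alpha> f) \<le> norm2 (weinstein_measure \<alpha>) f"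
proof -
  let ?M = "weinstein_measure \<alpha>" and ?W = "weinstein_integral \<alpha>"
  obtain g where g: "\<And>n. g n \<in> gauss_span" "\<And>n. integrable ?M (g n)" "\<And>n. square_integrable ?M (g n)"
    "\<And>n. (\<integral>x. cmod (f x - g n x) \<partial>?M) < 1 / real (Suc n)"
    "\<And>n. norm2 ?M (\<lambda>x. f x - g n x) < 1 / real (Suc n)"
    using approximable_sequence[OF approximable_gauss_span[OF \<alpha> f]] by blast
  have Wg: "?W (g n) \<in> gauss_span" for n by (rule weinstein_integral_gauss_span[OF \<alpha> g(1)])
  have lim: "(\<lambda>n. ?W (g n) l) \<longlonglongrightarrow> ?W f l" for l
  proof (rule Lim_transform_bound[THEN LIM_zero_cancel])
    show "(\<lambda>n. 1 / real (Suc n)) \<longlonglongrightarrow> 0" by (rule LIMSEQ_Suc[OF lim_1_over_n])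
    have "cmod (?W (g n) l - ?W f l) \<le> 1 / real (Suc n)" for n
    proof -
      have "cmod (?W (g n) l - ?W f l) = cmod (?W (\<lambda>x. f x - g n x) l)"
        by (simp add: weinstein_integral_diff[OF \<alpha> f(1) g(2)] norm_minus_commute)
      also have "\<dots> \<le> (\<integral>x. cmod (f x - g n x) \<partial>?M)"
        using f g(2) by (intro norm_weinstein_integral_le \<alpha>) simp
      finally show ?thesis using g(4)[of n] by linarith
    qed
    then show "\<forall>\<^sub>F n in sequentially. norm (?W (g n) l - ?W f l) \<le> norm (1 / real (Suc n))"
      by (intro always_eventually allI) simp
  qed
  have "?W f \<in> borel_measurable borel"
    by (rule borel_measurable_LIMSEQ_metric[of "\<lambda>n. ?W (g n)"]) (use gauss_span_borel[OF Wg] lim in auto)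
  then have m: "?W f \<in> borel_measurable ?M" by (rule borel_measurable_weinstein_measure)
  have sq: "square_integrable ?M (?W (g n))" for n by (rule gauss_span_square_integrable[OF \<alpha> Wg])
  have le: "norm2 ?M (?W (g n)) \<le> norm2 ?M f + 1 / real (Suc n)" for n
    unfolding norm2_weinstein_integral_gauss_span[OF \<alpha> g(1)]
    using norm2_le_add_diff[OF g(3) f(2), of n] g(5)[of n] norm2_minus_commute[of ?M f "g n"] by linarith
  have *: "square_integrable ?M (?W f) \<and> norm2 ?M (?W f) \<le> norm2 ?M f + e" if e: "e > 0" for e
  proof -
    have "(\<lambda>n. 1 / real (Suc n)) \<longlonglongrightarrow> 0" by (rule LIMSEQ_Suc[OF lim_1_over_n])
    from order_tendstoD(2)[OF this e] have "\<forall>\<^sub>F n in sequentially. norm2 ?M (?W (g n)) \<le> norm2 ?M f + e"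
    proof eventually_elim
      case (elim n)
      then show ?case using le[of n] by linarith
    qed
    from norm2_liminf[OF sq m _ this] show ?thesis using lim e by auto
  qed
  show "square_integrable ?M (?W f)" using *[of 1] by simp
  show "norm2 ?M (?W f) \<le> norm2 ?M f" by (rule field_le_epsilon) (use * in blast)
qed

text \<open>For the reverse inequality, an approximant g from the span keeps its norm exactly, and
  the contraction applied to \<open>g - f\<close> bounds the error on the transform side.\<close>

theorem norm2_weinstein_integral:
  assumes \<alpha>: "\<alpha> > -1/2"
    and f: "integrable (weinstein_measure \<alpha>) f" "square_integrable (weinstein_measure \<alpha>) f"
  shows "norm2 (weinstein_measure \<alpha>) (weinstein_integral \<alpha> f) = norm2 (weinstein_measure \<alpha>) f"
proof (rule antisym)
  let ?M = "weinstein_measure \<alpha>" and ?W = "weinstein_integral \<alpha>"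
  show "norm2 ?M (?W f) \<le> norm2 ?M f" by (rule weinstein_integral_contraction[OF \<alpha> f])
  show "norm2 ?M f \<le> norm2 ?M (?W f)"
  proof (rule field_le_epsilon)
    fix e :: real assume "e > 0"
    then have "e / 2 > 0" by simp
    from approximableD(3)[OF approximable_gauss_span[OF \<alpha> f] this]
    obtain g where g: "g \<in> gauss_span" "integrable ?M g" "square_integrable ?M g"
      "norm2 ?M (\<lambda>x. f x - g x) < e / 2" by blast
    have d: "integrable ?M (\<lambda>x. g x - f x)" "square_integrable ?M (\<lambda>x. g x - f x)"
      using f g by (auto intro: square_integrable_diff)
    have "norm2 ?M f \<le> norm2 ?M g + norm2 ?M (\<lambda>x. f x - g x)"
      by (rule norm2_le_add_diff[OF f(2) g(3)])
    also have "norm2 ?M g = norm2 ?M (?W g)" by (rule norm2_weinstein_integral_gauss_span[OF \<alpha> g(1), symmetric])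
    also have "\<dots> \<le> norm2 ?M (?W f) + norm2 ?M (\<lambda>x. ?W g x - ?W f x)"
      by (intro norm2_le_add_diff weinstein_integral_contraction \<alpha> f g)
    also have "(\<lambda>x. ?W g x - ?W f x) = ?W (\<lambda>x. g x - f x)"
      by (rule ext) (rule weinstein_integral_diff[OF \<alpha> g(2) f(1), symmetric])
    also have "norm2 ?M (?W (\<lambda>x. g x - f x)) \<le> norm2 ?M (\<lambda>x. g x - f x)"
      by (rule weinstein_integral_contraction[OF \<alpha> d])
    finally show "norm2 ?M f \<le> norm2 ?M (?W f) + e"
      using g(4) norm2_minus_commute[of ?M f g] by linarith
  qed
qed

section \<open>L2 convergence and the extension of the transform to L2\<close>

lemma L2_iff: "f \<in> L2 \<alpha> \<longleftrightarrow> square_integrable (weinstein_measure \<alpha>) f"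
  by (simp add: L2_def square_integrable_def)

lemma L2_norm_altdef: "L2_norm \<alpha> f = norm2 (weinstein_measure \<alpha>) f"
  by (simp add: L2_norm_def norm2_def)

lemma L2_tendsto_altdef:
  "L2_tendsto \<alpha> f g \<longleftrightarrow> (\<forall>n. square_integrable (weinstein_measure \<alpha>) (f n)) \<and>
     square_integrable (weinstein_measure \<alpha>) g \<and>
     (\<lambda>n. norm2 (weinstein_measure \<alpha>) (\<lambda>x. f n x - g x)) \<longlonglongrightarrow> 0"
  by (simp add: L2_tendsto_def L2_iff L2_norm_altdef)

lemma L2_tendsto_const: "square_integrable (weinstein_measure \<alpha>) f \<Longrightarrow> L2_tendsto \<alpha> (\<lambda>n. f) f"
  by (simp add: L2_tendsto_altdef norm2_def)

lemma L2_tendsto_norm2: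
  assumes "L2_tendsto \<alpha> f g"
  shows "(\<lambda>n. norm2 (weinstein_measure \<alpha>) (f n)) \<longlonglongrightarrow> norm2 (weinstein_measure \<alpha>) g"
proof (rule Lim_transform_bound[THEN LIM_zero_cancel])
  let ?M = "weinstein_measure \<alpha>"
  note a = assms[unfolded L2_tendsto_altdef]
  show "(\<lambda>n. norm2 ?M (\<lambda>x. f n x - g x)) \<longlonglongrightarrow> 0" using a by blast
  have "\<bar>norm2 ?M (f n) - norm2 ?M g\<bar> \<le> norm2 ?M (\<lambda>x. f n x - g x)" for n
    using norm2_le_add_diff[of ?M "f n" g] norm2_le_add_diff[of ?M g "f n"] a norm2_minus_commute[of ?M g "f n"]
    by (simp add: abs_le_iff)
  then show "\<forall>\<^sub>F n in sequentially. norm (norm2 ?M (f n) - norm2 ?M g) \<le> norm (norm2 ?M (\<lambda>x. f n x - g x))"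
    by (intro always_eventually allI) simp
qed

lemma L2_tendsto_add_cmult:
  assumes "L2_tendsto \<alpha> f g" "L2_tendsto \<alpha> f' g'"
  shows "L2_tendsto \<alpha> (\<lambda>n x. f n x + c * f' n x) (\<lambda>x. g x + c * g' x)"
proof -
  let ?M = "weinstein_measure \<alpha>"
  note a = assms[unfolded L2_tendsto_altdef]
  have sq: "square_integrable ?M (\<lambda>x. f n x + c * f' n x)" "square_integrable ?M (\<lambda>x. g x + c * g' x)" for n
    using a by (auto intro!: square_integrable_add square_integrable_cmult)
  have "(\<lambda>n. norm2 ?M (\<lambda>x. f n x + c * f' n x - (g x + c * g' x))) \<longlonglongrightarrow> 0"
  proof (rule Lim_null_comparison)
    have "norm2 ?M (\<lambda>x. f n x + c * f' n x - (g x + c * g' x)) \<le>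
      norm2 ?M (\<lambda>x. f n x - g x) + cmod c * norm2 ?M (\<lambda>x. f' n x - g' x)" for n
    proof -
      have d: "f n x + c * f' n x - (g x + c * g' x) = (f n x - g x) + c * (f' n x - g' x)" for x
        by (simp add: algebra_simps)
      have "square_integrable ?M (\<lambda>x. f n x - g x)" "square_integrable ?M (\<lambda>x. c * (f' n x - g' x))"
        using a by (auto intro!: square_integrable_diff square_integrable_cmult)
      from norm2_triangle[OF this] show ?thesis unfolding d norm2_cmult .
    qed
    then show "\<forall>\<^sub>F n in sequentially. norm (norm2 ?M (\<lambda>x. f n x + c * f' n x - (g x + c * g' x))) \<le>
      norm2 ?M (\<lambda>x. f n x - g x) + cmod c * norm2 ?M (\<lambda>x. f' n x - g' x)"
      by (intro always_eventually allI) simp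
    have "(\<lambda>n. norm2 ?M (\<lambda>x. f n x - g x) + cmod c * norm2 ?M (\<lambda>x. f' n x - g' x)) \<longlonglongrightarrow> 0 + cmod c * 0"
      using a by (intro tendsto_intros) auto
    then show "(\<lambda>n. norm2 ?M (\<lambda>x. f n x - g x) + cmod c * norm2 ?M (\<lambda>x. f' n x - g' x)) \<longlonglongrightarrow> 0" by simp
  qed
  then show ?thesis using sq by (simp add: L2_tendsto_altdef)
qed

text \<open>The graph of the extended transform. It has exact laws for linear combinations, norms
  and inversion, and each of f and g determines the other almost everywhere.\<close>

definition transform_pair ::
  "real \<Rightarrow> ((real ^ 'd) \<times> real \<Rightarrow> complex) \<Rightarrow> ((real ^ 'd) \<times> real \<Rightarrow> complex) \<Rightarrow> bool" where
  "transform_pair \<alpha> f g \<longleftrightarrow> (\<exists>u. (\<forall>n. integrable (weinstein_measure \<alpha>) (u n)) \<and> L2_tendsto \<alpha> u f \<and>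
     L2_tendsto \<alpha> (\<lambda>n. weinstein_integral \<alpha> (u n)) g)"

lemma transform_pair_square_integrable:
  assumes "transform_pair \<alpha> f g"
  shows "square_integrable (weinstein_measure \<alpha>) f" "square_integrable (weinstein_measure \<alpha>) g"
  using assms unfolding transform_pair_def L2_tendsto_altdef by blast+

lemma transform_pair_norm2:
  assumes \<alpha>: "\<alpha> > -1/2" and "transform_pair \<alpha> f g"
  shows "norm2 (weinstein_measure \<alpha>) g = norm2 (weinstein_measure \<alpha>) f"
proof -
  obtain u where u: "\<And>n. integrable (weinstein_measure \<alpha>) (u n)" "L2_tendsto \<alpha> u f"
      "L2_tendsto \<alpha> (\<lambda>n. weinstein_integral \<alpha> (u n)) g"
    using assms(2) unfolding transform_pair_def by blast
  have sq: "square_integrable (weinstein_measure \<alpha>) (u n)" for n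
    using u(2) unfolding L2_tendsto_altdef by blast
  show ?thesis
    using L2_tendsto_norm2[OF u(3)] L2_tendsto_norm2[OF u(2)]
    unfolding norm2_weinstein_integral[OF \<alpha> u(1) sq] by (rule LIMSEQ_unique)
qed

lemma transform_pair_add_cmult:
  assumes \<alpha>: "\<alpha> > -1/2" and fg: "transform_pair \<alpha> f g" "transform_pair \<alpha> f' g'"
  shows "transform_pair \<alpha> (\<lambda>x. f x + c * f' x) (\<lambda>x. g x + c * g' x)"
proof -
  obtain u where u: "\<And>n. integrable (weinstein_measure \<alpha>) (u n)" "L2_tendsto \<alpha> u f"
      "L2_tendsto \<alpha> (\<lambda>n. weinstein_integral \<alpha> (u n)) g"
    using fg(1) unfolding transform_pair_def by blast
  obtain v where v: "\<And>n. integrable (weinstein_measure \<alpha>) (v n)" "L2_tendsto \<alpha> v f'"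
      "L2_tendsto \<alpha> (\<lambda>n. weinstein_integral \<alpha> (v n)) g'"
    using fg(2) unfolding transform_pair_def by blast
  have W: "weinstein_integral \<alpha> (\<lambda>x. u n x + c * v n x) =
      (\<lambda>l. weinstein_integral \<alpha> (u n) l + c * weinstein_integral \<alpha> (v n) l)" for n
    using u(1) v(1) \<alpha> by (intro ext) (simp add: weinstein_integral_add weinstein_integral_cmult)
  show ?thesis
    unfolding transform_pair_def
  proof (intro exI conjI allI)
    show "integrable (weinstein_measure \<alpha>) (\<lambda>x. u n x + c * v n x)" for n using u(1) v(1) by simp
    show "L2_tendsto \<alpha> (\<lambda>n x. u n x + c * v n x) (\<lambda>x. f x + c * f' x)"
      by (rule L2_tendsto_add_cmult[OF u(2) v(2)])
    show "L2_tendsto \<alpha> (\<lambda>n. weinstein_integral \<alpha> (\<lambda>x. u n x + c * v n x)) (\<lambda>x. g x + c * g' x)"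
      unfolding W by (rule L2_tendsto_add_cmult[OF u(3) v(3)])
  qed
qed

lemma transform_pair_diff:
  assumes "\<alpha> > -1/2" "transform_pair \<alpha> f g" "transform_pair \<alpha> f' g'"
  shows "transform_pair \<alpha> (\<lambda>x. f x - f' x) (\<lambda>x. g x - g' x)"
  using transform_pair_add_cmult[OF assms, of "-1"] by simp

lemma transform_pair_norm2_diff:
  assumes "\<alpha> > -1/2" "transform_pair \<alpha> f g" "transform_pair \<alpha> f' g'"
  shows "norm2 (weinstein_measure \<alpha>) (\<lambda>x. g x - g' x) = norm2 (weinstein_measure \<alpha>) (\<lambda>x. f x - f' x)"
  by (rule transform_pair_norm2[OF assms(1) transform_pair_diff[OF assms]])

lemma transform_pair_unique_right:
  assumes "\<alpha> > -1/2" "transform_pair \<alpha> f g" "transform_pair \<alpha> f g'"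
  shows "AE x in weinstein_measure \<alpha>. g x = g' x"
proof (rule norm2_eq_0_imp_AE)
  show "square_integrable (weinstein_measure \<alpha>) (\<lambda>x. g x - g' x)"
    using assms(2,3) by (intro square_integrable_diff transform_pair_square_integrable)
  show "norm2 (weinstein_measure \<alpha>) (\<lambda>x. g x - g' x) = 0"
    unfolding transform_pair_norm2_diff[OF assms] by (simp add: norm2_def)
qed

text \<open>Injectivity of the L2 transform, from the isometry applied to differences; uniqueness of
  the minimiser rests on it.\<close>

lemma transform_pair_cong_left:
  fixes f f' g g' :: "(real ^ 'd) \<times> real \<Rightarrow> complex"
  assumes \<alpha>: "\<alpha> > -1/2" and fg: "transform_pair \<alpha> f g" "transform_pair \<alpha> f' g'"
    and eq: "AE x in weinstein_measure \<alpha>. g x = g' x"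
  shows "AE x in weinstein_measure \<alpha>. f x = f' x"
proof (rule norm2_eq_0_imp_AE)
  let ?M = "weinstein_measure \<alpha> :: ((real ^ 'd) \<times> real) measure"
  note sq = transform_pair_square_integrable[OF fg(1)] transform_pair_square_integrable[OF fg(2)]
  show "square_integrable ?M (\<lambda>x. f x - f' x)" by (intro square_integrable_diff sq)
  have "norm2 ?M (\<lambda>x. f x - f' x) = norm2 ?M (\<lambda>x. g x - g' x)"
    by (rule transform_pair_norm2_diff[OF \<alpha> fg, symmetric])
  also have "\<dots> = norm2 ?M (\<lambda>x. 0)"
  proof (rule norm2_cong_AE)
    show "(\<lambda>x. g x - g' x) \<in> borel_measurable ?M"
      by (rule square_integrableD(1)[OF square_integrable_diff[OF sq(2,4)]])
    show "AE x in ?M. g x - g' x = 0" using eq by eventually_elim simp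
  qed simp
  finally show "norm2 ?M (\<lambda>x. f x - f' x) = 0" by (simp add: norm2_def)
qed

text \<open>Parseval's identity by polarisation: all combinations \<open>f + c f'\<close> are left
  members of pairs and so keep their norms.\<close>

lemma transform_pair_inner:
  assumes \<alpha>: "\<alpha> > -1/2" and fg: "transform_pair \<alpha> f g" "transform_pair \<alpha> f' g'"
  shows "(\<integral>x. f x * cnj (f' x) \<partial>weinstein_measure \<alpha>) = (\<integral>x. g x * cnj (g' x) \<partial>weinstein_measure \<alpha>)"
  by (intro norm2_eq_imp_inner_eq transform_pair_square_integrable[OF fg(1)] transform_pair_square_integrable[OF fg(2)]
      transform_pair_norm2[OF \<alpha>, symmetric] transform_pair_add_cmult \<alpha> fg)

lemma transform_pair_integral:
  assumes "\<alpha> > -1/2" "integrable (weinstein_measure \<alpha>) f" "square_integrable (weinstein_measure \<alpha>) f"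
  shows "transform_pair \<alpha> f (weinstein_integral \<alpha> f)"
  unfolding transform_pair_def
  using assms by (intro exI[of _ "\<lambda>n. f"] conjI allI L2_tendsto_const weinstein_integral_contraction)

text \<open>The cutoff \<open>c n x\<close> does three things: being at most n times the Gaussian,
  it bounds \<open>u n\<close> by a product of two square-integrable functions, which is integrable;
  being at most 1, it keeps \<open>u n\<close> below f; and at each point it is eventually 1, as the
  Gaussian has no zeros.\<close>

lemma L2_approx_integrable:
  fixes f :: "(real ^ 'd) \<times> real \<Rightarrow> complex"
  assumes \<alpha>: "\<alpha> > -1/2" and f: "square_integrable (weinstein_measure \<alpha>) f"
  obtains u where "\<And>n. integrable (weinstein_measure \<alpha>) (u n)" "L2_tendsto \<alpha> u f"
proof -
  let ?M = "weinstein_measure \<alpha> :: ((real ^ 'd) \<times> real) measure" and ?\<gamma> = "gauss 0 0 1 :: (real ^ 'd) \<times> real \<Rightarrow> complex"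
  have \<gamma>: "?\<gamma> \<in> gauss_span" using gauss_span.gauss[of 1 1 0 0] by simp
  have \<gamma>0: "?\<gamma> x \<noteq> 0" for x by (simp add: gauss_def)
  have fm [measurable]: "f \<in> borel_measurable ?M" by (rule square_integrableD(1)[OF f])
  have \<gamma>m [measurable]: "?\<gamma> \<in> borel_measurable ?M"
    by (intro borel_measurable_weinstein_measure borel_measurable_gauss)
  define c where "c n x = min 1 (real n * cmod (?\<gamma> x))" for n x
  have c01: "0 \<le> c n x" "c n x \<le> 1" "c n x \<le> real n * cmod (?\<gamma> x)" for n x by (simp_all add: c_def)
  have cm [measurable]: "c n \<in> borel_measurable ?M" for n unfolding c_def by measurable
  define u where "u n x = complex_of_real (c n x) * f x" for n x
  have um [measurable]: "u n \<in> borel_measurable ?M" for n unfolding u_def by measurable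
  have le: "cmod (u n x) \<le> cmod (f x)" for n x
    unfolding u_def norm_mult using c01[of n x] by (simp add: mult_left_le_one_le)
  have i: "integrable ?M (u n)" for n
  proof (rule Bochner_Integration.integrable_bound)
    show "integrable ?M (\<lambda>x. complex_of_real (real n) * (?\<gamma> x * f x))"
      by (intro integrable_mult_right square_integrable_mult f gauss_span_square_integrable \<alpha> \<gamma>)
    have "cmod (u n x) \<le> cmod (complex_of_real (real n) * (?\<gamma> x * f x))" for x
      unfolding u_def norm_mult using mult_right_mono[OF c01(3)[of n x], of "cmod (f x)"] c01(1)[of n x]
      by (simp add: mult.assoc)
    then show "AE x in ?M. norm (u n x) \<le> norm (complex_of_real (real n) * (?\<gamma> x * f x))"
      by (intro AE_I2)
  qed (rule um)
  have sq: "square_integrable ?M (u n)" for n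
    by (rule square_integrable_bound[OF f um, where C = 1]) (simp add: le)
  have lim: "(\<lambda>n. u n x) \<longlonglongrightarrow> f x" for x
  proof (rule tendsto_eventually)
    have "\<exists>N. 1 < real N * cmod (?\<gamma> x)"
      using reals_Archimedean3[of "cmod (?\<gamma> x)"] \<gamma>0[of x] by simp
    then obtain N where N: "1 < real N * cmod (?\<gamma> x)" by blast
    show "\<forall>\<^sub>F n in sequentially. u n x = f x"
      using eventually_ge_at_top[of N]
    proof eventually_elim
      case (elim n)
      then have "real N * cmod (?\<gamma> x) \<le> real n * cmod (?\<gamma> x)" by (intro mult_right_mono) auto
      with N have "c n x = 1" by (simp add: c_def)
      then show ?case by (simp add: u_def)
    qed
  qed
  have "(\<lambda>n. \<integral>x. (cmod (u n x - f x))\<^sup>2 \<partial>?M) \<longlonglongrightarrow> (\<integral>x. 0 \<partial>?M)"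
  proof (rule integral_dominated_convergence[where w = "\<lambda>x. 4 * (cmod (f x))\<^sup>2"])
    show "AE x in ?M. (\<lambda>n. (cmod (u n x - f x))\<^sup>2) \<longlonglongrightarrow> 0"
    proof (rule AE_I2)
      fix x
      have "(\<lambda>n. (cmod (u n x - f x))\<^sup>2) \<longlonglongrightarrow> (cmod (f x - f x))\<^sup>2"
        by (intro tendsto_intros lim)
      then show "(\<lambda>n. (cmod (u n x - f x))\<^sup>2) \<longlonglongrightarrow> 0" by simp
    qed
    have "cmod (u n x - f x) \<le> 2 * cmod (f x)" for n x
      using norm_triangle_ineq4[of "u n x" "f x"] le[of n x] by linarith
    then have "(cmod (u n x - f x))\<^sup>2 \<le> (2 * cmod (f x))\<^sup>2" for n x
      by (rule power_mono) simp
    then show "AE x in ?M. norm ((cmod (u n x - f x))\<^sup>2) \<le> 4 * (cmod (f x))\<^sup>2" for n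
      by (intro AE_I2) (simp add: power_mult_distrib)
    show "integrable ?M (\<lambda>x. 4 * (cmod (f x))\<^sup>2)" using square_integrableD(2)[OF f] by simp
  qed auto
  then have "(\<lambda>n. norm2 ?M (\<lambda>x. u n x - f x)) \<longlonglongrightarrow> sqrt 0"
    unfolding norm2_def by (intro tendsto_real_sqrt) simp
  then have "L2_tendsto \<alpha> u f" using sq f by (simp add: L2_tendsto_altdef)
  with i show ?thesis by (rule that)
qed

text \<open>The isometry makes the transforms of integrable approximants a Cauchy sequence, and
  completeness provides its limit.\<close>

lemma transform_pair_exists:
  assumes \<alpha>: "\<alpha> > -1/2" and f: "square_integrable (weinstein_measure \<alpha>) f"
  shows "\<exists>g. transform_pair \<alpha> f g"
proof -
  let ?M = "weinstein_measure \<alpha>" and ?W = "weinstein_integral \<alpha>"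
  obtain u where u: "\<And>n. integrable ?M (u n)" "L2_tendsto \<alpha> u f"
    using L2_approx_integrable[OF assms] by blast
  have sq: "square_integrable ?M (u n)" for n using u(2) by (simp add: L2_tendsto_altdef)
  have Wsq: "square_integrable ?M (?W (u n))" for n by (rule weinstein_integral_contraction[OF \<alpha> u(1) sq])
  have W: "norm2 ?M (\<lambda>x. ?W (u m) x - ?W (u n) x) \<le> norm2 ?M (\<lambda>x. u m x - f x) + norm2 ?M (\<lambda>x. u n x - f x)" for m n
    using transform_pair_norm2_diff[OF \<alpha> transform_pair_integral[OF \<alpha> u(1) sq] transform_pair_integral[OF \<alpha> u(1) sq], of m n]
      norm2_triangle_diff[OF sq[of m] f sq[of n]] norm2_minus_commute[of ?M f "u n"] by simp
  obtain g where g: "square_integrable ?M g" "(\<lambda>n. norm2 ?M (\<lambda>x. ?W (u n) x - g x)) \<longlonglongrightarrow> 0"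
  proof (rule square_integrable_complete[OF Wsq])
    fix e :: real assume "e > 0"
    then have "e / 2 > 0" by simp
    moreover have "(\<lambda>n. norm2 ?M (\<lambda>x. u n x - f x)) \<longlonglongrightarrow> 0" using u(2) by (simp add: L2_tendsto_altdef)
    ultimately obtain N where N: "\<And>n. n \<ge> N \<Longrightarrow> norm2 ?M (\<lambda>x. u n x - f x) < e / 2"
      using order_tendstoD(2)[of _ 0 sequentially "e / 2"] unfolding eventually_sequentially by blast
    have "norm2 ?M (\<lambda>x. ?W (u m) x - ?W (u n) x) < e" if "m \<ge> N" "n \<ge> N" for m n
      using W[of m n] N[OF that(1)] N[OF that(2)] by linarith
    then show "\<exists>N. \<forall>m\<ge>N. \<forall>n\<ge>N. norm2 ?M (\<lambda>x. ?W (u m) x - ?W (u n) x) < e" by blast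
  qed
  then have "L2_tendsto \<alpha> (\<lambda>n. ?W (u n)) g" using Wsq by (simp add: L2_tendsto_altdef)
  with u show ?thesis unfolding transform_pair_def by blast
qed

text \<open>The bridge to the defined transform: for integrable f the constant sequence works, and
  otherwise existence ensures that the choice picks a genuine limit.\<close>

theorem transform_pair_weinstein:
  assumes \<alpha>: "\<alpha> > -1/2" and f: "square_integrable (weinstein_measure \<alpha>) f"
  shows "transform_pair \<alpha> f (weinstein \<alpha> f)"
proof (cases "integrable (weinstein_measure \<alpha>) f")
  case True
  then show ?thesis using transform_pair_integral[OF \<alpha> True f] by (simp add: weinstein_def)
next
  case False
  then have "weinstein \<alpha> f = (SOME g. transform_pair \<alpha> f g)"
    by (simp add: weinstein_def transform_pair_def)
  then show ?thesis using someI_ex[OF transform_pair_exists[OF assms]] by simp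
qed

section \<open>Reflection, inversion and dilation\<close>

lemma reflect_lebesgue:
  "(reflect :: (real ^ 'd) \<times> real \<Rightarrow> _) \<in> lebesgue \<rightarrow>\<^sub>M lebesgue"
  "distr lebesgue lebesgue (reflect :: (real ^ 'd) \<times> real \<Rightarrow> _) = lebesgue"
proof -
  \<comment> \<open>The basis vectors of x' are those with \<open>snd j = 0\<close>; the reflection
    is diagonal with entries of modulus 1 and so preserves Lebesgue measure.\<close>
  define c :: "(real ^ 'd) \<times> real \<Rightarrow> real" where "c j = (if snd j = 0 then - 1 else 1)" for j
  have c: "c j \<noteq> 0" for j by (simp add: c_def)
  have T: "reflect = (\<lambda>x :: (real ^ 'd) \<times> real. 0 + (\<Sum>j\<in>Basis. (c j * (x \<bullet> j)) *\<^sub>R j))"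
  proof (rule ext, rule euclidean_eqI)
    fix x b :: "(real ^ 'd) \<times> real" assume b: "b \<in> Basis"
    have "(0 + (\<Sum>j\<in>Basis. (c j * (x \<bullet> j)) *\<^sub>R j)) \<bullet> b = c b * (x \<bullet> b)"
      using b by (simp add: inner_sum_left_Basis)
    also have "\<dots> = reflect x \<bullet> b"
      using b by (auto simp: c_def reflect_def Basis_prod_def inner_prod_def)
    finally show "reflect x \<bullet> b = (0 + (\<Sum>j\<in>Basis. (c j * (x \<bullet> j)) *\<^sub>R j)) \<bullet> b" ..
  qed
  show "(reflect :: (real ^ 'd) \<times> real \<Rightarrow> _) \<in> lebesgue \<rightarrow>\<^sub>M lebesgue"
    unfolding T by (rule lebesgue_affine_measurable) (rule c)
  have "(\<Prod>j\<in>(Basis :: ((real ^ 'd) \<times> real) set). \<bar>c j\<bar>) = 1"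
    by (intro prod.neutral) (simp add: c_def)
  moreover have "lebesgue = density (distr lebesgue lebesgue (reflect :: (real ^ 'd) \<times> real \<Rightarrow> _)) (\<lambda>_. ennreal (\<Prod>j\<in>(Basis :: ((real ^ 'd) \<times> real) set). \<bar>c j\<bar>))"
    unfolding T by (rule lebesgue_affine_euclidean) (rule c)
  ultimately show "distr lebesgue lebesgue (reflect :: (real ^ 'd) \<times> real \<Rightarrow> _) = lebesgue"
    by (simp add: density_1)
qed

lemma measurable_reflect: "reflect \<in> weinstein_measure \<alpha> \<rightarrow>\<^sub>M weinstein_measure \<alpha>"
proof -
  have "reflect \<in> lebesgue_on half_space \<rightarrow>\<^sub>M lebesgue_on half_space"
    by (rule measurable_restrict_space3[OF reflect_lebesgue(1)]) simp
  then show ?thesis unfolding weinstein_measure_altdef by simp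
qed

text \<open>The density depends only on the last coordinate, which the reflection fixes, so the
  invariance of Lebesgue measure carries over.\<close>

lemma distr_reflect: "distr (weinstein_measure \<alpha>) (weinstein_measure \<alpha>) reflect = (weinstein_measure \<alpha> :: ((real ^ 'd) \<times> real) measure)"
proof (rule measure_eqI)
  let ?M = "weinstein_measure \<alpha> :: ((real ^ 'd) \<times> real) measure"
  let ?w = "\<lambda>x :: (real ^ 'd) \<times> real. ennreal (weinstein_density \<alpha> x)"
  show "sets (distr ?M ?M reflect) = sets ?M" by simp
  fix A assume "A \<in> sets (distr ?M ?M reflect)"
  then have A: "A \<in> sets ?M" by simp
  then have Al: "A \<in> sets lebesgue" "A \<subseteq> half_space"
    using half_space_lebesgue by (auto simp: weinstein_measure_altdef sets_restrict_space)
  have m: "?w \<in> borel_measurable (lebesgue_on half_space)"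
    by (rule measurable_compose[OF borel_measurable_weinstein_density_half_space measurable_ennreal])
  have em: "emeasure ?M B = (\<integral>\<^sup>+x. ?w x * indicator B x \<partial>lebesgue)" if B: "B \<in> sets ?M" for B
  proof -
    have B': "B \<in> sets (lebesgue_on half_space)" using B by (simp add: weinstein_measure_altdef)
    then have "B \<subseteq> half_space" by (metis sets.sets_into_space space_lebesgue_on)
    have "emeasure ?M B = (\<integral>\<^sup>+x. ?w x * indicator B x \<partial>lebesgue_on half_space)"
      unfolding weinstein_measure_altdef by (rule emeasure_density[OF m B'])
    also have "\<dots> = (\<integral>\<^sup>+x. ?w x * indicator B x * indicator half_space x \<partial>lebesgue)"
      using half_space_lebesgue by (subst nn_integral_restrict_space) auto
    also have "\<dots> = (\<integral>\<^sup>+x. ?w x * indicator B x \<partial>lebesgue)"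
      using \<open>B \<subseteq> half_space\<close> by (intro nn_integral_cong) (auto simp: indicator_def)
    finally show ?thesis .
  qed
  have [measurable]: "?w \<in> borel_measurable lebesgue"
    using borel_measurable_weinstein_density by (simp add: measurable_completion)
  note [measurable] = Al(1)
  have wl: "(\<lambda>x. ?w x * indicator A x) \<in> borel_measurable lebesgue" by measurable
  have "emeasure (distr ?M ?M reflect) A = emeasure ?M (reflect -` A \<inter> half_space)"
    using A by (simp add: emeasure_distr[OF measurable_reflect])
  also have "\<dots> = (\<integral>\<^sup>+x. ?w x * indicator (reflect -` A \<inter> half_space) x \<partial>lebesgue)"
    using measurable_sets[OF measurable_reflect A] by (intro em) simp
  also have "\<dots> = (\<integral>\<^sup>+x. ?w (reflect x) * indicator A (reflect x) \<partial>lebesgue)"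
  proof (rule nn_integral_cong)
    fix x :: "(real ^ 'd) \<times> real"
    have "x \<in> half_space" if "reflect x \<in> A" using that Al(2) reflect_in_half_space[of x] by blast
    then show "?w x * indicator (reflect -` A \<inter> half_space) x = ?w (reflect x) * indicator A (reflect x)"
      by (auto simp: indicator_def weinstein_density_def reflect_def)
  qed
  also have "\<dots> = (\<integral>\<^sup>+x. ?w x * indicator A x \<partial>distr lebesgue lebesgue reflect)"
    by (subst nn_integral_distr[OF reflect_lebesgue(1)]) (use wl in auto)
  also have "\<dots> = emeasure ?M A"
    unfolding reflect_lebesgue(2) by (rule em[OF A, symmetric])
  finally show "emeasure (distr ?M ?M reflect) A = emeasure ?M A" .
qed

lemma square_integrable_reflect:
  assumes f: "square_integrable (weinstein_measure \<alpha>) f"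
  shows "square_integrable (weinstein_measure \<alpha>) (\<lambda>x. f (reflect x))"
    "norm2 (weinstein_measure \<alpha>) (\<lambda>x. f (reflect x)) = norm2 (weinstein_measure \<alpha>) f"
proof -
  let ?M = "weinstein_measure \<alpha>"
  have fm: "f \<in> borel_measurable ?M" by (rule square_integrableD(1)[OF f])
  then have f2: "(\<lambda>x. (cmod (f x))\<^sup>2) \<in> borel_measurable ?M" by simp
  have "integrable ?M (\<lambda>x. (cmod (f (reflect x)))\<^sup>2)"
    using square_integrableD(2)[OF f] integrable_distr_eq[OF measurable_reflect f2] unfolding distr_reflect by simp
  then show "square_integrable ?M (\<lambda>x. f (reflect x))"
    using measurable_compose[OF measurable_reflect fm] by (simp add: square_integrable_def)
  show "norm2 ?M (\<lambda>x. f (reflect x)) = norm2 ?M f"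
    using integral_distr[OF measurable_reflect f2] unfolding distr_reflect norm2_def by simp
qed

text \<open>Transforms of arbitrary integrable approximants need not be integrable, so they could
  not serve as approximants of the reflected g. Approximants from the Gaussian span can: their
  transforms stay in the span, where inversion is an identity.\<close>

theorem transform_pair_inverse:
  assumes \<alpha>: "\<alpha> > -1/2" and fg: "transform_pair \<alpha> f g"
  shows "transform_pair \<alpha> (\<lambda>x. g (reflect x)) f"
proof -
  let ?M = "weinstein_measure \<alpha>" and ?W = "weinstein_integral \<alpha>"
  note fsq = transform_pair_square_integrable(1)[OF fg] and gsq = transform_pair_square_integrable(2)[OF fg]
  obtain u where u: "\<And>n. integrable ?M (u n)" "L2_tendsto \<alpha> u f"
    using L2_approx_integrable[OF \<alpha> fsq] by blast
  have usq: "square_integrable ?M (u n)" for n using u(2) by (simp add: L2_tendsto_altdef)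
  have "\<forall>n. \<exists>k. k \<in> gauss_span \<and> norm2 ?M (\<lambda>x. u n x - k x) < 1 / real (Suc n)"
  proof
    fix n
    have "1 / real (Suc n) > 0" by simp
    from approximableD(3)[OF approximable_gauss_span[OF \<alpha> u(1) usq] this]
    show "\<exists>k. k \<in> gauss_span \<and> norm2 ?M (\<lambda>x. u n x - k x) < 1 / real (Suc n)" by blast
  qed
  from choice[OF this] obtain s where s: "\<And>n. s n \<in> gauss_span"
      "\<And>n. norm2 ?M (\<lambda>x. u n x - s n x) < 1 / real (Suc n)" by blast
  have ssq: "square_integrable ?M (s n)" and si: "integrable ?M (s n)" for n
    by (rule gauss_span_square_integrable[OF \<alpha> s(1)], rule gauss_span_integrable[OF \<alpha> s(1)])
  have "(\<lambda>n. norm2 ?M (\<lambda>x. s n x - f x)) \<longlonglongrightarrow> 0"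
  proof (rule Lim_null_comparison)
    have "norm2 ?M (\<lambda>x. s n x - f x) \<le> 1 / real (Suc n) + norm2 ?M (\<lambda>x. u n x - f x)" for n
      using norm2_triangle_diff[OF ssq usq fsq, of n n] s(2)[of n] norm2_minus_commute[of ?M "u n" "s n"] by linarith
    then show "\<forall>\<^sub>F n in sequentially. norm (norm2 ?M (\<lambda>x. s n x - f x)) \<le> 1 / real (Suc n) + norm2 ?M (\<lambda>x. u n x - f x)"
      by (intro always_eventually allI) simp
    have "(\<lambda>n. 1 / real (Suc n) + norm2 ?M (\<lambda>x. u n x - f x)) \<longlonglongrightarrow> 0 + 0"
      using u(2) by (intro tendsto_add LIMSEQ_Suc[OF lim_1_over_n]) (simp add: L2_tendsto_altdef)
    then show "(\<lambda>n. 1 / real (Suc n) + norm2 ?M (\<lambda>x. u n x - f x)) \<longlonglongrightarrow> 0" by simp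
  qed
  note slim = this
  have Wspan: "?W (s n) \<in> gauss_span" for n by (rule weinstein_integral_gauss_span[OF \<alpha> s(1)])
  have Wsq: "square_integrable ?M (?W (s n))" for n by (rule gauss_span_square_integrable[OF \<alpha> Wspan])
  have Wg: "norm2 ?M (\<lambda>x. ?W (s n) x - g x) = norm2 ?M (\<lambda>x. s n x - f x)" for n
    by (rule transform_pair_norm2_diff[OF \<alpha> transform_pair_integral[OF \<alpha> si ssq] fg])
  have R: "norm2 ?M (\<lambda>x. ?W (s n) (reflect x) - g (reflect x)) = norm2 ?M (\<lambda>x. s n x - f x)" for n
    using square_integrable_reflect(2)[OF square_integrable_diff[OF Wsq gsq], of n] unfolding Wg .
  show ?thesis
    unfolding transform_pair_def
  proof (intro exI[of _ "\<lambda>n x. ?W (s n) (reflect x)"] conjI allI)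
    show "integrable ?M (\<lambda>x. ?W (s n) (reflect x))" for n
      by (intro gauss_span_integrable gauss_span_reflect \<alpha> Wspan)
    show "L2_tendsto \<alpha> (\<lambda>n x. ?W (s n) (reflect x)) (\<lambda>x. g (reflect x))"
      unfolding L2_tendsto_altdef R using square_integrable_reflect(1) Wsq gsq slim by blast
    have "?W (\<lambda>x. ?W (s n) (reflect x)) = s n" for n
      by (rule ext) (rule weinstein_integral_inverse_gauss_span(1)[OF \<alpha> s(1)])
    then show "L2_tendsto \<alpha> (\<lambda>n. ?W (\<lambda>x. ?W (s n) (reflect x))) f"
      unfolding L2_tendsto_altdef using ssq fsq slim by simp
  qed
qed

lemma scaleR_in_half_space: "\<sigma> > 0 \<Longrightarrow> \<sigma> *\<^sub>R x \<in> half_space \<longleftrightarrow> x \<in> half_space"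
  by (simp add: half_space_def zero_less_mult_iff)

lemma measurable_scaleR_weinstein:
  assumes "\<sigma> > 0"
  shows "(\<lambda>x. \<sigma> *\<^sub>R x) \<in> weinstein_measure \<alpha> \<rightarrow>\<^sub>M weinstein_measure \<alpha>"
proof -
  have "(\<lambda>x. \<sigma> *\<^sub>R x) \<in> lebesgue_on half_space \<rightarrow>\<^sub>M lebesgue_on half_space"
    by (rule measurable_restrict_space3[OF lebesgue_measurable_scaling])
      (use scaleR_in_half_space[OF assms] in auto)
  then show ?thesis unfolding weinstein_measure_altdef by simp
qed

text \<open>A dilation changes Lebesgue measure by a positive constant factor, so preimages of null
  sets are null.\<close>

lemma AE_lebesgue_scaleR:
  fixes P :: "'a::euclidean_space \<Rightarrow> bool"
  assumes \<sigma>: "\<sigma> > 0" and P: "AE x in lebesgue. P x"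
  shows "AE x in lebesgue. P (\<sigma> *\<^sub>R x)"
proof -
  let ?T = "\<lambda>x :: 'a. \<sigma> *\<^sub>R x"
  have T: "?T = (\<lambda>x. 0 + (\<Sum>j\<in>Basis. (\<sigma> * (x \<bullet> j)) *\<^sub>R j))"
  proof
    fix x :: 'a
    have "\<sigma> *\<^sub>R x = \<sigma> *\<^sub>R (\<Sum>j\<in>Basis. (x \<bullet> j) *\<^sub>R j)" by (simp only: euclidean_representation)
    then show "\<sigma> *\<^sub>R x = 0 + (\<Sum>j\<in>Basis. (\<sigma> * (x \<bullet> j)) *\<^sub>R j)"
      by (simp add: scaleR_sum_right del: euclidean_representation)
  qed
  have L: "(lebesgue :: 'a measure) = density (distr lebesgue lebesgue ?T) (\<lambda>_. ennreal (\<Prod>j\<in>(Basis :: 'a set). \<bar>\<sigma>\<bar>))"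
    unfolding T by (rule lebesgue_affine_euclidean) (use \<sigma> in simp)
  \<comment> \<open>The exceptional set is enlarged to a null set N whose complement is visibly
    measurable, as the passage through the image measure requires.\<close>
  obtain N where N: "{x. \<not> P x} \<subseteq> N" "N \<in> null_sets (lebesgue :: 'a measure)"
    using P by (auto simp: eventually_ae_filter)
  have "AE x in (lebesgue :: 'a measure). x \<notin> N" by (rule AE_not_in[OF N(2)])
  then have "AE x in distr lebesgue lebesgue ?T. x \<notin> N"
    using \<sigma> by (subst (asm) L, subst (asm) AE_density) (auto simp: prod_pos)
  moreover have "{x \<in> space lebesgue. x \<notin> N} \<in> sets (lebesgue :: 'a measure)"
  proof -
    have eq: "{x \<in> space lebesgue. x \<notin> N} = space (lebesgue :: 'a measure) - N" by auto
    show ?thesis unfolding eq by (rule sets.compl_sets[OF null_setsD2[OF N(2)]])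
  qed
  ultimately have "AE x in lebesgue. ?T x \<notin> N"
    by (subst (asm) AE_distr_iff[OF lebesgue_measurable_scaling]) auto
  then show ?thesis using N(1) by (auto elim!: eventually_mono)
qed

lemma dilate_Linfinity:
  assumes \<alpha>: "\<alpha> > -1/2" and \<sigma>: "\<sigma> > 0" and m: "m \<in> Linfinity \<alpha>"
  shows "dilate m \<sigma> \<in> Linfinity \<alpha>"
proof -
  have "m \<in> borel_measurable (weinstein_measure \<alpha>)" using m by (simp add: Linfinity_def)
  from measurable_compose[OF measurable_scaleR_weinstein[OF \<sigma>] this]
  have "dilate m \<sigma> \<in> borel_measurable (weinstein_measure \<alpha>)" by (simp add: dilate_def[abs_def])
  moreover obtain C where "AE x in weinstein_measure \<alpha>. cmod (m x) \<le> C"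
    using m by (auto simp: Linfinity_def)
  then have "AE x in lebesgue. x \<in> half_space \<longrightarrow> cmod (m x) \<le> C"
    by (simp only: AE_weinstein_measure_iff[OF \<alpha>])
  from AE_lebesgue_scaleR[OF \<sigma> this]
  have "AE x in weinstein_measure \<alpha>. cmod (dilate m \<sigma> x) \<le> C"
    unfolding AE_weinstein_measure_iff[OF \<alpha>] scaleR_in_half_space[OF \<sigma>] dilate_def .
  ultimately show ?thesis by (auto simp: Linfinity_def)
qed

subsection \<open>The Tikhonov functional\<close>

text \<open>The square is completed in F, with \<open>\<eta> * \<zeta>\<close> in the role of z. The
  remainder is free of F, so it is the pointwise minimum; its integral will be the minimal value J
  of the functional.\<close>

lemma tikhonov_square_identity:
  fixes F H m :: complex and z :: real
  assumes z: "z > 0"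
  defines "D \<equiv> z + (cmod m)\<^sup>2"
  shows "z * (cmod F)\<^sup>2 + (cmod (H - m * F))\<^sup>2 =
    D * (cmod (F - cnj m * H / complex_of_real D))\<^sup>2 + (cmod H)\<^sup>2 * (z / D)"
proof -
  have D: "D > 0" using z by (simp add: D_def add_pos_nonneg)
  define w where "w = cnj m * H"
  have w2: "(cmod w)\<^sup>2 = (cmod m)\<^sup>2 * (cmod H)\<^sup>2" by (simp add: w_def norm_mult power_mult_distrib)
  \<comment> \<open>c is the cross term \<open>Re (F * cnj w)\<close>.\<close>
  define c where "c = Re F * Re w + Im F * Im w"
  have 1: "(cmod (H - m * F))\<^sup>2 = (cmod H)\<^sup>2 - 2 * c + (cmod m)\<^sup>2 * (cmod F)\<^sup>2"
    unfolding c_def w_def cmod_power2 by (simp add: power2_eq_square algebra_simps)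
  have "(cmod (F - w / complex_of_real D))\<^sup>2 = (Re F - Re w / D)\<^sup>2 + (Im F - Im w / D)\<^sup>2"
    unfolding cmod_power2 by (simp add: Re_divide_of_real Im_divide_of_real)
  also have "\<dots> = (cmod F)\<^sup>2 - 2 * c / D + (cmod w)\<^sup>2 / D\<^sup>2"
    unfolding cmod_power2 c_def by (simp add: power2_diff power_divide add_divide_distrib distrib_left)
  finally have "D * (cmod (F - w / complex_of_real D))\<^sup>2 = D * (cmod F)\<^sup>2 - 2 * c + (cmod m)\<^sup>2 * (cmod H)\<^sup>2 / D"
    using D w2 by (simp add: distrib_left right_diff_distrib power2_eq_square)
  moreover have "(cmod m)\<^sup>2 * (cmod H)\<^sup>2 / D + (cmod H)\<^sup>2 * (z / D) = (cmod H)\<^sup>2"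
  proof -
    have "(cmod m)\<^sup>2 * (cmod H)\<^sup>2 / D + (cmod H)\<^sup>2 * (z / D) = (cmod H)\<^sup>2 * (((cmod m)\<^sup>2 + z) / D)"
      by (simp add: add_divide_distrib distrib_left mult.commute)
    also have "(cmod m)\<^sup>2 + z = D" by (simp add: D_def)
    finally show ?thesis using D by simp
  qed
  moreover have "D * (cmod F)\<^sup>2 = z * (cmod F)\<^sup>2 + (cmod m)\<^sup>2 * (cmod F)\<^sup>2"
    by (simp add: D_def distrib_right)
  ultimately show ?thesis unfolding 1 w_def[symmetric] by linarith
qed

theorem theorem3p6:
  fixes \<alpha> \<sigma> \<eta> :: real
    and \<zeta> :: "(real ^ 'd) \<times> real \<Rightarrow> real"
    and m h :: "(real ^ 'd) \<times> real \<Rightarrow> complex"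
  assumes "\<alpha> > - 1 / 2"
    and "\<And>\<xi>. \<xi> \<in> half_space \<Longrightarrow> \<zeta> \<xi> \<ge> 1"
    and "integrable (weinstein_measure \<alpha>) (\<lambda>\<xi>. 1 / \<zeta> \<xi>)"
    and "m \<in> Linfinity \<alpha>"
    and "\<sigma> > 0"
    and "h \<in> L2 \<alpha>"
    and "\<eta> > 0"
  shows "\<exists>\<phi> \<in> H_space \<alpha> \<zeta>.
      tikhonov \<alpha> \<zeta> m \<sigma> \<eta> h \<phi> = (INF \<psi>\<in>H_space \<alpha> \<zeta>. tikhonov \<alpha> \<zeta> m \<sigma> \<eta> h \<psi>) \<and>
      (\<forall>\<psi> \<in> H_space \<alpha> \<zeta>.
         tikhonov \<alpha> \<zeta> m \<sigma> \<eta> h \<psi> = (INF \<psi>'\<in>H_space \<alpha> \<zeta>. tikhonov \<alpha> \<zeta> m \<sigma> \<eta> h \<psi>') \<longrightarrow>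
         (AE x in weinstein_measure \<alpha>. \<psi> x = \<phi> x)) \<and>
      (\<forall>y \<in> half_space.
         (\<forall>x \<in> half_space.
            integrable (weinstein_measure \<alpha>) (theta_integrand \<alpha> \<zeta> m \<sigma> \<eta> x y)) \<and>
         integrable (weinstein_measure \<alpha>) (\<lambda>x. h x * cnj (theta \<alpha> \<zeta> m \<sigma> \<eta> x y)) \<and>
         \<phi> y = (\<integral>x. h x * cnj (theta \<alpha> \<zeta> m \<sigma> \<eta> x y) \<partial>weinstein_measure \<alpha>))"
proof -
  let ?M = "weinstein_measure \<alpha> :: ((real ^ 'd) \<times> real) measure"
  note \<alpha> = assms(1) and \<eta> = assms(7)
  have \<zeta>1: "1 \<le> \<zeta> \<xi>" if "\<xi> \<in> half_space" for \<xi> by (rule assms(2)[OF that])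
  have h: "square_integrable ?M h" using assms(6) by (simp add: L2_iff)
  define \<mu> where "\<mu> = dilate m \<sigma>"
  have "\<mu> \<in> Linfinity \<alpha>" unfolding \<mu>_def by (rule dilate_Linfinity[OF \<alpha> assms(5,4)])
  then obtain C where \<mu>m [measurable]: "\<mu> \<in> borel_measurable ?M" and C: "AE x in ?M. cmod (\<mu> x) \<le> C"
    by (auto simp: Linfinity_def)
  \<comment> \<open>Measurability of \<zeta> is recovered from that of its reciprocal; double
    inversion is the identity even at 0, by the convention \<open>1 / 0 = 0\<close>.\<close>
  have "(\<lambda>\<xi>. 1 / (1 / \<zeta> \<xi>)) \<in> borel_measurable ?M"
    using borel_measurable_integrable[OF assms(3)] by measurable
  then have \<zeta>m [measurable]: "\<zeta> \<in> borel_measurable ?M" by simp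
  define D where "D \<xi> = \<eta> * \<zeta> \<xi> + (cmod (\<mu> \<xi>))\<^sup>2" for \<xi>
  have Dm [measurable]: "D \<in> borel_measurable ?M" unfolding D_def by measurable
  have \<eta>\<zeta>: "\<eta> \<le> \<eta> * \<zeta> \<xi>" "0 < \<eta> * \<zeta> \<xi>" if "\<xi> \<in> half_space" for \<xi>
  proof -
    show "\<eta> \<le> \<eta> * \<zeta> \<xi>" using mult_left_mono[OF \<zeta>1[OF that], of \<eta>] \<eta> by simp
    then show "0 < \<eta> * \<zeta> \<xi>" using \<eta> by linarith
  qed
  have Dpos: "0 < D \<xi>" if "\<xi> \<in> half_space" for \<xi>
    using \<eta>\<zeta>(2)[OF that] by (simp add: D_def add_pos_nonneg)
  \<comment> \<open>One quotient serves both claims: \<open>H * cnj k\<close> will be the transform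
    of the minimiser, and k times the kernel at y the transform of \<open>theta\<close> in its first
    argument.\<close>
  define k where "k \<xi> = \<mu> \<xi> / complex_of_real (D \<xi>)" for \<xi>
  have km [measurable]: "k \<in> borel_measurable ?M" unfolding k_def by measurable
  have k1: "cmod (k \<xi>) \<le> 1 / (2 * sqrt \<eta>) * (1 / sqrt (\<zeta> \<xi>))" if x: "\<xi> \<in> half_space" for \<xi>
  proof -
    have "2 * sqrt (\<eta> * \<zeta> \<xi>) * cmod (\<mu> \<xi>) \<le> (sqrt (\<eta> * \<zeta> \<xi>))\<^sup>2 + (cmod (\<mu> \<xi>))\<^sup>2"
      by (rule sum_squares_bound)
    also have "\<dots> = D \<xi>" using \<eta>\<zeta>(2)[OF x] by (simp add: D_def)
    finally have "cmod (\<mu> \<xi>) / D \<xi> \<le> 1 / (2 * sqrt (\<eta> * \<zeta> \<xi>))"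
      using Dpos[OF x] \<eta>\<zeta>(2)[OF x] by (simp add: field_simps)
    then show ?thesis
      using Dpos[OF x] by (simp add: k_def norm_divide real_sqrt_mult)
  qed
  have k2: "AE \<xi> in ?M. cmod (k \<xi>) \<le> 1 / (2 * sqrt \<eta>) * cmod (complex_of_real (1 / sqrt (\<zeta> \<xi>)))"
  proof (rule AE_I2)
    fix \<xi> assume "\<xi> \<in> space ?M"
    then have x: "\<xi> \<in> half_space" by simp
    show "cmod (k \<xi>) \<le> 1 / (2 * sqrt \<eta>) * cmod (complex_of_real (1 / sqrt (\<zeta> \<xi>)))"
      unfolding norm_of_real using k1[OF x] \<zeta>1[OF x] by simp
  qed
  have "integrable ?M (\<lambda>\<xi>. (cmod (complex_of_real (1 / sqrt (\<zeta> \<xi>))))\<^sup>2)"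
    using assms(3)
  proof (rule Bochner_Integration.integrable_cong[THEN iffD1, rotated 2, OF _ refl])
    fix \<xi> assume "\<xi> \<in> space ?M"
    then have x: "\<xi> \<in> half_space" by simp
    show "1 / \<zeta> \<xi> = (cmod (complex_of_real (1 / sqrt (\<zeta> \<xi>))))\<^sup>2"
      unfolding norm_of_real using \<zeta>1[OF x] by (simp add: power_divide)
  qed
  then have sq\<zeta>: "square_integrable ?M (\<lambda>\<xi>. complex_of_real (1 / sqrt (\<zeta> \<xi>)))"
    by (simp add: square_integrable_def)
  have ksq: "square_integrable ?M k" by (rule square_integrable_bound[OF sq\<zeta> km k2])
  \<comment> \<open>The estimate \<open>k1\<close> yields square integrability only. Integrability
    uses instead the bound C of the multiplier and
    \<open>D \<xi> \<ge> \<eta> * \<zeta> \<xi>\<close>.\<close>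
  have ki: "integrable ?M k"
  proof (rule Bochner_Integration.integrable_bound[OF _ km])
    show "integrable ?M (\<lambda>\<xi>. C / \<eta> * (1 / \<zeta> \<xi>))"
      using assms(3) by (intro integrable_mult_right)
    show "AE \<xi> in ?M. norm (k \<xi>) \<le> norm (C / \<eta> * (1 / \<zeta> \<xi>))"
      using C AE_space
    proof eventually_elim
      case (elim \<xi>)
      then have x: "\<xi> \<in> half_space" by simp
      have "cmod (k \<xi>) = cmod (\<mu> \<xi>) / D \<xi>" using Dpos[OF x] by (simp add: k_def norm_divide)
      also have "\<dots> \<le> C / (\<eta> * \<zeta> \<xi>)"
        using elim(1) \<eta>\<zeta>(2)[OF x] by (intro frac_le) (auto simp: D_def intro: order_trans[OF norm_ge_zero])
      also have "\<dots> = C / \<eta> * (1 / \<zeta> \<xi>)" by simp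
      also have "\<dots> \<le> norm (C / \<eta> * (1 / \<zeta> \<xi>))"
        unfolding real_norm_def by (rule abs_ge_self)
      finally show ?case .
    qed
  qed
  define H where "H = weinstein \<alpha> h"
  have hH: "transform_pair \<alpha> h H" unfolding H_def by (rule transform_pair_weinstein[OF \<alpha> h])
  note Hsq = transform_pair_square_integrable(2)[OF hH]
  have Hm [measurable]: "H \<in> borel_measurable ?M" by (rule square_integrableD(1)[OF Hsq])
  define F where "F \<xi> = H \<xi> * cnj (k \<xi>)" for \<xi>
  have cnjk: "(\<lambda>\<xi>. cnj (k \<xi>)) \<in> borel_measurable ?M"
    by (rule square_integrableD(1)[OF square_integrable_cnj[OF ksq]])
  have Fm [measurable]: "F \<in> borel_measurable ?M"
    unfolding F_def[abs_def] by (rule borel_measurable_times[OF Hm cnjk])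
  have Fi: "integrable ?M F"
    unfolding F_def[abs_def] by (intro square_integrable_mult Hsq square_integrable_cnj ksq)
  have F\<zeta>: "cmod (complex_of_real (sqrt (\<zeta> \<xi>)) * F \<xi>) \<le> 1 / (2 * sqrt \<eta>) * cmod (H \<xi>)"
    "cmod (F \<xi>) \<le> 1 / (2 * sqrt \<eta>) * cmod (H \<xi>)" if x: "\<xi> \<in> half_space" for \<xi>
  proof -
    have s: "1 \<le> sqrt (\<zeta> \<xi>)" using \<zeta>1[OF x] by simp
    have "sqrt (\<zeta> \<xi>) * cmod (k \<xi>) \<le> sqrt (\<zeta> \<xi>) * (1 / (2 * sqrt \<eta>) * (1 / sqrt (\<zeta> \<xi>)))"
      using s by (intro mult_left_mono k1[OF x]) auto
    also have "\<dots> = 1 / (2 * sqrt \<eta>)" using s by simp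
    finally have 1: "sqrt (\<zeta> \<xi>) * cmod (k \<xi>) \<le> 1 / (2 * sqrt \<eta>)" .
    have "cmod (H \<xi>) * (sqrt (\<zeta> \<xi>) * cmod (k \<xi>)) \<le> cmod (H \<xi>) * (1 / (2 * sqrt \<eta>))"
      by (rule mult_left_mono[OF 1]) simp
    moreover have "cmod (complex_of_real (sqrt (\<zeta> \<xi>)) * F \<xi>) = cmod (H \<xi>) * (sqrt (\<zeta> \<xi>) * cmod (k \<xi>))"
      using s by (simp add: F_def norm_mult)
    ultimately show 2: "cmod (complex_of_real (sqrt (\<zeta> \<xi>)) * F \<xi>) \<le> 1 / (2 * sqrt \<eta>) * cmod (H \<xi>)"
      by (simp only: mult.commute)
    have "cmod (F \<xi>) \<le> sqrt (\<zeta> \<xi>) * cmod (F \<xi>)" using mult_right_mono[OF s, of "cmod (F \<xi>)"] by simp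
    also have "\<dots> = cmod (complex_of_real (sqrt (\<zeta> \<xi>)) * F \<xi>)" using s by (simp add: norm_mult)
    finally show "cmod (F \<xi>) \<le> 1 / (2 * sqrt \<eta>) * cmod (H \<xi>)" using 2 by linarith
  qed
  have Fsq: "square_integrable ?M F"
    by (rule square_integrable_bound[OF Hsq Fm, where C = "1 / (2 * sqrt \<eta>)"]) (rule AE_I2, rule F\<zeta>(2), simp)
  have sqrt\<zeta>m: "(\<lambda>\<xi>. complex_of_real (sqrt (\<zeta> \<xi>))) \<in> borel_measurable ?M" by measurable
  have \<zeta>Fsq: "square_integrable ?M (\<lambda>\<xi>. complex_of_real (sqrt (\<zeta> \<xi>)) * F \<xi>)"
    by (rule square_integrable_bound[OF Hsq borel_measurable_times[OF sqrt\<zeta>m Fm], where C = "1 / (2 * sqrt \<eta>)"])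
      (rule AE_I2, rule F\<zeta>(1), simp)

  \<comment> \<open>This representative is given at every y by an absolutely convergent integral, so
    the formula can hold everywhere, although \<open>weinstein \<alpha> \<phi>\<close> is F only
    almost everywhere.\<close>
  define \<phi> where "\<phi> y = weinstein_integral \<alpha> F (reflect y)" for y
  have \<phi>F: "transform_pair \<alpha> \<phi> F"
    unfolding \<phi>_def[abs_def] by (rule transform_pair_inverse[OF \<alpha> transform_pair_integral[OF \<alpha> Fi Fsq]])
  have tp: "transform_pair \<alpha> \<psi> (weinstein \<alpha> \<psi>)" if "\<psi> \<in> H_space \<alpha> \<zeta>" for \<psi>
    using that by (intro transform_pair_weinstein \<alpha>) (simp add: H_space_def L2_iff)
  have \<phi>sq: "square_integrable ?M \<phi>" by (rule transform_pair_square_integrable(1)[OF \<phi>F])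
  have W\<phi>: "AE \<xi> in ?M. weinstein \<alpha> \<phi> \<xi> = F \<xi>"
    by (rule transform_pair_unique_right[OF \<alpha> transform_pair_weinstein[OF \<alpha> \<phi>sq] \<phi>F])
  have W\<phi>m: "weinstein \<alpha> \<phi> \<in> borel_measurable ?M"
    by (rule square_integrableD(1)[OF transform_pair_square_integrable(2)[OF transform_pair_weinstein[OF \<alpha> \<phi>sq]]])
  have \<phi>H: "\<phi> \<in> H_space \<alpha> \<zeta>"
  proof -
    have "square_integrable ?M (\<lambda>\<xi>. complex_of_real (sqrt (\<zeta> \<xi>)) * weinstein \<alpha> \<phi> \<xi>)"
    proof (rule square_integrable_cong_AE[OF \<zeta>Fsq borel_measurable_times[OF sqrt\<zeta>m W\<phi>m]])
      show "AE \<xi> in ?M. complex_of_real (sqrt (\<zeta> \<xi>)) * F \<xi> = complex_of_real (sqrt (\<zeta> \<xi>)) * weinstein \<alpha> \<phi> \<xi>"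
        using W\<phi> by eventually_elim simp
    qed
    then show ?thesis using \<phi>sq by (simp add: H_space_def L2_iff)
  qed

  define J where "J = (\<integral>\<xi>. (cmod (H \<xi>))\<^sup>2 * (\<eta> * \<zeta> \<xi> / D \<xi>) \<partial>?M)"
  have Ji: "integrable ?M (\<lambda>\<xi>. (cmod (H \<xi>))\<^sup>2 * (\<eta> * \<zeta> \<xi> / D \<xi>))"
  proof (rule Bochner_Integration.integrable_bound[OF square_integrableD(2)[OF Hsq]])
    show "AE \<xi> in ?M. norm ((cmod (H \<xi>))\<^sup>2 * (\<eta> * \<zeta> \<xi> / D \<xi>)) \<le> norm ((cmod (H \<xi>))\<^sup>2)"
    proof (rule AE_I2)
      fix \<xi> assume "\<xi> \<in> space ?M"
      then have x: "\<xi> \<in> half_space" by simp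
      have "0 \<le> \<eta> * \<zeta> \<xi> / D \<xi>" "\<eta> * \<zeta> \<xi> / D \<xi> \<le> 1"
        using \<eta>\<zeta>(2)[OF x] Dpos[OF x] by (simp_all add: D_def)
      then have "\<bar>\<eta> * \<zeta> \<xi> / D \<xi>\<bar> \<le> 1" by (simp only: abs_of_nonneg)
      from mult_left_mono[OF this, of "\<bar>(cmod (H \<xi>))\<^sup>2\<bar>"]
      show "norm ((cmod (H \<xi>))\<^sup>2 * (\<eta> * \<zeta> \<xi> / D \<xi>)) \<le> norm ((cmod (H \<xi>))\<^sup>2)"
        by (simp only: real_norm_def abs_mult[of "(cmod (H \<xi>))\<^sup>2"] abs_ge_zero mult_1_right simp_thms)
    qed
  qed measurable

  \<comment> \<open>All dependence on \<psi> sits in a weighted squared distance from F.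
    Integrability is recorded too: the integral of a non-integrable function is 0 by convention, so
    a zero integral alone would not force equality with F.\<close>
  have tik: "integrable ?M (\<lambda>\<xi>. D \<xi> * (cmod (weinstein \<alpha> \<psi> \<xi> - F \<xi>))\<^sup>2) \<and>
    tikhonov \<alpha> \<zeta> m \<sigma> \<eta> h \<psi> = (\<integral>\<xi>. D \<xi> * (cmod (weinstein \<alpha> \<psi> \<xi> - F \<xi>))\<^sup>2 \<partial>?M) + J"
    if \<psi>: "\<psi> \<in> H_space \<alpha> \<zeta>" for \<psi>
  proof -
    define P where "P = weinstein \<alpha> \<psi>"
    note \<psi>P = tp[OF \<psi>, folded P_def]
    note Psq = transform_pair_square_integrable(2)[OF \<psi>P]
    have Pm [measurable]: "P \<in> borel_measurable ?M" by (rule square_integrableD(1)[OF Psq])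
    define G where "G \<xi> = \<mu> \<xi> * P \<xi>" for \<xi>
    have Gm [measurable]: "G \<in> borel_measurable ?M" unfolding G_def by measurable
    have Gsq: "square_integrable ?M G"
    proof (rule square_integrable_bound[OF Psq Gm, where C = C])
      show "AE \<xi> in ?M. cmod (G \<xi>) \<le> C * cmod (P \<xi>)"
        using C by eventually_elim (simp add: G_def norm_mult mult_right_mono)
    qed
    have T: "multiplier_op \<alpha> m \<sigma> \<psi> = (\<lambda>x. weinstein \<alpha> G (reflect x))"
      by (simp add: multiplier_op_def inverse_weinstein_def[abs_def] G_def[abs_def] P_def \<mu>_def)
    \<comment> \<open>By inversion the image of \<psi> under the multiplier operator has transform
      G, so the isometry moves the data term to the transform side.\<close>
    have "transform_pair \<alpha> (multiplier_op \<alpha> m \<sigma> \<psi>) G"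
      unfolding T by (rule transform_pair_inverse[OF \<alpha> transform_pair_weinstein[OF \<alpha> Gsq]])
    from transform_pair_norm2_diff[OF \<alpha> hH this]
    have n: "L2_norm \<alpha> (\<lambda>x. h x - multiplier_op \<alpha> m \<sigma> \<psi> x) = norm2 ?M (\<lambda>\<xi>. H \<xi> - G \<xi>)"
      by (simp add: L2_norm_altdef)
    have HG: "square_integrable ?M (\<lambda>\<xi>. H \<xi> - G \<xi>)" by (rule square_integrable_diff[OF Hsq Gsq])
    have "square_integrable ?M (\<lambda>\<xi>. complex_of_real (sqrt (\<zeta> \<xi>)) * P \<xi>)"
      using \<psi> by (simp add: H_space_def L2_iff P_def)
    from square_integrableD(2)[OF this]
    have \<zeta>P: "integrable ?M (\<lambda>\<xi>. \<zeta> \<xi> * (cmod (P \<xi>))\<^sup>2)"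
    proof (rule Bochner_Integration.integrable_cong[THEN iffD1, rotated 2, OF _ refl])
      fix \<xi> assume "\<xi> \<in> space ?M"
      then have "1 \<le> \<zeta> \<xi>" by (intro \<zeta>1) simp
      then show "(cmod (complex_of_real (sqrt (\<zeta> \<xi>)) * P \<xi>))\<^sup>2 = \<zeta> \<xi> * (cmod (P \<xi>))\<^sup>2"
        by (simp add: norm_mult power_mult_distrib)
    qed
    have "H_inner \<alpha> \<zeta> \<psi> \<psi> = (\<integral>\<xi>. complex_of_real (\<zeta> \<xi> * (cmod (P \<xi>))\<^sup>2) \<partial>?M)"
      unfolding H_inner_def P_def[symmetric]
      by (intro Bochner_Integration.integral_cong refl)
        (simp only: of_real_mult complex_norm_square mult.assoc)
    then have "H_inner \<alpha> \<zeta> \<psi> \<psi> = complex_of_real (\<integral>\<xi>. \<zeta> \<xi> * (cmod (P \<xi>))\<^sup>2 \<partial>?M)"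
      by (simp only: integral_complex_of_real)
    moreover have "0 \<le> (\<integral>\<xi>. \<zeta> \<xi> * (cmod (P \<xi>))\<^sup>2 \<partial>?M)"
    proof (rule Bochner_Integration.integral_nonneg)
      fix \<xi> assume "\<xi> \<in> space ?M"
      then have "1 \<le> \<zeta> \<xi>" by (intro \<zeta>1) simp
      then show "0 \<le> \<zeta> \<xi> * (cmod (P \<xi>))\<^sup>2" by simp
    qed
    ultimately have N: "(H_norm \<alpha> \<zeta> \<psi>)\<^sup>2 = (\<integral>\<xi>. \<zeta> \<xi> * (cmod (P \<xi>))\<^sup>2 \<partial>?M)"
      by (simp add: H_norm_def)
    have L: "integrable ?M (\<lambda>\<xi>. \<eta> * (\<zeta> \<xi> * (cmod (P \<xi>))\<^sup>2) + (cmod (H \<xi> - G \<xi>))\<^sup>2)"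
      using \<zeta>P square_integrableD(2)[OF HG] by simp
    have t: "tikhonov \<alpha> \<zeta> m \<sigma> \<eta> h \<psi> = (\<integral>\<xi>. \<eta> * (\<zeta> \<xi> * (cmod (P \<xi>))\<^sup>2) + (cmod (H \<xi> - G \<xi>))\<^sup>2 \<partial>?M)"
      unfolding tikhonov_def n N norm2_square using \<zeta>P square_integrableD(2)[OF HG] by simp
    have id: "\<eta> * (\<zeta> \<xi> * (cmod (P \<xi>))\<^sup>2) + (cmod (H \<xi> - G \<xi>))\<^sup>2 =
        D \<xi> * (cmod (P \<xi> - F \<xi>))\<^sup>2 + (cmod (H \<xi>))\<^sup>2 * (\<eta> * \<zeta> \<xi> / D \<xi>)" if "\<xi> \<in> space ?M" for \<xi>
    proof -
      have x: "\<xi> \<in> half_space" using that by simp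
      have "F \<xi> = cnj (\<mu> \<xi>) * H \<xi> / complex_of_real (D \<xi>)" by (simp add: F_def k_def)
      then show ?thesis
        using tikhonov_square_identity[OF \<eta>\<zeta>(2)[OF x], of "P \<xi>" "H \<xi>" "\<mu> \<xi>"]
        by (simp add: D_def G_def mult.assoc)
    qed
    have "integrable ?M (\<lambda>\<xi>. D \<xi> * (cmod (P \<xi> - F \<xi>))\<^sup>2 + (cmod (H \<xi>))\<^sup>2 * (\<eta> * \<zeta> \<xi> / D \<xi>))"
      using L by (rule Bochner_Integration.integrable_cong[THEN iffD1, rotated 2, OF _ refl]) (rule id)
    from Bochner_Integration.integrable_diff[OF this Ji]
    have DP: "integrable ?M (\<lambda>\<xi>. D \<xi> * (cmod (P \<xi> - F \<xi>))\<^sup>2)" by simp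
    have "tikhonov \<alpha> \<zeta> m \<sigma> \<eta> h \<psi> = (\<integral>\<xi>. D \<xi> * (cmod (P \<xi> - F \<xi>))\<^sup>2 + (cmod (H \<xi>))\<^sup>2 * (\<eta> * \<zeta> \<xi> / D \<xi>) \<partial>?M)"
      unfolding t by (rule Bochner_Integration.integral_cong[OF refl id])
    also have "\<dots> = (\<integral>\<xi>. D \<xi> * (cmod (P \<xi> - F \<xi>))\<^sup>2 \<partial>?M) + J"
      unfolding J_def by (rule Bochner_Integration.integral_add[OF DP Ji])
    finally show ?thesis using DP unfolding P_def by blast
  qed
  have D0: "0 \<le> D \<xi> * (cmod z)\<^sup>2" if "\<xi> \<in> space ?M" for \<xi> z
    using Dpos[of \<xi>] that by simp
  have tik\<phi>: "tikhonov \<alpha> \<zeta> m \<sigma> \<eta> h \<phi> = J"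
  proof -
    have "(\<integral>\<xi>. D \<xi> * (cmod (weinstein \<alpha> \<phi> \<xi> - F \<xi>))\<^sup>2 \<partial>?M) = 0"
      using W\<phi> by (intro integral_eq_zero_AE) (auto elim!: eventually_mono)
    then show ?thesis using tik[OF \<phi>H] by simp
  qed
  have ge: "J \<le> tikhonov \<alpha> \<zeta> m \<sigma> \<eta> h \<psi>" if "\<psi> \<in> H_space \<alpha> \<zeta>" for \<psi>
    using tik[OF that] Bochner_Integration.integral_nonneg[OF D0, of ?M] by simp
  have INF: "(INF \<psi>\<in>H_space \<alpha> \<zeta>. tikhonov \<alpha> \<zeta> m \<sigma> \<eta> h \<psi>) = J"
    by (rule cInf_eq_minimum) (use \<phi>H tik\<phi> ge in auto)
  have unique: "AE x in ?M. \<psi> x = \<phi> x" if \<psi>: "\<psi> \<in> H_space \<alpha> \<zeta>" "tikhonov \<alpha> \<zeta> m \<sigma> \<eta> h \<psi> = J" for \<psi>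
  proof -
    have "(\<integral>\<xi>. D \<xi> * (cmod (weinstein \<alpha> \<psi> \<xi> - F \<xi>))\<^sup>2 \<partial>?M) = 0"
      using tik[OF \<psi>(1)] \<psi>(2) by simp
    then have "AE \<xi> in ?M. D \<xi> * (cmod (weinstein \<alpha> \<psi> \<xi> - F \<xi>))\<^sup>2 = 0"
      using tik[OF \<psi>(1)] by (subst (asm) integral_nonneg_eq_0_iff_AE) (auto intro!: AE_I2 D0)
    with AE_space have "AE \<xi> in ?M. weinstein \<alpha> \<psi> \<xi> = F \<xi>"
    proof eventually_elim
      case (elim \<xi>)
      then show ?case using Dpos[of \<xi>] by simp
    qed
    then show ?thesis by (rule transform_pair_cong_left[OF \<alpha> tp[OF \<psi>(1)] \<phi>F])
  qed
  have formula: "(\<forall>x\<in>half_space. integrable ?M (theta_integrand \<alpha> \<zeta> m \<sigma> \<eta> x y)) \<and>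
     integrable ?M (\<lambda>x. h x * cnj (theta \<alpha> \<zeta> m \<sigma> \<eta> x y)) \<and>
     \<phi> y = (\<integral>x. h x * cnj (theta \<alpha> \<zeta> m \<sigma> \<eta> x y) \<partial>?M)" for y
  proof -
    \<comment> \<open>As a function of x, \<open>theta\<close> is the inverse transform of G: the
      reflected x in the integrand is the reflection of the inversion formula.\<close>
    define G where "G \<xi> = k \<xi> * weinstein_kernel \<alpha> y \<xi>" for \<xi>
    have Gi: "integrable ?M G"
      unfolding G_def[abs_def] by (rule integrable_mult_weinstein_kernel[OF \<alpha> ki])
    have Gsq: "square_integrable ?M G"
    proof (rule square_integrable_bound[OF ksq borel_measurable_integrable[OF Gi], where C = 1])
      have "cmod (k \<xi>) * cmod (weinstein_kernel \<alpha> y \<xi>) \<le> cmod (k \<xi>) * 1" for \<xi>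
        by (intro mult_left_mono norm_weinstein_kernel_le \<alpha>) simp
      then show "AE \<xi> in ?M. cmod (G \<xi>) \<le> 1 * cmod (k \<xi>)"
        by (intro AE_I2) (simp add: G_def norm_mult)
    qed
    have ti: "theta_integrand \<alpha> \<zeta> m \<sigma> \<eta> x y = (\<lambda>\<xi>. G \<xi> * weinstein_kernel \<alpha> (reflect x) \<xi>)" for x
      by (simp add: fun_eq_iff theta_integrand_def G_def k_def D_def \<mu>_def)
    have th: "theta \<alpha> \<zeta> m \<sigma> \<eta> x y = weinstein_integral \<alpha> G (reflect x)" for x
      by (simp add: theta_def ti weinstein_integral_def)
    have \<theta>G: "transform_pair \<alpha> (\<lambda>x. theta \<alpha> \<zeta> m \<sigma> \<eta> x y) G"
      unfolding th by (rule transform_pair_inverse[OF \<alpha> transform_pair_integral[OF \<alpha> Gi Gsq]])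
    have "integrable ?M (theta_integrand \<alpha> \<zeta> m \<sigma> \<eta> x y)" for x
      unfolding ti by (rule integrable_mult_weinstein_kernel[OF \<alpha> Gi])
    moreover have "integrable ?M (\<lambda>x. h x * cnj (theta \<alpha> \<zeta> m \<sigma> \<eta> x y))"
      by (intro square_integrable_mult h square_integrable_cnj transform_pair_square_integrable(1)[OF \<theta>G])
    \<comment> \<open>Parseval leaves the integral of \<open>H * cnj G\<close>. Conjugating the
      kernel at y reflects y, so this is the transform of F at \<open>reflect y\<close>.\<close>
    moreover have "(\<integral>x. h x * cnj (theta \<alpha> \<zeta> m \<sigma> \<eta> x y) \<partial>?M) = \<phi> y"
      unfolding transform_pair_inner[OF \<alpha> hH \<theta>G] \<phi>_def weinstein_integral_def
      by (intro Bochner_Integration.integral_cong refl) (simp add: G_def F_def weinstein_kernel_reflect)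
    ultimately show ?thesis by simp
  qed
  show ?thesis
    unfolding INF using \<phi>H tik\<phi> unique formula by blast
qed

end
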